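(* Let $\varepsilon>0$ be a constant, let $t\ge 1$ be any constant and let $W\ge 2$ be an integer. There exists a randomized single-pass dynamic streaming algorithm that, for a connected graph $G$ on vertex set $[n]$ whose edges have integer weights in $\{1,2,\dots,W\}$, computes a $(1+\varepsilon)$-approximation of the weight of a minimum spanning tree of $G$, using space and post-processing time $O\!\left(e^t W n^{1-\frac{\varepsilon}{W-1}+\frac{\varepsilon^t}{(W-1)^t}}\,\mathrm{poly}\log n\right)$.
   Context: In the dynamic streaming model, the input (weighted) graph on the fixed vertex set $[n]$ is defined by a sequence of edge insertions and deletions (each with its weight); the algorithm makes a single pass over the stream. Post-processing time is the time needed after the stream ends to produce the output. The algorithm is randomized and succeeds with constant probability. A $(1+\varepsilon)$-approximation of a quantity $X>0$ is a value $Y$ with $|Y-X|\le \varepsilon X$. *)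

theory Defs
  imports "HOL-Probability.Probability" "HOL-Library.Log_Nat"
begin

section \<open>A probabilistic random access machine with logarithmic costs\<close>

text \<open>
  Memory cells are indexed by, and contain, natural numbers of arbitrary size; all costs are
  measured in bits. Working memory, random bits that are to be used again, and everything that is
  remembered between stream items live in the memory. Programs are finite and have no other store.
\<close>

type_synonym memory = "nat \<Rightarrow> nat"

datatype arith = Add | Sub | Mult | Div | Mod

fun arith_op :: "arith \<Rightarrow> nat \<Rightarrow> nat \<Rightarrow> nat" where
  "arith_op Add a b = a + b"
| "arith_op Sub a b = a - b"
| "arith_op Mult a b = a * b"
| "arith_op Div a b = a div b"
| "arith_op Mod a b = a mod b"

text \<open>
  Writing \<open>M\<close> for the memory: \<open>Const x c\<close> is \<open>M[x] := c\<close>, \<open>Arith f x y z\<close> is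
  \<open>M[x] := f M[y] M[z]\<close>, \<open>Load x y\<close> is \<open>M[x] := M[M[y]]\<close>, \<open>Store x y\<close> is \<open>M[M[x]] := M[y]\<close>, and
  \<open>Flip x\<close> sets \<open>M[x]\<close> to a fresh fair coin flip. \<open>Cond\<close> and \<open>While\<close> test \<open>M[x] \<noteq> 0\<close>.
\<close>

datatype program =
    Skip
  | Const nat nat
  | Arith arith nat nat nat
  | Load nat nat
  | Store nat nat
  | Flip nat
  | Seq program program
  | Cond nat program program
  | While nat program

definition bits :: "nat \<Rightarrow> nat" where
  "bits a = max 1 (floorlog 2 a)"

text \<open>
  The memory is described by the list of its nonzero cells. The addresses are charged as well, so
  that no information can be hidden in the choice of the cells.
\<close>

definition memory_bits :: "memory \<Rightarrow> nat" where
  "memory_bits M = (\<Sum>a | M a \<noteq> 0. bits a + bits (M a))"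

text \<open>\<open>peak\<close> is the largest number of memory bits in use so far.\<close>

record config =
  mem :: memory
  time :: nat
  peak :: nat

definition set_mem :: "memory \<Rightarrow> config \<Rightarrow> config" where
  "set_mem M s = s\<lparr>mem := M, peak := max (peak s) (memory_bits M)\<rparr>"

definition charge :: "nat \<Rightarrow> config \<Rightarrow> config" where
  "charge c s = s\<lparr>time := time s + c\<rparr>"

text \<open>Assignment of \<open>v\<close> to cell \<open>a\<close>, where \<open>c\<close> is the cost of determining \<open>a\<close> and \<open>v\<close>.\<close>

definition assign :: "nat \<Rightarrow> nat \<Rightarrow> nat \<Rightarrow> config \<Rightarrow> config" where
  "assign c a v s = set_mem ((mem s)(a := v)) (charge (c + bits a + bits v) s)"

definition read_cost :: "nat \<Rightarrow> config \<Rightarrow> nat" where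
  "read_cost a s = bits a + bits (mem s a)"

text \<open>The missing probability mass of a subprobability mass function is that of divergence.\<close>

partial_function (spmf) loop :: "nat \<Rightarrow> (config \<Rightarrow> config spmf) \<Rightarrow> config \<Rightarrow> config spmf" where
  "loop x body s =
    (if mem s x \<noteq> 0
     then bind_spmf (body (charge (read_cost x s) s)) (loop x body)
     else return_spmf (charge (read_cost x s) s))"

primrec exec :: "program \<Rightarrow> config \<Rightarrow> config spmf" where
  "exec Skip s = return_spmf s"
| "exec (Const x c) s = return_spmf (assign 0 x c s)"
| "exec (Arith f x y z) s =
     return_spmf (assign (read_cost y s + read_cost z s) x (arith_op f (mem s y) (mem s z)) s)"
| "exec (Load x y) s =
     return_spmf (assign (read_cost y s + read_cost (mem s y) s) x (mem s (mem s y)) s)"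
| "exec (Store x y) s =
     return_spmf (assign (read_cost x s + read_cost y s) (mem s x) (mem s y) s)"
| "exec (Flip x) s = map_spmf (\<lambda>b. assign 0 x (of_bool b) s) coin_spmf"
| "exec (Seq p q) s = bind_spmf (exec p s) (exec q)"
| "exec (Cond x p q) s =
     (if mem s x \<noteq> 0 then exec p (charge (read_cost x s) s) else exec q (charge (read_cost x s) s))"
| "exec (While x p) s = loop x (exec p) s"


section \<open>Dynamic graph streams\<close>

text \<open>
  A weighted graph on a fixed vertex set maps each of its edges, which are two-element sets of
  vertices, to its weight, and everything else to \<open>None\<close>.
\<close>

type_synonym wgraph = "nat set \<Rightarrow> nat option"

datatype stream_item = Insertion nat nat nat | Deletion nat nat nat

fun apply_item :: "stream_item \<Rightarrow> wgraph \<Rightarrow> wgraph" where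
  "apply_item (Insertion u v w) g = g({u, v} := Some w)"
| "apply_item (Deletion u v w) g = g({u, v} := None)"

definition final_graph :: "stream_item list \<Rightarrow> wgraph" where
  "final_graph xs = fold apply_item xs (\<lambda>_. None)"

text \<open>
  Only absent edges are inserted, and only present edges are deleted, together with the weight they
  have. The end points come in any order.
\<close>

fun valid_item :: "nat \<Rightarrow> nat \<Rightarrow> wgraph \<Rightarrow> stream_item \<Rightarrow> bool" where
  "valid_item n W g (Insertion u v w) \<longleftrightarrow>
     u \<in> {1..n} \<and> v \<in> {1..n} \<and> u \<noteq> v \<and> w \<in> {1..W} \<and> g {u, v} = None"
| "valid_item n W g (Deletion u v w) \<longleftrightarrow> u \<noteq> v \<and> g {u, v} = Some w"

definition valid_stream :: "nat \<Rightarrow> nat \<Rightarrow> stream_item list \<Rightarrow> bool" where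
  "valid_stream n W xs \<longleftrightarrow>
     (\<forall>i < length xs. valid_item n W (final_graph (take i xs)) (xs ! i))"


section \<open>Minimum spanning trees\<close>

definition graph_connected :: "nat set \<Rightarrow> nat set set \<Rightarrow> bool" where
  "graph_connected V E \<longleftrightarrow> V \<noteq> {} \<and> (\<forall>u \<in> V. \<forall>v \<in> V. (u, v) \<in> {(x, y). {x, y} \<in> E}\<^sup>*)"

definition graph_cycle :: "nat set set \<Rightarrow> nat list \<Rightarrow> bool" where
  "graph_cycle E p \<longleftrightarrow> length p \<ge> 3 \<and> distinct p \<and>
     (\<forall>i < length p. {p ! i, p ! (Suc i mod length p)} \<in> E)"

definition spanning_tree :: "nat set \<Rightarrow> nat set set \<Rightarrow> nat set set \<Rightarrow> bool" where
  "spanning_tree V E T \<longleftrightarrow> T \<subseteq> E \<and> graph_connected V T \<and> (\<nexists>p. graph_cycle T p)"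

definition mst_weight :: "nat \<Rightarrow> wgraph \<Rightarrow> nat" where
  "mst_weight n g = Min ((\<lambda>T. \<Sum>e \<in> T. the (g e)) ` {T. spanning_tree {1..n} (dom g) T})"


section \<open>Streaming algorithms\<close>

text \<open>
  The initial program runs before the stream starts, with the number of vertices in cell 0. For each
  stream item, the item is written to the cells 0 to 3 and the step program is run. The
  post-processing program runs after the end of the stream; it leaves the numerator and the denominator
  of the output in the cells 0 and 1.
\<close>

datatype stream_algorithm =
  Stream_Algorithm (init_prog: program) (step_prog: program) (post_prog: program)

definition start_config :: "nat \<Rightarrow> config" where
  "start_config n = set_mem ((\<lambda>_. 0)(0 := n)) \<lparr>mem = (\<lambda>_. 0), time = 0, peak = 0\<rparr>"

fun read_item :: "stream_item \<Rightarrow> config \<Rightarrow> config" where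
  "read_item (Insertion u v w) s = set_mem ((mem s)(0 := 1, 1 := u, 2 := v, 3 := w)) s"
| "read_item (Deletion u v w) s = set_mem ((mem s)(0 := 0, 1 := u, 2 := v, 3 := w)) s"

primrec process_stream :: "program \<Rightarrow> stream_item list \<Rightarrow> config \<Rightarrow> config spmf" where
  "process_stream p [] s = return_spmf s"
| "process_stream p (x # xs) s = bind_spmf (exec p (read_item x s)) (process_stream p xs)"

text \<open>
  The clock is reset when the stream ends, so that in the final configuration \<open>time\<close> is the
  post-processing time, whereas \<open>peak\<close> is the space used during the whole computation.
\<close>

definition run_stream :: "stream_algorithm \<Rightarrow> nat \<Rightarrow> stream_item list \<Rightarrow> config spmf" where
  "run_stream A n xs =
     bind_spmf (exec (init_prog A) (start_config n))
       (\<lambda>s. bind_spmf (process_stream (step_prog A) xs s)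
         (\<lambda>s'. exec (post_prog A) (s'\<lparr>time := 0\<rparr>)))"

definition result :: "config \<Rightarrow> real" where
  "result s = real (mem s 0) / real (mem s 1)"

definition approximates :: "real \<Rightarrow> real \<Rightarrow> real \<Rightarrow> bool" where
  "approximates \<epsilon> X Y \<longleftrightarrow> \<bar>Y - X\<bar> \<le> \<epsilon> * X"

end

theory Submission
  imports Defs "HOL-Computational_Algebra.Primes" "HOL-Computational_Algebra.Polynomial"
    "HOL-Library.Nat_Bijection"
begin

text \<open>
  If \<open>c\<^sub>j\<close> is the number of connected components of the subgraph of the edges of weight at most \<open>j\<close>,
  then the minimum spanning tree weighs \<open>(n - 1) + (\<Sum>j = 1..<W. c\<^sub>j - 1)\<close>, so it suffices to estimate
  each \<open>c\<^sub>j\<close> up to \<open>x (n - 1)\<close>, where \<open>x = \<epsilon> / (W - 1)\<close>. At most \<open>n / (L + 1) < x n\<close> components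
  have more than \<open>L = \<lfloor>1 / x\<rfloor>\<close> vertices, and guessing half of that bound for their number costs at
  most half of the allowed error. To count the others, every vertex is sampled with probability
  \<open>2\<^sup>-\<^sup>a \<approx> n\<^sup>-\<^sup>1\<^sup>/\<^sup>L\<close>; a component \<open>C\<close> survives with probability \<open>2\<^sup>-\<^sup>a\<^sup>|\<^sup>C\<^sup>|\<close> and is then counted with weight
  \<open>2\<^sup>a\<^sup>|\<^sup>C\<^sup>|\<close>, and Chebyshev's inequality applies.

  For every sampled vertex and every threshold only a linear fingerprint of its incidence vector is
  kept, the value at a random point of a polynomial modulo a prime whose coefficients are the signed
  incidences. The fingerprints of a vertex set sum up to the polynomial of the edges that leave the
  set; so, up to a small error probability, the components are the minimal sets with sum zero. Since
  only space and post-processing time are restricted, these sets are found by exhaustive search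
  after each stream item, and the post-processing merely copies the answer.

  If \<open>n < 2\<^sup>W\<close>, then \<open>n\<^sup>x\<close> is bounded and nothing is sampled away. Here the weights are
  rounded to powers of \<open>1 + \<epsilon> / 2\<close>, which leaves \<open>O(log W)\<close> thresholds and saves a factor of \<open>W\<close>.
  For \<open>\<epsilon> \<ge> 1\<close> the answer \<open>0\<close> is good enough.
\<close>


section \<open>Components and spanning trees\<close>

text \<open>The constant may depend neither on \<open>W\<close> nor on \<open>t\<close>, and this
  forces the two regimes. Chebyshev's inequality tolerates a variance of order n * 2^(a * L) against
  a deviation of order x * n, so 2^(a * L) may be as large as n up to a factor polynomial in
  \<open>W\<close>; since L \<le> 1 / x, the sample then has about n^(1 - x) vertices, up to such a
  factor. For 2^W \<le> n every power of \<open>W\<close> is bounded by a power of log n and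
  disappears in the polylogarithm. For smaller n only a single factor \<open>W\<close> may be lost
  in the product of sample size, number of thresholds and bits per fingerprint. This is delicate
  because the fingerprints must be correct for all sets of at most L vertices at once: the union
  bound over about n^L sets requires primes of about L * log n bits, with L proportional to
  \<open>W\<close>. Random bits that are used again are charged as space, so the sample and the
  evaluation point are stored explicitly.\<close>

definition adj :: "nat set set \<Rightarrow> (nat \<times> nat) set" where
  "adj E = {(x, y). {x, y} \<in> E}"

definition component :: "nat set set \<Rightarrow> nat \<Rightarrow> nat set" where
  "component E u = {v. (u, v) \<in> (adj E)\<^sup>*}"

definition components :: "nat set \<Rightarrow> nat set set \<Rightarrow> nat set set" where
  "components V E = component E ` V"

definition closed_under :: "nat set set \<Rightarrow> nat set \<Rightarrow> bool" where
  "closed_under E U \<longleftrightarrow> (\<forall>x y. {x, y} \<in> E \<longrightarrow> x \<in> U \<longrightarrow> y \<in> U)"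

lemma component_refl [simp]: "u \<in> component E u"
  by (simp add: component_def)

lemma sym_adj: "sym (adj E)"
  by (auto simp: sym_def adj_def insert_commute)

lemma component_sym: "v \<in> component E u \<Longrightarrow> u \<in> component E v"
  using sym_rtrancl[OF sym_adj[of E]] by (auto simp: component_def sym_def)

lemma component_trans: "v \<in> component E u \<Longrightarrow> w \<in> component E v \<Longrightarrow> w \<in> component E u"
  by (auto simp: component_def)

lemma component_eq: "v \<in> component E u \<Longrightarrow> component E v = component E u"
  using component_sym component_trans by blast

lemma component_disjoint: "component E u \<noteq> component E v \<Longrightarrow> component E u \<inter> component E v = {}"
  by (metis component_eq disjoint_iff)

lemma component_mono: "E \<subseteq> E' \<Longrightarrow> component E u \<subseteq> component E' u"
  unfolding component_def adj_def by (auto elim!: rtrancl_mono[THEN subsetD, rotated])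

lemma closed_under_component: "closed_under E (component E u)"
  by (auto simp: closed_under_def component_def adj_def intro: rtrancl_into_rtrancl)

lemma component_subset_closed:
  assumes "closed_under E U" "u \<in> U"
  shows "component E u \<subseteq> U"
proof
  fix v assume "v \<in> component E u"
  then have "(u, v) \<in> (adj E)\<^sup>*" by (simp add: component_def)
  then show "v \<in> U"
    by (induction rule: rtrancl_induct) (use assms in \<open>auto simp: closed_under_def adj_def\<close>)
qed

lemma component_edge: "{x, y} \<in> E \<Longrightarrow> y \<in> component E x"
  by (auto simp: component_def adj_def)

text \<open>One inclusion is monotonicity together with the new edge. For the other, the right-hand
  side is closed under the enlarged edge set and contains \<open>x\<close>, so it contains the
  component.\<close>

lemma component_insert:
  "component (insert {u, v} E) x =
    (if u \<in> component E x \<or> v \<in> component E x then component E u \<union> component E v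
     else component E x)" (is "_ = ?R")
proof
  let ?E = "insert {u, v} E"
  have mono: "component E y \<subseteq> component ?E y" for y by (rule component_mono) auto
  have uv: "v \<in> component ?E u" "u \<in> component ?E v"
    by (auto intro!: component_edge simp: insert_commute)
  show "?R \<subseteq> component ?E x"
  proof (cases "u \<in> component E x \<or> v \<in> component E x")
    case True
    then have "u \<in> component ?E x \<or> v \<in> component ?E x" using mono by blast
    then have "component ?E u = component ?E x" "component ?E v = component ?E x"
      using component_eq uv by blast+
    then show ?thesis using True mono[of u] mono[of v] by simp
  next
    case False
    then show ?thesis using mono by simp
  qed
  have "closed_under ?E ?R"
    unfolding closed_under_def
  proof (intro allI impI)
    fix y z assume yz: "{y, z} \<in> ?E" "y \<in> ?R"
    show "z \<in> ?R"
    proof (cases "{y, z} \<in> E")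
      case True
      have "closed_under E (component E u \<union> component E v)"
        using closed_under_component[of E u] closed_under_component[of E v]
        unfolding closed_under_def by blast
      then have "closed_under E ?R"
        using closed_under_component[of E x] by simp
      then show ?thesis using True yz(2) unfolding closed_under_def by blast
    next
      case False
      then have "(y = u \<and> z = v) \<or> (y = v \<and> z = u)" using yz(1) by (auto simp: doubleton_eq_iff)
      then show ?thesis using yz(2) by (auto split: if_splits)
    qed
  qed
  moreover have "x \<in> ?R"
    using component_sym by auto
  ultimately show "component ?E x \<subseteq> ?R" by (rule component_subset_closed)
qed

lemma components_insert_same:
  assumes "component E u = component E v"
  shows "components V (insert {u, v} E) = components V E"
proof -
  have "component (insert {u, v} E) x = component E x" for x
  proof (cases "u \<in> component E x \<or> v \<in> component E x")
    case True
    then have "component E u = component E x" "component E v = component E x"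
      using assms component_eq[of u E x] component_eq[of v E x] by auto
    then show ?thesis by (simp add: component_insert)
  qed (simp add: component_insert)
  then show ?thesis by (simp add: components_def)
qed

lemma card_components_insert:
  assumes "finite V" "u \<in> V" "v \<in> V" "component E u \<noteq> component E v"
  shows "card (components V E) = Suc (card (components V (insert {u, v} E)))"
proof -
  let ?U = "component E u" and ?W = "component E v"
  have eq: "components V (insert {u, v} E) = insert (?U \<union> ?W) (components V E - {?U, ?W})"
  proof (rule set_eqI)
    fix X
    have cx: "x \<in> V \<Longrightarrow> u \<in> component E x \<Longrightarrow> component E x = ?U"
      "x \<in> V \<Longrightarrow> v \<in> component E x \<Longrightarrow> component E x = ?W" for x
      using component_eq by blast+
    show "X \<in> components V (insert {u, v} E) \<longleftrightarrow> X \<in> insert (?U \<union> ?W) (components V E - {?U, ?W})"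
    proof
      assume "X \<in> components V (insert {u, v} E)"
      then obtain x where x: "x \<in> V" "X = component (insert {u, v} E) x"
        by (auto simp: components_def)
      show "X \<in> insert (?U \<union> ?W) (components V E - {?U, ?W})"
      proof (cases "u \<in> component E x \<or> v \<in> component E x")
        case True
        then show ?thesis using x by (simp add: component_insert)
      next
        case False
        then have "X = component E x" using x by (simp add: component_insert)
        moreover from this have "X \<noteq> ?U" "X \<noteq> ?W"
          using False component_refl[of u E] component_refl[of v E] by metis+
        ultimately show ?thesis using x(1) by (simp add: components_def)
      qed
    next
      assume "X \<in> insert (?U \<union> ?W) (components V E - {?U, ?W})"
      then consider "X = ?U \<union> ?W" | "X \<in> components V E" "X \<noteq> ?U" "X \<noteq> ?W" by auto
      then show "X \<in> components V (insert {u, v} E)"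
      proof cases
        case 1
        then have "X = component (insert {u, v} E) u" by (simp add: component_insert)
        then show ?thesis using assms(2) by (auto simp: components_def)
      next
        case 2
        then obtain x where x: "x \<in> V" "X = component E x" by (auto simp: components_def)
        then have "u \<notin> component E x" "v \<notin> component E x" using 2 cx[of x] by metis+
        then have "X = component (insert {u, v} E) x" using x by (simp add: component_insert)
        then show ?thesis using x by (auto simp: components_def)
      qed
    qed
  qed
  \<comment> \<open>The merged set is no class of the old partition, so inserting it adds exactly
    one element after two have been removed.\<close>
  have notin: "?U \<union> ?W \<notin> components V E - {?U, ?W}"
  proof
    assume "?U \<union> ?W \<in> components V E - {?U, ?W}"
    then obtain x where x: "?U \<union> ?W = component E x" "component E x \<noteq> ?U"
      by (auto simp: components_def)
    have "u \<in> component E x" using x(1) component_refl[of u E] by blast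
    then show False using x(2) component_eq by blast
  qed
  have fin: "finite (components V E)" using assms(1) by (simp add: components_def)
  have sub: "{?U, ?W} \<subseteq> components V E" using assms by (auto simp: components_def)
  have "card (components V E - {?U, ?W}) = card (components V E) - 2"
    using card_Diff_subset[of "{?U, ?W}" "components V E"] sub assms(4) by simp
  moreover have "card (components V E) \<ge> 2"
    using card_mono[OF fin sub] assms(4) by simp
  ultimately show ?thesis
    unfolding eq using notin fin by simp
qed

section \<open>Forests and Kruskal's construction\<close>

definition edges_on :: "nat set \<Rightarrow> nat set set \<Rightarrow> bool" where
  "edges_on V E \<longleftrightarrow> (\<forall>e\<in>E. \<exists>u v. e = {u, v} \<and> u \<noteq> v \<and> u \<in> V \<and> v \<in> V)"

lemma edges_onD:
  assumes "edges_on V E" "{x, y} \<in> E"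
  shows "x \<in> V \<and> y \<in> V \<and> x \<noteq> y"
proof -
  obtain u v where "{x, y} = {u, v}" "u \<noteq> v" "u \<in> V" "v \<in> V"
    using assms unfolding edges_on_def by blast
  then show ?thesis by (auto simp: doubleton_eq_iff)
qed

lemma edges_on_subset: "edges_on V E \<Longrightarrow> F \<subseteq> E \<Longrightarrow> edges_on V F"
  by (auto simp: edges_on_def)

lemma finite_edges_on: "finite V \<Longrightarrow> edges_on V E \<Longrightarrow> finite E"
proof -
  assume "finite V" "edges_on V E"
  then have "E \<subseteq> Pow V" by (auto simp: edges_on_def)
  then show ?thesis using \<open>finite V\<close> finite_subset by blast
qed

lemma component_subset:
  assumes "edges_on V E" "u \<in> V"
  shows "component E u \<subseteq> V"
proof (rule component_subset_closed)
  show "closed_under E V"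
    using assms(1) unfolding edges_on_def closed_under_def by (metis doubleton_eq_iff)
qed fact

text \<open>Each edge of \<open>F\<close> merges at most two components, so the count drops by at
  most one per edge. With \<open>A\<close> empty this bounds the size of spanning sets from below;
  with \<open>A\<close> a level it bounds the number of edges that must come from outside that
  level.\<close>

lemma card_components_union:
  assumes "finite V" "finite F" "edges_on V F"
  shows "card (components V A) \<le> card (components V (A \<union> F)) + card F"
  using assms(2,3)
proof (induction F rule: finite_induct)
  case (insert e F)
  then obtain u v where uv: "e = {u, v}" "u \<in> V" "v \<in> V" by (auto simp: edges_on_def)
  have IH: "card (components V A) \<le> card (components V (A \<union> F)) + card F"
    using insert edges_on_subset[of V "insert e F" F] by auto
  have "card (components V (A \<union> F)) \<le> Suc (card (components V (insert e (A \<union> F))))"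
    using components_insert_same[of "A \<union> F" u v V] card_components_insert[OF assms(1) uv(2,3), of "A \<union> F"]
    unfolding uv(1) by (cases "component (A \<union> F) u = component (A \<union> F) v") auto
  then show ?case using IH insert by simp
qed simp

lemma card_components_empty: "card (components V {}) = card V"
proof -
  have "component {} u = {u}" for u by (auto simp: component_def adj_def)
  then show ?thesis by (simp add: components_def card_image inj_on_def)
qed

lemma graph_connected_iff: "graph_connected V E \<longleftrightarrow> V \<noteq> {} \<and> (\<forall>u\<in>V. V \<subseteq> component E u)"
  by (auto simp: graph_connected_def component_def adj_def)

lemma card_components_connected:
  assumes "edges_on V E" "graph_connected V E"
  shows "card (components V E) = 1"
proof -
  have "component E u = V" if "u \<in> V" for u
    using assms that component_subset by (auto simp: graph_connected_iff)
  then have "components V E = {V}" using assms(2) by (auto simp: components_def graph_connected_iff)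
  then show ?thesis by simp
qed

lemma graph_connected_mono: "graph_connected V E \<Longrightarrow> E \<subseteq> E' \<Longrightarrow> graph_connected V E'"
  unfolding graph_connected_iff using component_mono by blast

text \<open>
  Every edge lowers the number of components by at most one, and the edge sets in which each one does
  are the forests. This form of acyclicity is the one that counting needs.
\<close>

definition tight_forest :: "nat set \<Rightarrow> nat set set \<Rightarrow> bool" where
  "tight_forest V F \<longleftrightarrow> edges_on V F \<and> card F + card (components V F) = card V"

text \<open>The closing edge of a cycle can be removed without changing the components, because the
  rest of the cycle still joins its ends. Then fewer than \<open>card F\<close> edges would reduce
  \<open>card V\<close> singletons to the same number of components, which is more than one per
  edge.\<close>

lemma tight_forest_no_cycle:
  assumes V: "finite V" and F: "tight_forest V F"
  shows "\<not> graph_cycle F p"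
proof
  assume "graph_cycle F p"
  then have len: "length p \<ge> 3" and dist: "distinct p"
    and ed: "\<And>i. i < length p \<Longrightarrow> {p ! i, p ! (Suc i mod length p)} \<in> F"
    by (auto simp: graph_cycle_def)
  define m where "m = length p - 1"
  define e where "e = {p ! m, p ! 0}"
  have m: "m < length p" "Suc m = length p" "m \<ge> 2" using len by (auto simp: m_def)
  have eF: "e \<in> F" using ed[OF m(1)] m(2) by (simp add: e_def)
  have finF: "finite F" using F V finite_edges_on by (auto simp: tight_forest_def)
  \<comment> \<open>The other edges differ from the closing edge because the vertices of the cycle
    are distinct and there are at least three of them.\<close>
  have step: "{p ! i, p ! Suc i} \<in> F - {e}" if "i < m" for i
  proof -
    have "Suc i mod length p = Suc i" using that m by simp
    then have "{p ! i, p ! Suc i} \<in> F" using ed[of i] that m by simp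
    moreover have "{p ! i, p ! Suc i} \<noteq> e"
    proof
      assume "{p ! i, p ! Suc i} = e"
      then have "(p ! i = p ! m \<and> p ! Suc i = p ! 0) \<or> (p ! i = p ! 0 \<and> p ! Suc i = p ! m)"
        by (auto simp: e_def doubleton_eq_iff)
      then show False
      proof
        assume "p ! i = p ! m \<and> p ! Suc i = p ! 0"
        then show False using nth_eq_iff_index_eq[OF dist, of i m] that m by auto
      next
        assume a: "p ! i = p ! 0 \<and> p ! Suc i = p ! m"
        then have "i = 0" using nth_eq_iff_index_eq[OF dist, of i 0] that m len by (cases "p = []") auto
        moreover have "Suc i = m" using a nth_eq_iff_index_eq[OF dist, of "Suc i" m] that m by auto
        ultimately show False using m by auto
      qed
    qed
    ultimately show ?thesis by simp
  qed
  have "p ! i \<in> component (F - {e}) (p ! 0)" if "i \<le> m" for i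
    using that
  proof (induction i)
    case (Suc i)
    then show ?case using component_edge[OF step[of i]] component_trans[of "p ! i" "F - {e}" "p ! 0"] by auto
  qed simp
  then have "component (F - {e}) (p ! m) = component (F - {e}) (p ! 0)"
    by (intro component_eq) auto
  then have same: "components V F = components V (F - {e})"
    using components_insert_same[of "F - {e}" "p ! m" "p ! 0" V] eF
    by (simp add: e_def[symmetric] insert_absorb)
  have "card V \<le> card (components V (F - {e})) + card (F - {e})"
    using card_components_union[OF V, of "F - {e}" "{}"] finF F
      edges_on_subset[of V F "F - {e}"] by (auto simp: card_components_empty tight_forest_def)
  moreover have "card (F - {e}) < card F" using eF finF by (meson card_Diff1_less)
  ultimately show False using F same by (simp add: tight_forest_def)
qed

text \<open>A maximal tight forest between \<open>F\<close> and \<open>E\<close> joins the ends of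
  every edge of \<open>E\<close>: an edge between two of its components could be added, since it
  lowers their number by exactly one.\<close>

lemma tight_forest_extend:
  assumes V: "finite V" and E: "edges_on V E" and F: "tight_forest V F" "F \<subseteq> E"
  obtains F' where "F \<subseteq> F'" "F' \<subseteq> E" "tight_forest V F'"
    "components V F' = components V E"
proof -
  let ?S = "{F'. F \<subseteq> F' \<and> F' \<subseteq> E \<and> tight_forest V F'}"
  have fin: "finite ?S" using finite_edges_on[OF V E] by (auto intro: finite_subset[of _ "Pow E"])
  have "?S \<noteq> {}" using F by auto
  from finite_has_maximal[OF fin this]
  obtain F' where "F' \<in> ?S" and max: "\<forall>G\<in>?S. F' \<subseteq> G \<longrightarrow> F' = G" by blast
  then have F': "F \<subseteq> F'" "F' \<subseteq> E" "tight_forest V F'" by auto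
  have edge: "y \<in> component F' x" if xy: "{x, y} \<in> E" for x y
  proof (rule ccontr)
    assume "y \<notin> component F' x"
    then have ne: "component F' x \<noteq> component F' y" by auto
    have "x \<in> V" "y \<in> V" using edges_onD[OF E xy] by auto
    then have c: "card (components V F') = Suc (card (components V (insert {x, y} F')))"
      using card_components_insert[OF V _ _ ne] by simp
    have notin: "{x, y} \<notin> F'" using \<open>y \<notin> component F' x\<close> component_edge by blast
    have "finite F'" using F' finite_edges_on[OF V E] finite_subset by auto
    then have "tight_forest V (insert {x, y} F')"
      using F' c notin edges_on_subset[OF E, of "insert {x, y} F'"] xy by (auto simp: tight_forest_def)
    then have "insert {x, y} F' \<in> ?S" using F' xy by auto
    from bspec[OF max this] have "F' = insert {x, y} F'" by blast
    then show False using notin by blast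
  qed
  have "component F' u = component E u" for u
  proof
    show "component F' u \<subseteq> component E u" using F' component_mono by auto
    have "closed_under E (component F' u)"
      unfolding closed_under_def using edge component_trans by blast
    then show "component E u \<subseteq> component F' u" by (rule component_subset_closed) simp
  qed
  then have "components V F' = components V E" by (simp add: components_def)
  then show thesis using that F' by auto
qed

text \<open>Kruskal's algorithm on the levels \<open>E 0\<close>, ..., \<open>E m\<close>: the
  forest of one level is extended within the next. A single forest thus spans every level at once,
  since enlarging it later preserves the inequalities already obtained.\<close>

lemma greedy_spanning_forest:
  fixes m :: nat and E :: "nat \<Rightarrow> nat set set"
  assumes V: "finite V" and E: "\<And>j. j \<le> m \<Longrightarrow> edges_on V (E j)"
    and mono: "\<And>i j. i \<le> j \<Longrightarrow> j \<le> m \<Longrightarrow> E i \<subseteq> E j"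
  shows "\<exists>F. tight_forest V F \<and> F \<subseteq> E m \<and> components V F = components V (E m) \<and>
    (\<forall>i\<le>m. card V \<le> card (F \<inter> E i) + card (components V (E i)))"
  using E mono
proof (induction m)
  case 0
  have "tight_forest V {}" by (simp add: tight_forest_def edges_on_def card_components_empty)
  then obtain F where F: "F \<subseteq> E 0" "tight_forest V F" "components V F = components V (E 0)"
    using tight_forest_extend[OF V 0(1)[of 0], of "{}"] by auto
  moreover have "F \<inter> E 0 = F" using F by auto
  ultimately show ?case by (intro exI[of _ F]) (auto simp: tight_forest_def)
next
  case (Suc m)
  obtain F where F: "tight_forest V F" "F \<subseteq> E m"
    "\<And>i. i \<le> m \<Longrightarrow> card V \<le> card (F \<inter> E i) + card (components V (E i))"
    using Suc.IH Suc.prems by fastforce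
  have "F \<subseteq> E (Suc m)" using F(2) Suc.prems(2)[of m "Suc m"] by auto
  then obtain F' where F': "F \<subseteq> F'" "F' \<subseteq> E (Suc m)" "tight_forest V F'"
    "components V F' = components V (E (Suc m))"
    using tight_forest_extend[OF V Suc.prems(1)[of "Suc m"] F(1)] by auto
  have finF': "finite F'" using F'(3) V finite_edges_on by (auto simp: tight_forest_def)
  have "card V \<le> card (F' \<inter> E i) + card (components V (E i))" if "i \<le> Suc m" for i
  proof (cases "i = Suc m")
    case True
    have "F' \<inter> E (Suc m) = F'" using F' by auto
    then show ?thesis using True F'(3,4) by (auto simp: tight_forest_def)
  next
    case False
    then have "card V \<le> card (F \<inter> E i) + card (components V (E i))" using F(3) that by auto
    moreover have "card (F \<inter> E i) \<le> card (F' \<inter> E i)" using F'(1) finF' by (intro card_mono) auto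
    ultimately show ?thesis by simp
  qed
  then show ?case using F' by auto
qed

section \<open>Minimum spanning trees as sums of component counts over levels\<close>

lemma sum_by_levels:
  fixes \<tau> :: "nat \<Rightarrow> nat"
  assumes fin: "finite T" and cl: "\<And>e. e \<in> T \<Longrightarrow> cl e \<le> m" and mono: "\<And>j. \<tau> j \<le> \<tau> (Suc j)"
  shows "(\<Sum>e\<in>T. \<tau> (cl e)) = \<tau> 0 * card T + (\<Sum>j<m. (\<tau> (Suc j) - \<tau> j) * card {e \<in> T. j < cl e})"
proof -
  \<comment> \<open>Every \<open>\<tau> c\<close> telescopes into the gaps below \<open>c\<close>.
    Exchanging the sums then counts, for each gap, the edges whose class lies above it.\<close>
  have tau: "\<tau> c = \<tau> 0 + (\<Sum>j<c. \<tau> (Suc j) - \<tau> j)" for c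
  proof (induction c)
    case (Suc c)
    then show ?case using mono[of c] by simp
  qed simp
  have cut: "(\<Sum>j<cl e. \<tau> (Suc j) - \<tau> j) = (\<Sum>j<m. (\<tau> (Suc j) - \<tau> j) * of_bool (j < cl e))"
    if "e \<in> T" for e
  proof -
    have "{..<m} \<inter> {j. j < cl e} = {..<cl e}" using cl[OF that] by auto
    then show ?thesis by simp
  qed
  have "(\<Sum>e\<in>T. \<tau> (cl e)) = (\<Sum>e\<in>T. \<tau> 0 + (\<Sum>j<cl e. \<tau> (Suc j) - \<tau> j))"
    by (intro sum.cong refl tau)
  also have "\<dots> = \<tau> 0 * card T + (\<Sum>e\<in>T. \<Sum>j<m. (\<tau> (Suc j) - \<tau> j) * of_bool (j < cl e))"
    using cut by (simp add: sum.distrib)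
  also have "(\<Sum>e\<in>T. \<Sum>j<m. (\<tau> (Suc j) - \<tau> j) * of_bool (j < cl e))
      = (\<Sum>j<m. (\<tau> (Suc j) - \<tau> j) * card {e \<in> T. j < cl e})"
    using fin by (subst sum.swap) (simp add: sum_distrib_left[symmetric] Int_def)
  finally show ?thesis .
qed

text \<open>\<open>cl\<close> is the class of an edge and \<open>\<tau>\<close> the weight that
  stands for a class. Exact weights are the instance with class \<open>w - 1\<close> for weight
  \<open>w\<close> and \<open>\<tau> j = j + 1\<close>; rounding to powers is the other
  instance.\<close>

locale leveled_graph =
  fixes V :: "nat set" and E :: "nat set set" and cl :: "nat set \<Rightarrow> nat"
    and \<tau> :: "nat \<Rightarrow> nat" and m :: nat
  assumes finV: "finite V" and E: "edges_on V E" and conn: "graph_connected V E"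
    and cl: "\<And>e. e \<in> E \<Longrightarrow> cl e \<le> m" and mono: "\<And>j. \<tau> j \<le> \<tau> (Suc j)"
begin

definition level :: "nat \<Rightarrow> nat set set" where
  "level j = {e \<in> E. cl e \<le> j}"

text \<open>The minimum for the class weights: \<open>card V - 1\<close> edges at the lowest weight,
  and one more gap for each edge that is forced above level \<open>j\<close>.\<close>

definition level_cost :: nat where
  "level_cost = \<tau> 0 * (card V - 1) + (\<Sum>j<m. (\<tau> (Suc j) - \<tau> j) * (card (components V (level j)) - 1))"

text \<open>The edges of \<open>T\<close> above level \<open>j\<close> must connect the components
  of that level, so their number is at least that of these components minus one.\<close>

lemma level_cost_le:
  assumes "T \<subseteq> E" "graph_connected V T"
  shows "level_cost \<le> (\<Sum>e\<in>T. \<tau> (cl e))"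
proof -
  have finT: "finite T" using finite_edges_on[OF finV E] assms(1) finite_subset by blast
  have bnd: "card (components V A) - 1 \<le> card F" if "A \<union> F \<supseteq> T" "F \<subseteq> T" "A \<subseteq> E" for A F
  proof -
    have "graph_connected V (A \<union> F)" using graph_connected_mono[OF assms(2) that(1)] .
    moreover have "edges_on V (A \<union> F)" "edges_on V F"
      using that assms(1) by (auto intro!: edges_on_subset[OF E])
    moreover have "finite F" using that(2) finT finite_subset by blast
    ultimately show ?thesis
      using card_components_union[OF finV, of F A] card_components_connected[of V "A \<union> F"] by auto
  qed
  have "card V - 1 \<le> card T" using bnd[of "{}" T] by (simp add: card_components_empty)
  moreover have "card (components V (level j)) - 1 \<le> card {e \<in> T. j < cl e}" for j
    using assms(1) by (intro bnd) (auto simp: level_def)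
  moreover have "(\<Sum>e\<in>T. \<tau> (cl e)) =
      \<tau> 0 * card T + (\<Sum>j<m. (\<tau> (Suc j) - \<tau> j) * card {e \<in> T. j < cl e})"
    using assms(1) cl by (intro sum_by_levels finT mono) auto
  ultimately show ?thesis
    unfolding level_cost_def by (auto intro!: add_mono sum_mono mult_le_mono2)
qed

text \<open>Kruskal's forest has so many edges inside each level that no more than the forced number
  remains above it.\<close>

lemma ex_spanning_tree_level_cost:
  "\<exists>T. spanning_tree V E T \<and> (\<Sum>e\<in>T. \<tau> (cl e)) \<le> level_cost"
proof -
  have lm: "level m = E" using cl by (auto simp: level_def)
  have "\<exists>F. tight_forest V F \<and> F \<subseteq> level m \<and> components V F = components V (level m) \<and>
    (\<forall>i\<le>m. card V \<le> card (F \<inter> level i) + card (components V (level i)))"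
    by (rule greedy_spanning_forest[OF finV])
      (auto simp: level_def intro: edges_on_subset[OF E])
  then obtain T where T: "tight_forest V T" "T \<subseteq> E" "components V T = components V E"
    "\<And>i. i \<le> m \<Longrightarrow> card V \<le> card (T \<inter> level i) + card (components V (level i))"
    using lm by auto
  have finT: "finite T" using T(1) finV finite_edges_on by (auto simp: tight_forest_def)
  have c1: "card (components V T) = 1" using T(3) card_components_connected[OF E conn] by simp
  have VT: "card V = Suc (card T)" using T(1) c1 by (simp add: tight_forest_def)
  have ne: "V \<noteq> {}" using conn by (simp add: graph_connected_iff)
  have "graph_connected V T"
  proof -
    obtain X where X: "components V T = {X}" using c1 card_1_singletonE by blast
    have "component T u = X" if "u \<in> V" for u using X that by (auto simp: components_def)
    then show ?thesis unfolding graph_connected_iff using ne by (metis component_refl subsetI)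
  qed
  then have "spanning_tree V E T"
    using T tight_forest_no_cycle[OF finV] by (auto simp: spanning_tree_def)
  moreover have "card {e \<in> T. j < cl e} \<le> card (components V (level j)) - 1" if "j < m" for j
  proof -
    have "T = (T \<inter> level j) \<union> {e \<in> T. j < cl e}" "(T \<inter> level j) \<inter> {e \<in> T. j < cl e} = {}"
      using T(2) by (auto simp: level_def)
    then have "card T = card (T \<inter> level j) + card {e \<in> T. j < cl e}"
      using finT card_Un_disjoint[of "T \<inter> level j" "{e \<in> T. j < cl e}"] by auto
    then show ?thesis using T(4)[of j] that VT by simp
  qed
  moreover have "(\<Sum>e\<in>T. \<tau> (cl e)) =
      \<tau> 0 * card T + (\<Sum>j<m. (\<tau> (Suc j) - \<tau> j) * card {e \<in> T. j < cl e})"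
    using T(2) cl by (intro sum_by_levels finT mono) auto
  ultimately show ?thesis
    unfolding level_cost_def using VT
    by (intro exI[of _ T]) (auto intro!: sum_mono mult_le_mono2)
qed

end

text \<open>The tree that is optimal for the class weights bounds the true minimum from above, and a
  true minimum tree bounds the class cost, up to the rounding factor \<open>1 + \<delta>\<close>.
  The third conclusion turns additive errors proportional to \<open>n - 1\<close> into relative
  ones.\<close>

lemma mst_weight_level_cost:
  fixes g :: wgraph and \<delta> :: real
  assumes "leveled_graph {1..n} (dom g) (\<lambda>e. c (the (g e))) \<tau> m"
    and lower: "\<And>e. e \<in> dom g \<Longrightarrow> 1 \<le> the (g e) \<and> the (g e) \<le> \<tau> (c (the (g e)))"
    and upper: "\<And>e. e \<in> dom g \<Longrightarrow> real (\<tau> (c (the (g e)))) \<le> (1 + \<delta>) * the (g e)"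
  shows "real (mst_weight n g) \<le> real (leveled_graph.level_cost {1..n} (dom g) (\<lambda>e. c (the (g e))) \<tau> m)"
    and "real (leveled_graph.level_cost {1..n} (dom g) (\<lambda>e. c (the (g e))) \<tau> m) \<le> (1 + \<delta>) * mst_weight n g"
    and "n - 1 \<le> mst_weight n g"
proof -
  interpret leveled_graph "{1..n}" "dom g" "\<lambda>e. c (the (g e))" \<tau> m by fact
  let ?S = "{T. spanning_tree {1..n} (dom g) T}"
  let ?w = "\<lambda>T. \<Sum>e\<in>T. the (g e)"
  have finE: "finite (dom g)" using finite_edges_on[OF finV E] .
  have finS: "finite ?S" using finE by (auto intro: finite_subset[of _ "Pow (dom g)"] simp: spanning_tree_def)
  obtain T where T: "T \<in> ?S" "(\<Sum>e\<in>T. \<tau> (c (the (g e)))) \<le> level_cost"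
    using ex_spanning_tree_level_cost by auto
  have ws: "mst_weight n g \<in> ?w ` ?S" unfolding mst_weight_def using finS T(1) by (intro Min_in) auto
  have "mst_weight n g \<le> ?w T" unfolding mst_weight_def using finS T(1) by (intro Min_le) auto
  also have "\<dots> \<le> (\<Sum>e\<in>T. \<tau> (c (the (g e))))"
  proof (rule sum_mono)
    fix e assume "e \<in> T"
    then have "e \<in> dom g" using T(1) by (auto simp: spanning_tree_def)
    then show "the (g e) \<le> \<tau> (c (the (g e)))" using lower by blast
  qed
  finally show "real (mst_weight n g) \<le> real level_cost" using T(2) by linarith
  obtain T' where T': "spanning_tree {1..n} (dom g) T'" "mst_weight n g = ?w T'" using ws by auto
  then have sub: "T' \<subseteq> dom g" "graph_connected {1..n} T'" by (auto simp: spanning_tree_def)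
  have "real level_cost \<le> real (\<Sum>e\<in>T'. \<tau> (c (the (g e))))"
    using level_cost_le[OF sub] by (simp only: of_nat_le_iff)
  also have "\<dots> = (\<Sum>e\<in>T'. real (\<tau> (c (the (g e)))))" by simp
  also have "\<dots> \<le> (\<Sum>e\<in>T'. (1 + \<delta>) * the (g e))"
  proof (rule sum_mono)
    fix e assume "e \<in> T'"
    then have "e \<in> dom g" using sub by blast
    then show "real (\<tau> (c (the (g e)))) \<le> (1 + \<delta>) * the (g e)" using upper by blast
  qed
  also have "\<dots> = (1 + \<delta>) * mst_weight n g" by (simp add: T' sum_distrib_left)
  finally show "real level_cost \<le> (1 + \<delta>) * mst_weight n g" .
  have finT': "finite T'" using sub finE finite_subset by blast
  have "card {1..n} \<le> card (components {1..n} T') + card T'"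
    using card_components_union[OF finV finT' edges_on_subset[OF E sub(1)], of "{}"]
    by (simp add: card_components_empty)
  then have "n - 1 \<le> card T'"
    using card_components_connected[OF edges_on_subset[OF E sub(1)] sub(2)] by simp
  also have "\<dots> \<le> ?w T'"
  proof -
    have "(\<Sum>e\<in>T'. 1) \<le> ?w T'" using lower sub by (intro sum_mono) blast
    then show ?thesis by simp
  qed
  finally show "n - 1 \<le> mst_weight n g" using T' by simp
qed

section \<open>Primes of bounded size and roots modulo a prime\<close>

text \<open>Induction along Leibniz' harmonic triangle.\<close>

lemma Suc_mult_binomial_dvd:
  fixes D :: nat
  assumes "k \<le> n" "\<And>i. 1 \<le> i \<Longrightarrow> i \<le> Suc n \<Longrightarrow> i dvd D"
  shows "Suc n * (n choose k) dvd D"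
  using assms
proof (induction n arbitrary: k)
  case 0
  then show ?case by simp
next
  case (Suc n)
  note IHn = Suc.IH and Dn = Suc.prems(2)
  show ?case using Suc.prems(1)
  proof (induction k)
    case 0
    then show ?case using Suc.prems(2)[of "Suc (Suc n)"] by simp
  next
    case (Suc k)
    let ?a = "Suc n * (n choose k)" and ?b = "Suc (Suc n) * (Suc n choose k)"
      and ?c = "Suc (Suc n) * (Suc n choose Suc k)"
    have "?a dvd D" using Suc.prems Dn by (intro IHn) auto
    then obtain x where x: "D = ?a * x" by blast
    have "?b dvd D" using Suc by simp
    then obtain y where y: "D = ?b * y" by blast
    have pos: "n choose k > 0" "Suc n choose k > 0" "Suc n choose Suc k > 0"
      using Suc.prems by (auto simp del: binomial_Suc_Suc)
    have e1: "Suc k * (Suc n choose Suc k) = Suc n * (n choose k)"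
      by (rule Suc_times_binomial)
    have e2: "(Suc n - k) * (Suc n choose k) = Suc n * (n choose k)"
      using binomial_absorb_comp[of "Suc n" k] by simp
    obtain d where d: "Suc n = k + Suc d" using Suc.prems less_iff_Suc_add[of k "Suc n"] by auto
    \<comment> \<open>This is the rule 1/c = 1/a - 1/b of the harmonic triangle multiplied by
      \<open>D\<close>, where x = D/a and y = D/b. Working in the integers avoids truncated
      subtraction.\<close>
    have "int D = int ?c * (int x - int y)"
    proof -
      let ?p = "int (n choose k)" let ?q = "int (Suc n choose k)" let ?r = "int (Suc n choose Suc k)"
      have E1: "(int k + 1) * ?r = (int k + int d + 1) * ?p"
        using arg_cong[OF e1, of int] d by (simp add: algebra_simps del: binomial_Suc_Suc)
      have E2: "(int d + 1) * ?q = (int k + int d + 1) * ?p"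
        using arg_cong[OF e2, of int] d by (simp add: algebra_simps del: binomial_Suc_Suc)
      have X: "int D = (int k + int d + 1) * ?p * int x"
        using arg_cong[OF x, of int] d by (simp add: algebra_simps del: binomial_Suc_Suc)
      have Y: "int D = (int k + int d + 2) * ?q * int y"
        using arg_cong[OF y, of int] d by (simp add: algebra_simps del: binomial_Suc_Suc)
      have X': "int D = (int k + 1) * ?r * int x" using X E1 by simp
      have "(int d + 1) * int D = (int k + int d + 2) * ((int d + 1) * ?q) * int y"
        using Y by (simp add: algebra_simps)
      then have Y': "(int d + 1) * int D = (int k + int d + 2) * ((int k + 1) * ?r) * int y"
        using E1 E2 by simp
      have "(int k + 1) * int D = (int k + 1) * ((int k + int d + 2) * ?r * (int x - int y))"
      proof -
        have "(int k + 1) * ((int k + int d + 2) * ?r * (int x - int y)) =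
           (int k + int d + 2) * ((int k + 1) * ?r * int x) - (int k + int d + 2) * ((int k + 1) * ?r) * int y"
          by (simp add: algebra_simps)
        also have "\<dots> = (int k + int d + 2) * int D - (int d + 1) * int D"
          by (simp only: X'[symmetric] Y'[symmetric])
        finally show ?thesis by (simp add: algebra_simps)
      qed
      moreover have "int k + 1 \<noteq> 0" by simp
      ultimately have "int D = (int k + int d + 2) * ?r * (int x - int y)"
        by (metis mult_cancel_left)
      then show ?thesis using d by (simp add: algebra_simps del: binomial_Suc_Suc)
    qed
    then have "int ?c dvd int D" by (metis dvd_triv_left)
    then show ?case by (simp only: int_dvd_int_iff)
  qed
qed

text \<open>The central binomial coefficient is the largest of the \<open>2 * m + 1\<close> terms
  that sum to \<open>4 ^ m\<close>, and \<open>2 * m + 1\<close> times it divides every such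
  \<open>D\<close>.\<close>

lemma four_power_le_common_multiple:
  fixes D :: nat
  assumes "D > 0" "\<And>i. 1 \<le> i \<Longrightarrow> i \<le> 2 * m + 1 \<Longrightarrow> i dvd D"
  shows "4 ^ m \<le> D"
proof -
  have "(4::nat) ^ m = 2 ^ (2 * m)" by (simp add: power_mult)
  also have "\<dots> = (\<Sum>k\<le>2*m. (2*m) choose k)" by (rule choose_row_sum[symmetric])
  also have "\<dots> \<le> (\<Sum>k\<le>2*m. (2*m) choose m)" by (intro sum_mono binomial_maximum')
  also have "\<dots> = Suc (2 * m) * ((2 * m) choose m)" by simp
  also have "\<dots> \<le> D"
    using Suc_mult_binomial_dvd[of m "2 * m" D] assms by (intro dvd_imp_le) simp_all
  finally show ?thesis .
qed

text \<open>
  If there were no such prime, then the product of the largest powers up to \<open>X\<close> of the few primes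
  below \<open>2 ^ N\<close> would be a common multiple of \<open>1, \<dots>, X\<close> that is smaller than \<open>2 ^ (X - 1)\<close>.
\<close>

lemma ex_prime_between:
  fixes N :: nat
  assumes N: "N \<ge> 2"
  shows "\<exists>p::nat. prime p \<and> 2 ^ N \<le> p \<and> p \<le> 2 ^ (4 * N)"
proof (rule ccontr)
  assume none: "\<not> ?thesis"
  define A :: nat where "A = 2 ^ N"
  \<comment> \<open>Of the form \<open>2 * m + 1\<close> with \<open>m = A ^ 3\<close>, and at most
    \<open>A ^ 4 = 2 ^ (4 * N)\<close>, so that by assumption all primes up to \<open>X\<close> lie
    below \<open>A\<close>.\<close>
  define X :: nat where "X = 2 * A ^ 3 + 1"
  have A: "A \<ge> 4" using power_increasing[of 2 N "2::nat"] N by (simp add: A_def)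
  have XA: "X \<le> A ^ 4"
  proof -
    have "X \<le> 4 * A ^ 3" using A by (simp add: X_def)
    also have "\<dots> \<le> A * A ^ 3" using A by (intro mult_right_mono) auto
    also have "\<dots> = A ^ 4" by (simp add: power_Suc[symmetric] numeral_eq_Suc del: power_Suc)
    finally show ?thesis .
  qed
  have A4: "A ^ 4 = 2 ^ (4 * N)" by (simp add: A_def power_mult[symmetric] mult.commute)
  define S where "S = {p. prime p \<and> p < A}"
  have finS: "finite S" by (simp add: S_def)
  define D where "D = (\<Prod>p\<in>S. p ^ Max {j. p ^ j \<le> X})"
  have fine: "finite {j. p ^ j \<le> X}" if "p \<in> S" for p
  proof -
    have "p \<ge> 2" using that prime_ge_2_nat by (auto simp: S_def)
    have "j \<le> X" if "p ^ j \<le> X" for j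
    proof -
      have "j < 2 ^ j" by (rule less_exp)
      also have "(2::nat) ^ j \<le> p ^ j" using \<open>p \<ge> 2\<close> by (intro power_mono) auto
      finally show ?thesis using that by simp
    qed
    then show ?thesis by (auto intro: finite_subset[of _ "{..X}"])
  qed
  have ne: "{j. p ^ j \<le> X} \<noteq> {}" for p
    by (auto intro!: exI[of _ 0] simp: X_def)
  have Dpos: "D > 0" unfolding D_def by (auto intro!: prod_pos simp: S_def prime_gt_0_nat)
  have "i dvd D" if i: "1 \<le> i" "i \<le> X" for i
  proof -
    have pS: "p \<in> S" if "p \<in> prime_factors i" for p
    proof -
      have "prime p" "p dvd i" using that by auto
      then have "p \<le> i" using i by (auto intro: dvd_imp_le)
      then have "p \<le> 2 ^ (4 * N)" using i XA A4 by simp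
      then have "\<not> 2 ^ N \<le> p" using none \<open>prime p\<close> by blast
      then show ?thesis using \<open>prime p\<close> by (simp add: S_def A_def)
    qed
    have "i = (\<Prod>p\<in>prime_factors i. p ^ multiplicity p i)"
      using i by (intro prime_factorization_nat) auto
    also have "\<dots> dvd (\<Prod>p\<in>prime_factors i. p ^ Max {j. p ^ j \<le> X})"
    proof (rule prod_dvd_prod)
      fix p assume p: "p \<in> prime_factors i"
      have "p ^ multiplicity p i \<le> i" using i by (intro dvd_imp_le multiplicity_dvd) auto
      then have "multiplicity p i \<le> Max {j. p ^ j \<le> X}"
        using fine[OF pS[OF p]] i by (intro Max_ge) auto
      then show "p ^ multiplicity p i dvd p ^ Max {j. p ^ j \<le> X}" by (rule le_imp_power_dvd)
    qed
    also have "\<dots> dvd D" unfolding D_def using pS by (intro prod_dvd_prod_subset finS) auto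
    finally show ?thesis .
  qed
  then have "4 ^ (A ^ 3) \<le> D"
    using Dpos by (intro four_power_le_common_multiple) (auto simp: X_def)
  also have "D \<le> (\<Prod>p\<in>S. X)"
    unfolding D_def
  proof (rule prod_mono)
    fix p assume "p \<in> S"
    then have "Max {j. p ^ j \<le> X} \<in> {j. p ^ j \<le> X}" using fine ne by (intro Max_in) auto
    then show "0 \<le> p ^ Max {j. p ^ j \<le> X} \<and> p ^ Max {j. p ^ j \<le> X} \<le> X" by simp
  qed
  also have "\<dots> = X ^ card S" by simp
  also have "\<dots> \<le> X ^ A"
  proof (rule power_increasing)
    have "S \<subseteq> {..<A}" by (auto simp: S_def)
    then show "card S \<le> A" using card_mono[of "{..<A}" S] by simp
  qed (simp add: X_def)
  also have "\<dots> \<le> (2 ^ (4 * N)) ^ A" using XA A4 by (intro power_mono) auto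
  finally have "(2::nat) ^ (2 * A ^ 3) \<le> 2 ^ (4 * N * A)" by (simp add: power_mult)
  \<comment> \<open>The left-hand side is cubic in \<open>A\<close> and the right-hand side almost
    linear, although the number of primes below \<open>A\<close> was estimated by \<open>A\<close>
    itself.\<close>
  then have "2 * A ^ 3 \<le> 4 * N * A" by simp
  then have "A * A \<le> 2 * N" using A by (simp add: power3_eq_cube)
  moreover have "2 * N < 4 * A" unfolding A_def using less_exp[of N] by linarith
  moreover have "4 * A \<le> A * A" using A by simp
  ultimately show False by linarith
qed

text \<open>Lagrange's bound for polynomials over a field, phrased with integer coefficients: a root
  \<open>a\<close> modulo \<open>p\<close> splits off a linear factor up to the constant
  \<open>poly q a\<close>, which \<open>p\<close> divides.\<close>

lemma card_roots_mod_prime: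
  fixes q :: "int poly" and p :: int
  assumes p: "prime p" and nz: "\<exists>i. \<not> p dvd coeff q i"
  shows "card {r \<in> {0..<p}. p dvd poly q r} \<le> degree q"
  using nz
proof (induction "degree q" arbitrary: q)
  case 0
  then obtain c where q: "q = [:c:]" using degree_eq_zeroE by metis
  then have "\<not> p dvd c" using 0 by (metis coeff_pCons_0 coeff_pCons_Suc coeff_0 dvd_0_right not0_implies_Suc)
  then show ?case using q by simp
next
  case (Suc d)
  show ?case
  proof (cases "\<exists>a\<in>{0..<p}. p dvd poly q a")
    case False
    then have "{r \<in> {0..<p}. p dvd poly q r} = {}" by auto
    then show ?thesis by (metis card.empty zero_le)
  next
    case True
    then obtain a where a: "a \<in> {0..<p}" "p dvd poly q a" by auto
    define h where "h = synthetic_div q a"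
    have q: "q + smult a h = pCons (poly q a) h" unfolding h_def by (rule synthetic_div_correct)
    have deg: "degree h = d" using Suc(2) by (simp add: h_def degree_synthetic_div)
    have qr: "poly q r = poly q a + (r - a) * poly h r" for r
      using arg_cong[OF q, of "\<lambda>f. poly f r"] by (simp add: algebra_simps)
    \<comment> \<open>Modulo \<open>p\<close>, \<open>q\<close> is the product of \<open>h\<close>
      and a linear factor, so a quotient that vanishes modulo \<open>p\<close> would make
      \<open>q\<close> vanish.\<close>
    have "\<exists>i. \<not> p dvd coeff h i"
    proof (rule ccontr)
      assume "\<not> ?thesis"
      then have h: "p dvd coeff h i" for i by auto
      have "p dvd coeff q i" for i
      proof -
        have "coeff q i = coeff (pCons (poly q a) h) i - a * coeff h i"
          using arg_cong[OF q, of "\<lambda>f. coeff f i"] by simp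
        moreover have "p dvd coeff (pCons (poly q a) h) i" using h a by (cases i) auto
        ultimately show ?thesis using h by simp
      qed
      then show False using Suc.prems by auto
    qed
    then have IH: "card {r \<in> {0..<p}. p dvd poly h r} \<le> d" using Suc(1)[of h] deg by simp
    have "{r \<in> {0..<p}. p dvd poly q r} \<subseteq> insert a {r \<in> {0..<p}. p dvd poly h r}"
    proof
      fix r assume r: "r \<in> {r \<in> {0..<p}. p dvd poly q r}"
      then have "p dvd (r - a) * poly h r" using qr[of r] a by (simp add: dvd_add_right_iff)
      then have "p dvd r - a \<or> p dvd poly h r" using p by (simp add: prime_dvd_mult_iff)
      moreover have "r = a" if "p dvd r - a"
      proof -
        have "\<bar>r - a\<bar> < p" using r a by auto
        then show ?thesis using that dvd_imp_le_int[of "r - a" p] by (cases "r = a") auto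
      qed
      ultimately show "r \<in> insert a {r \<in> {0..<p}. p dvd poly h r}" using r by auto
    qed
    then have "card {r \<in> {0..<p}. p dvd poly q r} \<le> card (insert a {r \<in> {0..<p}. p dvd poly h r})"
    proof (rule card_mono[rotated])
      have "finite {r \<in> {0..<p}. p dvd poly h r}" by (rule finite_subset[of _ "{0..<p}"]) auto
      then show "finite (insert a {r \<in> {0..<p}. p dvd poly h r})" by simp
    qed
    also have "\<dots> \<le> Suc d" using IH card_insert_le_m1[of "Suc d"] by (metis card_insert_le_m1 diff_Suc_1 zero_less_Suc)
    finally show ?thesis using Suc(2) by simp
  qed
qed

section \<open>Fingerprints of cuts\<close>

definition digits_num :: "nat \<Rightarrow> (nat \<Rightarrow> nat) \<Rightarrow> nat \<Rightarrow> nat" where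
  "digits_num b f K = (\<Sum>k<K. f k * b ^ k)"

lemma digits_num_Suc [simp]: "digits_num b f (Suc K) = digits_num b f K + f K * b ^ K"
  and digits_num_0 [simp]: "digits_num b f 0 = 0"
  by (simp_all add: digits_num_def)

lemma digits_num_cong: "(\<And>k. k < K \<Longrightarrow> f k = g k) \<Longrightarrow> digits_num b f K = digits_num b g K"
  by (simp add: digits_num_def)

lemma digits_num_less:
  assumes "\<And>k. k < K \<Longrightarrow> f k < b"
  shows "digits_num b f K < b ^ K"
  using assms
proof (induction K)
  case (Suc K)
  have "digits_num b f K + f K * b ^ K < b ^ K + f K * b ^ K" using Suc by simp
  also have "\<dots> = Suc (f K) * b ^ K" by simp
  also have "\<dots> \<le> b * b ^ K" using Suc.prems[of K] by (intro mult_le_mono1) simp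
  finally show ?case by simp
qed simp

definition digit :: "nat \<Rightarrow> nat \<Rightarrow> nat \<Rightarrow> nat" where
  "digit b x k = x div b ^ k mod b"

lemma digit_digits_num:
  assumes "\<And>i. i < K \<Longrightarrow> f i < b" "k < K"
  shows "digit b (digits_num b f K) k = f k"
  using assms
proof (induction K)
  case (Suc K)
  have lt: "digits_num b f K < b ^ K" using Suc.prems by (intro digits_num_less) auto
  have b: "b > 0" using Suc.prems(1)[of K] by simp
  show ?case
  proof (cases "k = K")
    case True
    have "digits_num b f (Suc K) div b ^ K = f K" using lt b by simp
    then show ?thesis using True Suc.prems(1)[of K] by (simp add: digit_def)
  next
    case False
    then have k: "k < K" using Suc.prems by simp
    then obtain d where d: "K = k + Suc d" using less_iff_Suc_add by auto
    have "(digits_num b f K + f K * b ^ K) div b ^ k = digits_num b f K div b ^ k + f K * b ^ Suc d"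
    proof -
      have "f K * b ^ K = (f K * b ^ Suc d) * b ^ k" by (simp add: d power_add)
      then show ?thesis using b by (simp only: div_mult_self1) simp
    qed
    moreover have "f K * b ^ Suc d = (f K * b ^ d) * b" by simp
    ultimately have "digit b (digits_num b f (Suc K)) k = digit b (digits_num b f K) k"
      by (simp only: digit_def digits_num_Suc mod_mult_self1)
    then show ?thesis using Suc k by simp
  qed
qed simp

section \<open>Signed incidence polynomials\<close>

definition edge_index :: "nat \<Rightarrow> nat set \<Rightarrow> nat" where
  "edge_index n e = Min e * (n + 1) + Max e"

definition edge_sign :: "nat set \<Rightarrow> nat \<Rightarrow> int" where
  "edge_sign e s = (if s = Min e then 1 else if s = Max e then -1 else 0)"

definition fingerprint :: "nat \<Rightarrow> nat \<Rightarrow> nat set set \<Rightarrow> nat \<Rightarrow> int" where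
  "fingerprint n r A s = (\<Sum>e\<in>A. edge_sign e s * int r ^ edge_index n e)"

definition cut_coeff :: "nat set \<Rightarrow> nat set \<Rightarrow> int" where
  "cut_coeff U e = of_bool (Min e \<in> U) - of_bool (Max e \<in> U)"

definition cut_poly :: "nat \<Rightarrow> nat set set \<Rightarrow> nat set \<Rightarrow> int poly" where
  "cut_poly n A U = (\<Sum>e\<in>A. monom (cut_coeff U e) (edge_index n e))"

lemma sum_edge_sign:
  assumes "finite U" "Min e \<noteq> Max e"
  shows "(\<Sum>s\<in>U. edge_sign e s) = cut_coeff U e"
proof -
  have "edge_sign e s = of_bool (s = Min e) - of_bool (s = Max e)" for s
    using assms(2) by (simp add: edge_sign_def)
  then show ?thesis using assms(1) by (simp add: sum_subtractf cut_coeff_def of_bool_def)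
qed

lemma edge_Min_Max:
  assumes "edges_on {1..n} A" "e \<in> A"
  shows "e = {Min e, Max e}" "Min e < Max e" "Min e \<in> {1..n}" "Max e \<in> {1..n}"
proof -
  obtain u v where uv: "e = {u, v}" "u \<noteq> v" "u \<in> {1..n}" "v \<in> {1..n}"
    using assms unfolding edges_on_def by blast
  then have "Min e = min u v" "Max e = max u v" by auto
  then show "e = {Min e, Max e}" "Min e < Max e" "Min e \<in> {1..n}" "Max e \<in> {1..n}"
    using uv by (auto simp: min_def max_def)
qed

lemma sum_fingerprint:
  assumes "edges_on {1..n} A" "finite U"
  shows "(\<Sum>s\<in>U. fingerprint n r A s) = poly (cut_poly n A U) (int r)"
proof -
  have "(\<Sum>s\<in>U. fingerprint n r A s) = (\<Sum>e\<in>A. (\<Sum>s\<in>U. edge_sign e s) * int r ^ edge_index n e)"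
    unfolding fingerprint_def sum_distrib_right by (rule sum.swap)
  also have "\<dots> = (\<Sum>e\<in>A. cut_coeff U e * int r ^ edge_index n e)"
  proof (intro sum.cong refl)
    fix e assume "e \<in> A"
    then have "Min e \<noteq> Max e" using edge_Min_Max(2)[OF assms(1)] by fastforce
    then show "(\<Sum>s\<in>U. edge_sign e s) * int r ^ edge_index n e = cut_coeff U e * int r ^ edge_index n e"
      using sum_edge_sign[OF assms(2)] by simp
  qed
  finally show ?thesis by (simp add: cut_poly_def poly_sum poly_monom)
qed

text \<open>\<open>edge_index\<close> is a two-digit number to the base \<open>n + 1\<close>.
  Distinct edges therefore occupy distinct monomials and cannot cancel each other in
  \<open>cut_poly\<close>.\<close>

lemma edge_index_inj:
  assumes "edges_on {1..n} A" "e \<in> A" "e' \<in> A" "edge_index n e = edge_index n e'"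
  shows "e = e'"
proof -
  note e = edge_Min_Max[OF assms(1,2)] and e' = edge_Min_Max[OF assms(1,3)]
  have d: "(x * (n + 1) + y) div (n + 1) = x" "(x * (n + 1) + y) mod (n + 1) = y" if "y \<le> n" for x y :: nat
    using that by (simp_all only: mod_mult_self3 div_mult_self3) simp_all
  have "Max e = Max e'" "Min e = Min e'"
    using assms(4) d[of "Max e" "Min e"] d[of "Max e'" "Min e'"] e(4) e'(4)
    unfolding edge_index_def atLeastAtMost_iff by metis+
  then show ?thesis using e(1) e'(1) by simp
qed

lemma coeff_cut_poly:
  assumes "edges_on {1..n} A" "e \<in> A"
  shows "coeff (cut_poly n A U) (edge_index n e) = cut_coeff U e"
proof -
  have fin: "finite A" using finite_edges_on[OF _ assms(1)] by simp
  have "coeff (cut_poly n A U) (edge_index n e) =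
      (\<Sum>e'\<in>A. if e' = e then cut_coeff U e' else 0)"
    unfolding cut_poly_def coeff_sum
    using edge_index_inj[OF assms(1) _ assms(2)] by (intro sum.cong refl) auto
  also have "\<dots> = cut_coeff U e" using fin assms(2) by simp
  finally show ?thesis .
qed

lemma degree_cut_poly:
  assumes "edges_on {1..n} A"
  shows "degree (cut_poly n A U) \<le> (n + 1) ^ 2"
  unfolding cut_poly_def
proof (rule degree_sum_le)
  show "finite A" using finite_edges_on[OF _ assms] by simp
  fix e assume "e \<in> A"
  then have "Min e \<le> n" "Max e \<le> n" using edge_Min_Max[OF assms] by auto
  then have "edge_index n e \<le> n * (n + 1) + n"
    unfolding edge_index_def by (intro add_mono mult_le_mono1)
  also have "\<dots> \<le> (n + 1) ^ 2" by (simp add: power2_eq_square)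
  finally show "degree (monom (cut_coeff U e) (edge_index n e)) \<le> (n + 1) ^ 2"
    using degree_monom_le le_trans by blast
qed

lemma closed_fingerprint:
  assumes "edges_on {1..n} A" "finite U" "closed_under A U"
  shows "(\<Sum>s\<in>U. fingerprint n r A s) = 0"
proof -
  have "cut_coeff U e = 0" if "e \<in> A" for e
  proof -
    have e: "{Min e, Max e} \<in> A" "{Max e, Min e} \<in> A"
      using edge_Min_Max(1)[OF assms(1) that] that by (simp_all add: insert_commute)
    then have "Min e \<in> U \<longleftrightarrow> Max e \<in> U" using assms(3) unfolding closed_under_def by blast
    then show ?thesis by (simp add: cut_coeff_def)
  qed
  then have "cut_poly n A U = 0" by (simp add: cut_poly_def)
  then show ?thesis using sum_fingerprint[OF assms(1,2)] by simp
qed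

text \<open>An edge that leaves \<open>U\<close> has coefficient 1 or -1, so the cut polynomial is
  nonzero modulo \<open>p\<close> and has few roots. Points below \<open>M\<close> rather than below
  \<open>p\<close> are counted because finitely many fair coins yield a uniform number only below a
  power of two.\<close>

lemma card_false_closed:
  assumes A: "edges_on {1..n} A" and U: "finite U" "\<not> closed_under A U"
    and p: "prime p" "M \<le> p"
  shows "card {r \<in> {..<M}. int p dvd (\<Sum>s\<in>U. fingerprint n r A s)} \<le> (n + 1) ^ 2"
proof -
  let ?q = "cut_poly n A U"
  obtain x y where xy: "{x, y} \<in> A" "x \<in> U" "y \<notin> U" using U(2) by (auto simp: closed_under_def)
  note e = edge_Min_Max[OF A xy(1)]
  have "cut_coeff U {x, y} = 1 \<or> cut_coeff U {x, y} = -1"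
    using xy by (cases "x < y") (auto simp: cut_coeff_def)
  then have "\<not> int p dvd coeff ?q (edge_index n {x, y})"
    unfolding coeff_cut_poly[OF A xy(1)] using p(1) prime_gt_1_nat[of p]
    by (metis dvd_minus_iff int_dvd_int_iff nat_dvd_1_iff_1 not_prime_1 of_nat_1)
  then have "card {r \<in> {0..<int p}. int p dvd poly ?q r} \<le> degree ?q"
    using p(1) by (intro card_roots_mod_prime) auto
  also have "\<dots> \<le> (n + 1) ^ 2" by (rule degree_cut_poly[OF A])
  finally have c: "card {r \<in> {0..<int p}. int p dvd poly ?q r} \<le> (n + 1) ^ 2" .
  have "int ` {r \<in> {..<M}. int p dvd (\<Sum>s\<in>U. fingerprint n r A s)} \<subseteq> {r \<in> {0..<int p}. int p dvd poly ?q r}"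
    using p(2) by (auto simp: sum_fingerprint[OF A U(1)])
  then have "card (int ` {r \<in> {..<M}. int p dvd (\<Sum>s\<in>U. fingerprint n r A s)})
      \<le> card {r \<in> {0..<int p}. int p dvd poly ?q r}"
    by (intro card_mono) (auto intro: finite_subset[of _ "{0..<int p}"])
  then show ?thesis using c by (simp add: card_image)
qed

text \<open>Each small subset is described by a list of length exactly \<open>L\<close>, padded with
  0, which is no vertex.\<close>

lemma card_small_subsets:
  fixes V :: "nat set"
  assumes "0 \<notin> V" "finite V"
  shows "finite {U. U \<subseteq> V \<and> card U \<le> L}" "card {U. U \<subseteq> V \<and> card U \<le> L} \<le> (card V + 1) ^ L"
proof -
  let ?S = "{U. U \<subseteq> V \<and> card U \<le> L}"
  let ?Ls = "{l. set l \<subseteq> insert 0 V \<and> length l = L}"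
  show "finite ?S" using assms by (auto intro: finite_subset[of _ "Pow V"])
  have "?S \<subseteq> (\<lambda>l. set l - {0}) ` ?Ls"
  proof
    fix U assume U: "U \<in> ?S"
    then have "finite U" using assms finite_subset by auto
    then obtain l where "set l = U" "distinct l" using finite_distinct_list by blast
    then have l: "set l = U" "length l = card U" using distinct_card[of l] by auto
    let ?l = "l @ replicate (L - card U) 0"
    have "set ?l - {0} = U" using l U assms(1) by auto
    moreover have "?l \<in> ?Ls" using l U by auto
    ultimately show "U \<in> (\<lambda>l. set l - {0}) ` ?Ls" by (intro image_eqI[of _ _ ?l]) simp_all
  qed
  moreover have fin: "finite ?Ls" using assms finite_lists_length_eq[of "insert 0 V" L] by simp
  ultimately have "card ?S \<le> card ((\<lambda>l. set l - {0}) ` ?Ls)" by (intro card_mono) auto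
  also have "\<dots> \<le> card ?Ls" using fin by (rule card_image_le)
  also have "\<dots> = (card V + 1) ^ L"
    using assms card_lists_length_eq[of "insert 0 V" L] by simp
  finally show "card ?S \<le> (card V + 1) ^ L" .
qed

text \<open>Only sets of at most \<open>L\<close> vertices are ever tested for being closed, which
  keeps the union bound at \<open>(n + 1) ^ L\<close> sets.\<close>

definition deceived :: "nat \<Rightarrow> nat \<Rightarrow> nat \<Rightarrow> nat set set \<Rightarrow> nat \<Rightarrow> bool" where
  "deceived n p L A r \<longleftrightarrow> (\<exists>U \<subseteq> {1..n}. card U \<le> L \<and> \<not> closed_under A U \<and>
     int p dvd (\<Sum>s\<in>U. fingerprint n r A s))"

text \<open>Union bound over \<open>T\<close> edge sets, at most \<open>(n + 1) ^ L\<close> vertex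
  sets for each, and \<open>(n + 1) ^ 2\<close> roots of each cut polynomial. The range of the
  random point is later chosen at least twelve times as large.\<close>

lemma card_deceived:
  assumes A: "\<And>j. j < T \<Longrightarrow> edges_on {1..n} (A j)" and p: "prime p" "M \<le> p"
  shows "card {r \<in> {..<M}. \<exists>j<T. deceived n p L (A j) r} \<le> T * (n + 1) ^ (L + 2)"
proof -
  let ?S = "{U. U \<subseteq> {1..n} \<and> card U \<le> L}"
  let ?B = "\<lambda>(j, U). {r \<in> {..<M}. \<not> closed_under (A j) U \<and> int p dvd (\<Sum>s\<in>U. fingerprint n r (A j) s)}"
  have fin: "finite ({..<T} \<times> ?S)" using card_small_subsets(1)[of "{1..n}" L] by simp
  have "{r \<in> {..<M}. \<exists>j<T. deceived n p L (A j) r} \<subseteq> (\<Union>x\<in>{..<T} \<times> ?S. ?B x)"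
    by (auto simp: deceived_def)
  then have "card {r \<in> {..<M}. \<exists>j<T. deceived n p L (A j) r} \<le> card (\<Union>x\<in>{..<T} \<times> ?S. ?B x)"
    using fin by (intro card_mono) auto
  also have "\<dots> \<le> (\<Sum>x\<in>{..<T} \<times> ?S. card (?B x))" by (rule card_UN_le[OF fin])
  also have "\<dots> \<le> (\<Sum>x\<in>{..<T} \<times> ?S. (n + 1) ^ 2)"
  proof (rule sum_mono)
    fix x assume "x \<in> {..<T} \<times> ?S"
    then obtain j U where x: "x = (j, U)" "j < T" "U \<subseteq> {1..n}" by auto
    have "finite U" using x finite_subset by blast
    show "card (?B x) \<le> (n + 1) ^ 2"
    proof (cases "closed_under (A j) U")
      case True
      then show ?thesis by (simp add: x)
    next
      case False
      then show ?thesis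
        using card_false_closed[OF A[OF x(2)] \<open>finite U\<close> False p] by (simp add: x)
    qed
  qed
  also have "\<dots> = T * card ?S * (n + 1) ^ 2" using fin by (simp add: card_cartesian_product)
  also have "\<dots> \<le> T * (n + 1) ^ L * (n + 1) ^ 2"
    using card_small_subsets(2)[of "{1..n}" L] by (intro mult_le_mono1 mult_le_mono2) simp
  also have "\<dots> = T * (n + 1) ^ (L + 2)" by (simp only: power_add mult.assoc)
  finally show ?thesis .
qed

text \<open>Components are the minimal nonempty closed sets. The test \<open>z\<close> is trusted on
  sets of at most \<open>L\<close> elements only, which is enough because minimality concerns
  subsets of such a set.\<close>

lemma minimal_closed_iff_component:
  assumes A: "edges_on {1..n} A"
    and z: "\<And>U. U \<subseteq> {1..n} \<Longrightarrow> card U \<le> L \<Longrightarrow> z U \<longleftrightarrow> closed_under A U"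
    and S: "S \<subseteq> {1..n}"
  shows "{U. U \<subseteq> S \<and> U \<noteq> {} \<and> card U \<le> L \<and> z U \<and> (\<forall>U'. U' \<subset> U \<longrightarrow> U' \<noteq> {} \<longrightarrow> \<not> z U')} =
    {C \<in> components {1..n} A. C \<subseteq> S \<and> card C \<le> L}" (is "?X = ?Y")
proof -
  have zz: "z U' \<longleftrightarrow> closed_under A U'" if "U' \<subseteq> U" "U \<subseteq> S" "card U \<le> L" for U U'
  proof -
    have "finite U" using that S finite_subset by (meson finite_atLeastAtMost subset_trans)
    then have "card U' \<le> L" using card_mono[of U U'] that by simp
    then show ?thesis using z that S by (meson subset_trans)
  qed
  show ?thesis
  proof (rule set_eqI, rule iffI)
    fix U assume U: "U \<in> ?X"
    then obtain u where u: "u \<in> U" by auto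
    have "closed_under A U" using U zz[of U U] by auto
    then have sub: "component A u \<subseteq> U" using component_subset_closed u by blast
    have "z (component A u)" using zz[OF sub] U closed_under_component by auto
    moreover have "component A u \<noteq> {}" using component_refl by blast
    ultimately have "component A u = U" using U sub by blast
    moreover have "u \<in> {1..n}" using u U S by blast
    ultimately show "U \<in> ?Y" using U by (auto simp: components_def)
  next
    fix U assume U: "U \<in> ?Y"
    then obtain u where u: "U = component A u" "u \<in> {1..n}" by (auto simp: components_def)
    have "z U" using U zz[of U U] closed_under_component u by auto
    moreover have "\<not> z U'" if "U' \<subset> U" "U' \<noteq> {}" for U'
    proof
      assume "z U'"
      then have cl: "closed_under A U'" using zz[of U' U] U that by auto
      have "\<exists>v. v \<in> U'" using that by auto
      then obtain v where v: "v \<in> U'" ..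
      then have "component A v = U" using that u component_eq by blast
      then have "U \<subseteq> U'" using component_subset_closed[OF cl v] by simp
      then show False using that by auto
    qed
    moreover have "U \<noteq> {}" using u component_refl by blast
    ultimately show "U \<in> ?X" using U by auto
  qed
qed

section \<open>Exhaustive search over bit masks of the sample\<close>

definition bitn :: "nat \<Rightarrow> nat \<Rightarrow> nat" where
  "bitn c i = c div 2 ^ i mod 2"

definition popcount :: "nat \<Rightarrow> nat \<Rightarrow> nat" where
  "popcount m c = (\<Sum>i<m. bitn c i)"

definition mask_sum :: "nat \<Rightarrow> (nat \<Rightarrow> nat) \<Rightarrow> nat \<Rightarrow> nat \<Rightarrow> nat" where
  "mask_sum p d m c = (\<Sum>i<m. bitn c i * d i) mod p"

definition mask_excess :: "nat \<Rightarrow> nat \<Rightarrow> nat \<Rightarrow> nat" where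
  "mask_excess m c' c = (\<Sum>i<m. if bitn c' i - bitn c i \<noteq> 0 then 1 else 0)"

text \<open>A proper submask of \<open>c\<close> is a smaller number, so the range
  \<open>c' < c\<close> covers them all. The conditionals are nested in the order in which the
  program tests them.\<close>

definition zero_submasks :: "nat \<Rightarrow> (nat \<Rightarrow> nat) \<Rightarrow> nat \<Rightarrow> nat \<Rightarrow> nat" where
  "zero_submasks p d m c = (\<Sum>c'<c. if c' \<noteq> 0 then
     if mask_excess m c' c \<noteq> 0 then 0 else if mask_sum p d m c' \<noteq> 0 then 0 else 1 else 0)"

text \<open>The truncated difference \<open>popcount m c - L\<close> is nonzero exactly for masks
  with more than \<open>L\<close> elements. Testing this before anything else confines the
  fingerprint tests to small sets and keeps each power at most \<open>2 ^ (a * L)\<close>.\<close>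

definition atom_sum :: "nat \<Rightarrow> (nat \<Rightarrow> nat) \<Rightarrow> nat \<Rightarrow> nat \<Rightarrow> nat \<Rightarrow> nat" where
  "atom_sum p d m L a = (\<Sum>c<2 ^ m. if c \<noteq> 0 then if popcount m c - L \<noteq> 0 then 0
     else if mask_sum p d m c \<noteq> 0 then 0 else if zero_submasks p d m c \<noteq> 0 then 0
     else 2 ^ (a * popcount m c) else 0)"

lemma bitn_set_decode: "bitn c i = of_bool (i \<in> set_decode c)"
  by (simp add: bitn_def set_decode_def mod_2_eq_odd)

lemma set_decode_subset_iff: "set_decode c \<subseteq> {..<m} \<longleftrightarrow> c < 2 ^ m"
proof
  assume sub: "set_decode c \<subseteq> {..<m}"
  have "c = set_encode (set_decode c)" by simp
  also have "\<dots> = (\<Sum>i\<in>set_decode c. 2 ^ i)" by (simp add: set_encode_def)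
  also have "\<dots> \<le> (\<Sum>i<m. 2 ^ i)" using sub by (intro sum_mono2) auto
  also have "\<dots> < 2 ^ m" by (induction m) auto
  finally show "c < 2 ^ m" .
next
  assume c: "c < 2 ^ m"
  show "set_decode c \<subseteq> {..<m}"
  proof
    fix i assume i: "i \<in> set_decode c"
    show "i \<in> {..<m}"
    proof (rule ccontr)
      assume "i \<notin> {..<m}"
      then have "(2::nat) ^ m \<le> 2 ^ i" by simp
      then have "c div 2 ^ i = 0" using c by (intro div_less) linarith
      then show False using i by (simp add: set_decode_def)
    qed
  qed
qed

lemma bij_betw_set_decode: "bij_betw set_decode {..<2 ^ m} (Pow {..<m})"
proof (rule bij_betw_byWitness[where f' = set_encode])
  show "\<forall>A\<in>Pow {..<m}. set_decode (set_encode A) = A"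
    by (auto intro!: set_encode_inverse intro: finite_subset)
  then show "set_encode ` Pow {..<m} \<subseteq> {..<2 ^ m}"
    using set_decode_subset_iff by (metis (no_types, lifting) PowD image_subsetI lessThan_iff)
  show "set_decode ` {..<2 ^ m} \<subseteq> Pow {..<m}"
    using set_decode_subset_iff by (simp add: image_subset_iff)
qed simp

definition mask_set :: "nat list \<Rightarrow> nat \<Rightarrow> nat set" where
  "mask_set ss c = (!) ss ` set_decode c"

lemma bij_betw_mask_set:
  assumes "distinct ss"
  shows "bij_betw (mask_set ss) {..<2 ^ length ss} (Pow (set ss))"
proof -
  have "bij_betw ((!) ss) {..<length ss} (set ss)" using assms bij_betw_nth by blast
  then have "bij_betw ((`) ((!) ss)) (Pow {..<length ss}) (Pow (set ss))" by (rule bij_betw_Pow)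
  from bij_betw_trans[OF bij_betw_set_decode this] show ?thesis
    by (simp add: mask_set_def[abs_def] comp_def)
qed

context
  fixes ss :: "nat list" and m :: nat
  assumes dist: "distinct ss" and m: "m = length ss"
begin

lemma nth_inj_on: "c < 2 ^ m \<Longrightarrow> inj_on ((!) ss) (set_decode c)"
  using inj_on_nth[OF dist] set_decode_subset_iff m by (metis inj_on_subset lessThan_iff subset_iff)

text \<open>Stated over a semiring because it is needed for cardinalities in \<open>nat\<close> and
  for fingerprints in \<open>int\<close>.\<close>

lemma sum_bitn:
  fixes f :: "nat \<Rightarrow> 'a :: comm_semiring_1"
  assumes "c < 2 ^ m"
  shows "(\<Sum>i<m. of_nat (bitn c i) * f (ss ! i)) = (\<Sum>s\<in>mask_set ss c. f s)"
proof -
  have "(\<Sum>i<m. of_nat (bitn c i) * f (ss ! i)) = (\<Sum>i<m. if i \<in> set_decode c then f (ss ! i) else 0)"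
    by (intro sum.cong refl) (simp add: bitn_set_decode)
  also have "\<dots> = (\<Sum>i\<in>set_decode c. f (ss ! i))"
    using set_decode_subset_iff[of c m] assms
    by (simp add: sum.If_cases Int_absorb1)
  also have "\<dots> = (\<Sum>s\<in>mask_set ss c. f s)"
    unfolding mask_set_def using nth_inj_on[OF assms] by (simp add: sum.reindex)
  finally show ?thesis .
qed

lemma popcount_eq: "c < 2 ^ m \<Longrightarrow> popcount m c = card (mask_set ss c)"
  using sum_bitn[of c "\<lambda>_. 1::nat"] by (simp add: popcount_def)

lemma mask_excess_eq_0:
  assumes "c' < 2 ^ m" "c < 2 ^ m"
  shows "mask_excess m c' c = 0 \<longleftrightarrow> mask_set ss c' \<subseteq> mask_set ss c"
proof -
  have "mask_excess m c' c = 0 \<longleftrightarrow> (\<forall>i<m. i \<in> set_decode c' \<longrightarrow> i \<in> set_decode c)"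
    by (auto simp: mask_excess_def bitn_set_decode split: if_splits)
  also have "\<dots> \<longleftrightarrow> set_decode c' \<subseteq> set_decode c"
    using set_decode_subset_iff[of c' m] assms(1) by auto
  also have "\<dots> \<longleftrightarrow> mask_set ss c' \<subseteq> mask_set ss c"
  proof -
    have "inj_on ((!) ss) {..<m}" using inj_on_nth[OF dist] m by simp
    then show ?thesis
      unfolding mask_set_def using set_decode_subset_iff[of _ m] assms
      by (simp add: inj_on_image_subset_iff)
  qed
  finally show ?thesis .
qed

lemma mask_set_psubset:
  assumes "c' < 2 ^ m" "c < 2 ^ m" "mask_set ss c' \<subset> mask_set ss c"
  shows "c' < c"
proof -
  have "mask_excess m c' c = 0" using mask_excess_eq_0 assms by auto
  then have "\<forall>i<m. i \<in> set_decode c' \<longrightarrow> i \<in> set_decode c"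
    by (auto simp: mask_excess_def bitn_set_decode split: if_splits)
  then have sub: "set_decode c' \<subseteq> set_decode c"
    using set_decode_subset_iff[of c' m] assms(1) by auto
  have "set_encode (set_decode c') \<le> set_encode (set_decode c)"
    unfolding set_encode_def using sub by (auto intro: sum_mono2)
  then show ?thesis using assms(3) by (cases "c = c'") auto
qed

lemma mask_set_nonempty: "c < 2 ^ m \<Longrightarrow> c \<noteq> 0 \<longleftrightarrow> mask_set ss c \<noteq> {}"
  by (metis image_is_empty mask_set_def set_decode_inverse set_decode_zero set_encode_empty)

text \<open>The bijection between masks and subsets of the sample turns the search into a sum over
  minimal zero-sum sets. For a point that is not \<open>deceived\<close> these are the small
  components inside the sample. Agreement of the digits \<open>d\<close> with the fingerprints
  modulo \<open>p\<close> suffices.\<close>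

lemma atom_sum_eq:
  assumes A: "edges_on {1..n} A" and ss: "set ss \<subseteq> {1..n}"
    and d: "\<And>i. i < m \<Longrightarrow> int (d i) mod int p = fingerprint n r A (ss ! i) mod int p"
    and r: "\<not> deceived n p L A r"
  shows "atom_sum p d m L a =
    (\<Sum>C\<in>{C \<in> components {1..n} A. C \<subseteq> set ss \<and> card C \<le> L}. 2 ^ (a * card C))"
proof -
  define z where "z U \<longleftrightarrow> int p dvd (\<Sum>s\<in>U. fingerprint n r A s)" for U
  have ms: "mask_sum p d m c = 0 \<longleftrightarrow> z (mask_set ss c)" if c: "c < 2 ^ m" for c
  proof -
    have cg: "(\<Sum>i<m. (int (bitn c i) * int (d i)) mod int p) =
        (\<Sum>i<m. (int (bitn c i) * fingerprint n r A (ss ! i)) mod int p)"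
    proof (rule sum.cong)
      fix i assume "i \<in> {..<m}"
      then have "int (d i) mod int p = fingerprint n r A (ss ! i) mod int p" using d by simp
      then show "(int (bitn c i) * int (d i)) mod int p = (int (bitn c i) * fingerprint n r A (ss ! i)) mod int p"
        by (rule mod_mult_cong[OF refl])
    qed simp
    have "int (\<Sum>i<m. bitn c i * d i) mod int p = (\<Sum>i<m. int (bitn c i) * int (d i)) mod int p"
      by simp
    also have "\<dots> = (\<Sum>i<m. (int (bitn c i) * int (d i)) mod int p) mod int p"
      by (rule mod_sum_eq[symmetric])
    also have "\<dots> = (\<Sum>i<m. (int (bitn c i) * fingerprint n r A (ss ! i)) mod int p) mod int p"
      by (simp only: cg)
    also have "\<dots> = (\<Sum>i<m. int (bitn c i) * fingerprint n r A (ss ! i)) mod int p"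
      by (rule mod_sum_eq)
    also have "\<dots> = (\<Sum>s\<in>mask_set ss c. fingerprint n r A s) mod int p"
      using sum_bitn[OF c, of "fingerprint n r A"] by simp
    finally show ?thesis
      unfolding mask_sum_def z_def by (metis dvd_eq_mod_eq_0 of_nat_dvd_iff)
  qed
  have zz: "z U \<longleftrightarrow> closed_under A U" if "U \<subseteq> {1..n}" "card U \<le> L" for U
  proof -
    have "finite U" using that finite_subset by blast
    then show ?thesis
      unfolding z_def using that r closed_fingerprint[OF A, of U r] by (auto simp: deceived_def)
  qed
  let ?Q = "\<lambda>U. \<forall>U'. U' \<subset> U \<longrightarrow> U' \<noteq> {} \<longrightarrow> \<not> z U'"
  let ?g = "\<lambda>U. if U \<noteq> {} \<and> card U \<le> L \<and> z U \<and> ?Q U then 2 ^ (a * card U) else (0::nat)"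
  have bij: "bij_betw (mask_set ss) {..<2 ^ m} (Pow (set ss))"
    using bij_betw_mask_set[OF dist] m by simp
  have zs: "zero_submasks p d m c = 0 \<longleftrightarrow> ?Q (mask_set ss c)" if c: "c < 2 ^ m" for c
  proof -
    have "zero_submasks p d m c = 0 \<longleftrightarrow>
        (\<forall>c'<c. \<not> (c' \<noteq> 0 \<and> mask_excess m c' c = 0 \<and> mask_sum p d m c' = 0))"
      by (auto simp: zero_submasks_def split: if_splits)
    also have "\<dots> \<longleftrightarrow> (\<forall>c'<c. \<not> (mask_set ss c' \<noteq> {} \<and> mask_set ss c' \<subseteq> mask_set ss c \<and> z (mask_set ss c')))"
    proof -
      have "(c' \<noteq> 0 \<and> mask_excess m c' c = 0 \<and> mask_sum p d m c' = 0) \<longleftrightarrow>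
          (mask_set ss c' \<noteq> {} \<and> mask_set ss c' \<subseteq> mask_set ss c \<and> z (mask_set ss c'))"
        if "c' < c" for c'
      proof -
        have c': "c' < 2 ^ m" using that c by simp
        show ?thesis unfolding mask_set_nonempty[OF c'] mask_excess_eq_0[OF c' c] ms[OF c'] ..
      qed
      then show ?thesis by blast
    qed
    also have "\<dots> \<longleftrightarrow> ?Q (mask_set ss c)"
    proof
      assume L: "\<forall>c'<c. \<not> (mask_set ss c' \<noteq> {} \<and> mask_set ss c' \<subseteq> mask_set ss c \<and> z (mask_set ss c'))"
      show "?Q (mask_set ss c)"
      proof (intro allI impI)
        fix U' assume U': "U' \<subset> mask_set ss c" "U' \<noteq> {}"
        have "mask_set ss c \<subseteq> set ss" using bij c by (auto simp: bij_betw_def)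
        then have "U' \<in> mask_set ss ` {..<2 ^ m}" using bij U' by (auto simp: bij_betw_def)
        then obtain c' where c': "c' < 2 ^ m" "U' = mask_set ss c'" by auto
        then show "\<not> z U'" using L U' mask_set_psubset[OF c'(1) c] by auto
      qed
    next
      assume R: "?Q (mask_set ss c)"
      show "\<forall>c'<c. \<not> (mask_set ss c' \<noteq> {} \<and> mask_set ss c' \<subseteq> mask_set ss c \<and> z (mask_set ss c'))"
      proof (intro allI impI notI)
        fix c' assume c': "c' < c" "mask_set ss c' \<noteq> {} \<and> mask_set ss c' \<subseteq> mask_set ss c \<and> z (mask_set ss c')"
        have "inj_on (mask_set ss) {..<2 ^ m}" using bij by (simp add: bij_betw_def)
        then have "mask_set ss c' \<noteq> mask_set ss c"
          using c c'(1) inj_on_eq_iff[of "mask_set ss" "{..<2 ^ m}" c' c] by simp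
        then have "mask_set ss c' \<subset> mask_set ss c" using c'(2) by blast
        then show False using R c'(2) by blast
      qed
    qed
    finally show ?thesis .
  qed
  have "atom_sum p d m L a = (\<Sum>c<2 ^ m. ?g (mask_set ss c))"
    unfolding atom_sum_def
  proof (intro sum.cong refl)
    fix c :: nat assume "c \<in> {..<2 ^ m}"
    then have c: "c < 2 ^ m" by simp
    show "(if c \<noteq> 0 then if popcount m c - L \<noteq> 0 then 0
     else if mask_sum p d m c \<noteq> 0 then 0 else if zero_submasks p d m c \<noteq> 0 then 0
     else 2 ^ (a * popcount m c) else 0) = ?g (mask_set ss c)"
      unfolding mask_set_nonempty[OF c] popcount_eq[OF c] ms[OF c] zs[OF c] by simp
  qed
  also have "\<dots> = (\<Sum>U\<in>Pow (set ss). ?g U)"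
    by (rule sum.reindex_bij_betw[OF bij])
  also have "\<dots> = (\<Sum>U\<in>{U. U \<subseteq> set ss \<and> U \<noteq> {} \<and> card U \<le> L \<and> z U \<and> ?Q U}. 2 ^ (a * card U))"
    by (intro sum.mono_neutral_cong_right) auto
  also have "{U. U \<subseteq> set ss \<and> U \<noteq> {} \<and> card U \<le> L \<and> z U \<and> ?Q U} =
      {C \<in> components {1..n} A. C \<subseteq> set ss \<and> card C \<le> L}"
    by (rule minimal_closed_iff_component[OF A zz ss])
  finally show ?thesis .
qed

end

section \<open>Independent sampling of vertices\<close>

lemma expectation_bind_finite:
  fixes h :: "'b \<Rightarrow> real"
  assumes "finite (set_pmf p)" "\<And>x. x \<in> set_pmf p \<Longrightarrow> finite (set_pmf (f x))"
  shows "measure_pmf.expectation (bind_pmf p f) h =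
    measure_pmf.expectation p (\<lambda>x. measure_pmf.expectation (f x) h)"
  using assms by (subst pmf_expectation_bind[of "set_pmf p"]) (auto simp: integral_measure_pmf[of "set_pmf p"])

text \<open>A list rather than a set: the machine visits the vertices in increasing order, and the
  position of a vertex in the list is its position in the stored tables.\<close>

primrec sample_list :: "real \<Rightarrow> nat \<Rightarrow> nat list pmf" where
  "sample_list p 0 = return_pmf []"
| "sample_list p (Suc k) =
     bind_pmf (sample_list p k) (\<lambda>l. map_pmf (\<lambda>b. if b then l @ [Suc k] else l) (bernoulli_pmf p))"

lemma finite_sample_list: "finite (set_pmf (sample_list p k))"
  by (induction k) auto

lemma set_sample_list: "l \<in> set_pmf (sample_list p k) \<Longrightarrow> distinct l \<and> set l \<subseteq> {1..k}"
proof (induction k arbitrary: l)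
  case (Suc k)
  then obtain l' where l': "l' \<in> set_pmf (sample_list p k)" "l = l' \<or> l = l' @ [Suc k]"
    by (auto split: if_splits)
  then show ?case using Suc.IH[OF l'(1)] by (fastforce simp: subset_iff)
qed simp

context
  fixes p :: real
  assumes p: "0 < p" "p \<le> 1"
begin

lemma expectation_sample_list_Suc:
  fixes h :: "nat list \<Rightarrow> real"
  shows "measure_pmf.expectation (sample_list p (Suc k)) h =
    measure_pmf.expectation (sample_list p k) (\<lambda>l. h (l @ [Suc k]) * p + h l * (1 - p))"
  using p finite_sample_list[of p k] by (simp add: expectation_bind_finite)

text \<open>Induction on the last vertex: if it belongs to \<open>U\<close>, it must be drawn and
  contributes a factor \<open>p\<close>; otherwise the event does not depend on its coin.\<close>

lemma expectation_subset_sample_list: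
  assumes "U \<subseteq> {1..k}"
  shows "measure_pmf.expectation (sample_list p k) (\<lambda>l. of_bool (U \<subseteq> set l)) = p ^ card U"
  using assms
proof (induction k arbitrary: U)
  case (Suc k)
  have int: "integrable (measure_pmf (sample_list p k)) f" for f :: "_ \<Rightarrow> real"
    using finite_sample_list by (rule integrable_measure_pmf_finite)
  have notin: "Suc k \<notin> set l" if "l \<in> set_pmf (sample_list p k)" for l
    using set_sample_list[OF that] by auto
  show ?case
  proof (cases "Suc k \<in> U")
    case True
    define U' where "U' = U - {Suc k}"
    have U': "U' \<subseteq> {1..k}" using Suc.prems by (fastforce simp: U'_def)
    have U: "U = insert (Suc k) U'" "Suc k \<notin> U'" using True by (auto simp: U'_def)
    have fin: "finite U'" using U' finite_subset by blast
    have "measure_pmf.expectation (sample_list p (Suc k)) (\<lambda>l. of_bool (U \<subseteq> set l)) =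
       measure_pmf.expectation (sample_list p k) (\<lambda>l. of_bool (U' \<subseteq> set l) * p)"
      unfolding expectation_sample_list_Suc
    proof (rule integral_cong_AE)
      show "AE l in measure_pmf (sample_list p k).
          of_bool (U \<subseteq> set (l @ [Suc k])) * p + of_bool (U \<subseteq> set l) * (1 - p) = of_bool (U' \<subseteq> set l) * p"
      proof (rule AE_pmfI)
        fix l assume "l \<in> set_pmf (sample_list p k)"
        then have "Suc k \<notin> set l" using notin by blast
        then have "U \<subseteq> set (l @ [Suc k]) \<longleftrightarrow> U' \<subseteq> set l" "\<not> U \<subseteq> set l"
          unfolding U(1) using U(2) by auto
        then show "of_bool (U \<subseteq> set (l @ [Suc k])) * p + of_bool (U \<subseteq> set l) * (1 - p) = of_bool (U' \<subseteq> set l) * p"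
          by simp
      qed
    qed simp_all
    also have "\<dots> = p ^ card U' * p" using Suc.IH[OF U'] by simp
    also have "\<dots> = p ^ card U" using fin U by simp
    finally show ?thesis .
  next
    case False
    have U': "U \<subseteq> {1..k}" using Suc.prems False by (fastforce simp: le_Suc_eq)
    have "measure_pmf.expectation (sample_list p (Suc k)) (\<lambda>l. of_bool (U \<subseteq> set l) :: real) =
       measure_pmf.expectation (sample_list p k) (\<lambda>l. of_bool (U \<subseteq> set l))"
      unfolding expectation_sample_list_Suc
    proof (rule integral_cong_AE)
      show "AE l in measure_pmf (sample_list p k).
          of_bool (U \<subseteq> set (l @ [Suc k])) * p + of_bool (U \<subseteq> set l) * (1 - p) = of_bool (U \<subseteq> set l)"
      proof (rule AE_pmfI)
        fix l
        have "U \<subseteq> set (l @ [Suc k]) \<longleftrightarrow> U \<subseteq> set l" using False by auto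
        then show "of_bool (U \<subseteq> set (l @ [Suc k])) * p + of_bool (U \<subseteq> set l) * (1 - p) = of_bool (U \<subseteq> set l)"
          by (simp add: algebra_simps)
      qed
    qed simp_all
    then show ?thesis using Suc.IH[OF U'] by simp
  qed
qed simp

lemma expectation_length_sample_list:
  "measure_pmf.expectation (sample_list p k) (\<lambda>l. real (length l)) = p * k"
proof (induction k)
  case (Suc k)
  have int: "integrable (measure_pmf (sample_list p k)) f" for f :: "_ \<Rightarrow> real"
    using finite_sample_list by (rule integrable_measure_pmf_finite)
  have "measure_pmf.expectation (sample_list p (Suc k)) (\<lambda>l. real (length l)) =
      measure_pmf.expectation (sample_list p k) (\<lambda>l. real (length l) + p)"
    unfolding expectation_sample_list_Suc by (simp add: algebra_simps)
  also have "\<dots> = p * k + p" using Suc.IH int by (simp add: Bochner_Integration.integral_add)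
  finally show ?case by (simp add: algebra_simps)
qed simp

lemma prob_sample_list_too_long:
  assumes "c > 0" "p * k \<le> c / 12"
  shows "measure_pmf.prob (sample_list p k) {l. c \<le> length l} \<le> 1 / 12"
proof -
  have "measure_pmf.prob (sample_list p k) {l \<in> space (measure_pmf (sample_list p k)). c \<le> real (length l)}
      \<le> measure_pmf.expectation (sample_list p k) (\<lambda>l. real (length l)) / c"
    using assms(1) finite_sample_list[of p k]
    by (intro integral_Markov_inequality_measure[where A = "{}"]) (auto intro: integrable_measure_pmf_finite)
  also have "\<dots> = p * k / c" by (simp add: expectation_length_sample_list)
  also have "\<dots> \<le> 1 / 12" using assms by (simp add: field_simps)
  finally show ?thesis by simp
qed

text \<open>Disjoint components survive independently, so their covariances vanish. An indicator
  scaled by its inverse probability has mean 1 and variance \<open>(1 / p) ^ card C - 1\<close>.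
  Chebyshev's inequality is obtained as Markov's for the squared deviation.\<close>

lemma component_estimator_deviation:
  fixes \<C> :: "nat set set" and k L :: nat and \<eta> :: real
  assumes disj: "\<And>C D. C \<in> \<C> \<Longrightarrow> D \<in> \<C> \<Longrightarrow> C \<noteq> D \<Longrightarrow> C \<inter> D = {}"
    and sub: "\<And>C. C \<in> \<C> \<Longrightarrow> C \<subseteq> {1..k}" and L: "\<And>C. C \<in> \<C> \<Longrightarrow> card C \<le> L"
    and fin: "finite \<C>" and \<eta>: "\<eta> > 0"
  shows "measure_pmf.prob (sample_list p k)
      {l. \<eta> \<le> \<bar>(\<Sum>C\<in>{C\<in>\<C>. C \<subseteq> set l}. (1 / p) ^ card C) - card \<C>\<bar>}
    \<le> card \<C> * ((1 / p) ^ L - 1) / \<eta>\<^sup>2"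
proof -
  let ?M = "measure_pmf (sample_list p k)"
  define X where "X l = (\<Sum>C\<in>\<C>. (1 / p) ^ card C * of_bool (C \<subseteq> set l))" for l
  have Xeq: "(\<Sum>C\<in>{C\<in>\<C>. C \<subseteq> set l}. (1 / p) ^ card C) = X l" for l
    using fin by (simp add: X_def Int_def)
  have int: "integrable ?M f" for f :: "_ \<Rightarrow> real"
    using finite_sample_list by (rule integrable_measure_pmf_finite)
  have EX: "measure_pmf.expectation (sample_list p k) X = card \<C>"
  proof -
    have "measure_pmf.expectation (sample_list p k) X =
        (\<Sum>C\<in>\<C>. (1 / p) ^ card C * measure_pmf.expectation (sample_list p k) (\<lambda>l. of_bool (C \<subseteq> set l)))"
      unfolding X_def using int by (subst Bochner_Integration.integral_sum) auto
    also have "\<dots> = (\<Sum>C\<in>\<C>. 1)"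
      using sub p by (intro sum.cong refl) (simp add: expectation_subset_sample_list power_divide)
    finally show ?thesis by simp
  qed
  \<comment> \<open>For \<open>C = D\<close> one factor \<open>(1 / p) ^ card C\<close> remains; for
    disjoint sets the cardinalities add up and everything cancels.\<close>
  have prod: "(1 / p) ^ card C * (1 / p) ^ card D *
      measure_pmf.expectation (sample_list p k) (\<lambda>l. of_bool (C \<union> D \<subseteq> set l))
      = (if C = D then (1 / p) ^ card C else 1)" if CD: "C \<in> \<C>" "D \<in> \<C>" for C D
  proof -
    have f: "finite C" "finite D" using sub CD finite_subset by blast+
    have e: "measure_pmf.expectation (sample_list p k) (\<lambda>l. of_bool (C \<union> D \<subseteq> set l)) = p ^ card (C \<union> D)"
      using sub CD by (intro expectation_subset_sample_list) auto
    show ?thesis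
    proof (cases "C = D")
      case True
      then show ?thesis unfolding e using p by (simp add: power_divide)
    next
      case False
      then have "card (C \<union> D) = card C + card D" using disj CD f by (simp add: card_Un_disjoint)
      then show ?thesis unfolding e using p False by (simp add: power_divide power_add)
    qed
  qed
  have EX2: "measure_pmf.expectation (sample_list p k) (\<lambda>l. (X l)\<^sup>2) =
      (\<Sum>C\<in>\<C>. \<Sum>D\<in>\<C>. if C = D then (1 / p) ^ card C else 1)"
  proof -
    have "(X l)\<^sup>2 = (\<Sum>C\<in>\<C>. \<Sum>D\<in>\<C>. (1 / p) ^ card C * (1 / p) ^ card D * of_bool (C \<union> D \<subseteq> set l))" for l
      unfolding X_def power2_eq_square sum_product by (intro sum.cong refl) auto
    then have "measure_pmf.expectation (sample_list p k) (\<lambda>l. (X l)\<^sup>2) =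
      (\<Sum>C\<in>\<C>. \<Sum>D\<in>\<C>. (1 / p) ^ card C * (1 / p) ^ card D *
        measure_pmf.expectation (sample_list p k) (\<lambda>l. of_bool (C \<union> D \<subseteq> set l)))"
      using int by (simp add: Bochner_Integration.integral_sum)
    then show ?thesis using prod by simp
  qed
  have sumsq: "(\<Sum>C\<in>\<C>. \<Sum>D\<in>\<C>. if C = D then (1 / p) ^ card C else 1) =
      (real (card \<C>))\<^sup>2 + (\<Sum>C\<in>\<C>. (1 / p) ^ card C - 1)"
  proof -
    have "(\<Sum>D\<in>\<C>. if C = D then (1 / p) ^ card C else 1) = real (card \<C>) + ((1 / p) ^ card C - 1)"
      if "C \<in> \<C>" for C
    proof -
      have "(\<Sum>D\<in>\<C>. if C = D then (1 / p) ^ card C else 1) =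
        (\<Sum>D\<in>\<C>. 1 + (if C = D then (1 / p) ^ card C - 1 else 0))"
        by (intro sum.cong) auto
      also have "\<dots> = real (card \<C>) + ((1 / p) ^ card C - 1)"
        using fin that by (simp add: sum.distrib)
      finally show ?thesis .
    qed
    then show ?thesis by (simp add: sum.distrib power2_eq_square)
  qed
  have var: "measure_pmf.expectation (sample_list p k) (\<lambda>l. (X l - card \<C>)\<^sup>2) =
      (\<Sum>C\<in>\<C>. (1 / p) ^ card C - 1)"
  proof -
    have "measure_pmf.expectation (sample_list p k) (\<lambda>l. (X l - card \<C>)\<^sup>2) =
      measure_pmf.expectation (sample_list p k) (\<lambda>l. (X l)\<^sup>2 - 2 * card \<C> * X l + (card \<C>)\<^sup>2)"
      by (simp add: power2_diff algebra_simps)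
    also have "\<dots> = measure_pmf.expectation (sample_list p k) (\<lambda>l. (X l)\<^sup>2)
        - 2 * card \<C> * measure_pmf.expectation (sample_list p k) X + (card \<C>)\<^sup>2"
      using int by simp
    also have "\<dots> = (\<Sum>C\<in>\<C>. (1 / p) ^ card C - 1)"
      unfolding EX EX2 sumsq by (simp add: power2_eq_square algebra_simps)
    finally show ?thesis .
  qed
  have "measure_pmf.prob (sample_list p k) {l. \<eta> \<le> \<bar>X l - card \<C>\<bar>} =
      measure_pmf.prob (sample_list p k) {l \<in> space ?M. \<eta>\<^sup>2 \<le> (X l - card \<C>)\<^sup>2}"
  proof -
    have "\<eta> \<le> \<bar>y\<bar> \<longleftrightarrow> \<eta>\<^sup>2 \<le> y\<^sup>2" for y :: real
      using \<eta> abs_le_square_iff[of \<eta> y] by simp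
    then show ?thesis by simp
  qed
  also have "\<dots> \<le> measure_pmf.expectation (sample_list p k) (\<lambda>l. (X l - card \<C>)\<^sup>2) / \<eta>\<^sup>2"
    using int \<eta> by (intro integral_Markov_inequality_measure[where A = "{}"]) auto
  also have "\<dots> = (\<Sum>C\<in>\<C>. (1 / p) ^ card C - 1) / \<eta>\<^sup>2" by (simp only: var)
  also have "\<dots> \<le> (\<Sum>C\<in>\<C>. (1 / p) ^ L - 1) / \<eta>\<^sup>2"
    using L p by (intro divide_right_mono sum_mono diff_right_mono power_increasing) auto
  finally show ?thesis by (simp add: Xeq)
qed

end

section \<open>Compiling bounded arithmetic expressions\<close>

definition bounded_memory :: "nat \<Rightarrow> nat \<Rightarrow> memory \<Rightarrow> bool" where
  "bounded_memory K B M \<longleftrightarrow> (\<forall>x\<ge>K. M x = 0) \<and> (\<forall>x. M x \<le> B)"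

definition space_bound :: "nat \<Rightarrow> nat \<Rightarrow> nat" where
  "space_bound K B = K * (bits K + bits B)"

lemma bits_mono: "a \<le> b \<Longrightarrow> bits a \<le> bits b"
  unfolding bits_def using floorlog_mono[of a b 2] by auto

lemma memory_bits_le:
  assumes "bounded_memory K B M"
  shows "memory_bits M \<le> space_bound K B"
proof -
  have sub: "{a. M a \<noteq> 0} \<subseteq> {..<K}"
  proof
    fix a assume "a \<in> {a. M a \<noteq> 0}"
    then show "a \<in> {..<K}"
      using assms by (cases "a < K") (auto simp: bounded_memory_def)
  qed
  have "memory_bits M \<le> (\<Sum>a\<in>{a. M a \<noteq> 0}. bits K + bits B)"
    unfolding memory_bits_def
    using sub assms by (intro sum_mono add_mono bits_mono) (auto simp: bounded_memory_def)
  also have "\<dots> \<le> (\<Sum>a\<in>{..<K}. bits K + bits B)"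
    using sub by (intro sum_mono2) auto
  finally show ?thesis by (simp add: space_bound_def)
qed

lemma bounded_memory_upd:
  "bounded_memory K B M \<Longrightarrow> x < K \<Longrightarrow> v \<le> B \<Longrightarrow> bounded_memory K B (M(x := v))"
  by (auto simp: bounded_memory_def)

text \<open>\<open>spmf_of_pmf\<close> expresses that no probability is lost to divergence. The
  quantification over all configurations with memory \<open>M\<close> is needed because time and
  peak vary. Time is left open: only the post-processing is timed, and it is a fixed sequence of two
  instructions.\<close>

definition runs :: "nat \<Rightarrow> nat \<Rightarrow> program \<Rightarrow> memory \<Rightarrow> memory pmf \<Rightarrow> bool" where
  "runs K B p M D \<longleftrightarrow> (\<forall>s. mem s = M \<longrightarrow>
     (\<exists>D'. exec p s = spmf_of_pmf D' \<and> map_pmf mem D' = D \<and>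
        (\<forall>s'\<in>set_pmf D'. peak s' \<le> max (peak s) (space_bound K B))))"

lemma mem_assign [simp]: "mem (assign c a v s) = (mem s)(a := v)"
  and peak_assign [simp]: "peak (assign c a v s) = max (peak s) (memory_bits ((mem s)(a := v)))"
  and mem_charge [simp]: "mem (charge c s) = mem s"
  and peak_charge [simp]: "peak (charge c s) = peak s"
  by (simp_all add: assign_def set_mem_def charge_def)

lemma runs_assign:
  assumes "\<And>s :: config. mem s = M \<Longrightarrow> \<exists>c. exec p s = return_spmf (assign c x v s)"
    and "bounded_memory K B (M(x := v))"
  shows "runs K B p M (return_pmf (M(x := v)))"
  unfolding runs_def
proof (intro allI impI)
  fix s :: config assume s: "mem s = M"
  obtain c where c: "exec p s = return_spmf (assign c x v s)" using assms(1)[OF s] by blast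
  show "\<exists>D'. exec p s = spmf_of_pmf D' \<and> map_pmf mem D' = return_pmf (M(x := v)) \<and>
      (\<forall>s'\<in>set_pmf D'. peak s' \<le> max (peak s) (space_bound K B))"
    using memory_bits_le[OF assms(2)] s
    by (intro exI[of _ "return_pmf (assign c x v s)"]) (auto simp: c)
qed

lemma runs_Const:
  "bounded_memory K B M \<Longrightarrow> x < K \<Longrightarrow> c \<le> B \<Longrightarrow> runs K B (Const x c) M (return_pmf (M(x := c)))"
  by (rule runs_assign) (auto simp: bounded_memory_upd)

lemma runs_Arith:
  "bounded_memory K B M \<Longrightarrow> x < K \<Longrightarrow> v = arith_op f (M y) (M z) \<Longrightarrow> v \<le> B \<Longrightarrow>
    runs K B (Arith f x y z) M (return_pmf (M(x := v)))"
  by (rule runs_assign) (auto simp: bounded_memory_upd)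

lemma runs_Flip:
  assumes "bounded_memory K B M" "x < K" "1 \<le> B"
  shows "runs K B (Flip x) M (map_pmf (\<lambda>b. M(x := of_bool b)) (pmf_of_set UNIV))"
  unfolding runs_def
proof (intro allI impI)
  fix s :: config assume s: "mem s = M"
  have "memory_bits (M(x := of_bool b)) \<le> space_bound K B" for b
    using assms by (intro memory_bits_le bounded_memory_upd) auto
  moreover have "coin_spmf = spmf_of_pmf (pmf_of_set UNIV)" by simp
  ultimately show "\<exists>D'. exec (Flip x) s = spmf_of_pmf D' \<and>
      map_pmf mem D' = map_pmf (\<lambda>b. M(x := of_bool b)) (pmf_of_set UNIV) \<and>
      (\<forall>s'\<in>set_pmf D'. peak s' \<le> max (peak s) (space_bound K B))"
    using s
    by (intro exI[of _ "map_pmf (\<lambda>b. assign 0 x (of_bool b) s) (pmf_of_set UNIV)"])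
      (auto simp: map_pmf_comp max.coboundedI2 simp del: spmf_of_pmf_pmf_of_set)
qed

lemma runs_Seq:
  assumes p: "runs K B p M D" and q: "\<And>M'. M' \<in> set_pmf D \<Longrightarrow> runs K B q M' (F M')"
  shows "runs K B (Seq p q) M (bind_pmf D F)"
  unfolding runs_def
proof (intro allI impI)
  fix s :: config assume s: "mem s = M"
  obtain D' where D': "exec p s = spmf_of_pmf D'" "map_pmf mem D' = D"
    "\<And>s'. s' \<in> set_pmf D' \<Longrightarrow> peak s' \<le> max (peak s) (space_bound K B)"
    using p s unfolding runs_def by blast
  have "\<exists>G. exec q s' = spmf_of_pmf G \<and> map_pmf mem G = F (mem s') \<and>
      (\<forall>s''\<in>set_pmf G. peak s'' \<le> max (peak s') (space_bound K B))" if "s' \<in> set_pmf D'" for s'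
    using q[of "mem s'"] that D'(2) unfolding runs_def by force
  \<comment> \<open>The continuation is chosen for each configuration, since configurations with
    equal memory may differ in time and peak.\<close>
  then obtain G where G: "\<And>s'. s' \<in> set_pmf D' \<Longrightarrow> exec q s' = spmf_of_pmf (G s')"
    "\<And>s'. s' \<in> set_pmf D' \<Longrightarrow> map_pmf mem (G s') = F (mem s')"
    "\<And>s' s''. s' \<in> set_pmf D' \<Longrightarrow> s'' \<in> set_pmf (G s') \<Longrightarrow> peak s'' \<le> max (peak s') (space_bound K B)"
    by metis
  have 1: "exec (Seq p q) s = spmf_of_pmf (bind_pmf D' G)"
    by (simp add: D'(1) spmf_of_pmf_bind G(1) cong: bind_pmf_cong)
  have 2: "map_pmf mem (bind_pmf D' G) = bind_pmf D F"
    by (simp add: map_bind_pmf G(2) D'(2)[symmetric] bind_map_pmf cong: bind_pmf_cong)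
  show "\<exists>D'. exec (Seq p q) s = spmf_of_pmf D' \<and> map_pmf mem D' = bind_pmf D F \<and>
      (\<forall>s'\<in>set_pmf D'. peak s' \<le> max (peak s) (space_bound K B))"
    using 1 2 D'(3) G(3) by (intro exI[of _ "bind_pmf D' G"]) fastforce
qed

lemma runs_Seq_det:
  "runs K B p M (return_pmf M') \<Longrightarrow> runs K B q M' D \<Longrightarrow> runs K B (Seq p q) M D"
  using runs_Seq[of K B p M "return_pmf M'" q "\<lambda>_. D"] by (simp add: bind_return_pmf)

lemma runs_Cond:
  assumes "M x \<noteq> 0 \<Longrightarrow> runs K B p M D" "M x = 0 \<Longrightarrow> runs K B q M D"
  shows "runs K B (Cond x p q) M D"
  unfolding runs_def
proof (intro allI impI)
  fix s :: config assume s: "mem s = M"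
  then show "\<exists>D'. exec (Cond x p q) s = spmf_of_pmf D' \<and> map_pmf mem D' = D \<and>
      (\<forall>s'\<in>set_pmf D'. peak s' \<le> max (peak s) (space_bound K B))"
    using assms unfolding runs_def
    by (cases "M x = 0") (auto dest!: spec[where x = "charge (read_cost x s) s"])
qed

lemma runs_While_0: "M x = 0 \<Longrightarrow> runs K B (While x p) M (return_pmf M)"
  unfolding runs_def
proof (intro allI impI)
  fix s :: config assume "M x = 0" "mem s = M"
  then show "\<exists>D'. exec (While x p) s = spmf_of_pmf D' \<and> map_pmf mem D' = return_pmf M \<and>
      (\<forall>s'\<in>set_pmf D'. peak s' \<le> max (peak s) (space_bound K B))"
    by (intro exI[of _ "return_pmf (charge (read_cost x s) s)"]) (auto simp: loop.simps)
qed

text \<open>A single unfolding of the loop; termination comes from the inductions over a counter in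
  which this rule is applied.\<close>

lemma runs_While_step:
  assumes "M x \<noteq> 0" "runs K B (Seq p (While x p)) M D"
  shows "runs K B (While x p) M D"
  unfolding runs_def
proof (intro allI impI)
  fix s :: config assume s: "mem s = M"
  have "exec (While x p) s = exec (Seq p (While x p)) (charge (read_cost x s) s)"
  proof -
    have "exec (While x p) s = bind_spmf (exec p (charge (read_cost x s) s)) (loop x (exec p))"
      using assms(1) s by (simp add: loop.simps[of x _ s])
    moreover have "exec (While x p) = loop x (exec p)" by (rule ext) simp
    ultimately show ?thesis by (simp del: exec.simps(9))
  qed
  then show "\<exists>D'. exec (While x p) s = spmf_of_pmf D' \<and> map_pmf mem D' = D \<and>
      (\<forall>s'\<in>set_pmf D'. peak s' \<le> max (peak s) (space_bound K B))"
    using assms(2) s unfolding runs_def by (auto dest!: spec[where x = "charge (read_cost x s) s"])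
qed

text \<open>
  \<open>Rec i a l e b\<close> starts with the accumulator \<open>a\<close> set to \<open>e\<close> and replaces it by the value of \<open>b\<close>
  for \<open>i = 0, \<dots>, l - 1\<close>. Whole tables are stored as the digits of a single number, so that the
  number of cells in use is a constant and space is governed by the largest value.
\<close>

datatype aexp = Num nat | Var nat | Bin arith aexp aexp | Ite aexp aexp aexp
  | Rec nat nat aexp aexp aexp

primrec aval :: "aexp \<Rightarrow> memory \<Rightarrow> nat" where
  "aval (Num c) M = c"
| "aval (Var x) M = M x"
| "aval (Bin f d e) M = arith_op f (aval d M) (aval e M)"
| "aval (Ite c d e) M = (if aval c M \<noteq> 0 then aval d M else aval e M)"
| "aval (Rec i a l e b) M = rec_nat (aval e M) (\<lambda>k v. aval b (M(i := k, a := v))) (aval l M)"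

text \<open>Only the branch that is taken has to fit, and the body of a recursion only for the
  values that its accumulator actually assumes. A test can therefore protect a subexpression from
  large values.\<close>

primrec fits :: "nat \<Rightarrow> aexp \<Rightarrow> memory \<Rightarrow> bool" where
  "fits B (Num c) M \<longleftrightarrow> c \<le> B"
| "fits B (Var x) M \<longleftrightarrow> M x \<le> B"
| "fits B (Bin f d e) M \<longleftrightarrow> fits B d M \<and> fits B e M \<and> arith_op f (aval d M) (aval e M) \<le> B"
| "fits B (Ite c d e) M \<longleftrightarrow> fits B c M \<and> (if aval c M \<noteq> 0 then fits B d M else fits B e M)"
| "fits B (Rec i a l e b) M \<longleftrightarrow> fits B l M \<and> fits B e M \<and> (\<forall>k<aval l M.
     fits B b (M(i := k, a := rec_nat (aval e M) (\<lambda>k v. aval b (M(i := k, a := v))) k)))"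

primrec vars :: "aexp \<Rightarrow> nat set" where
  "vars (Num c) = {}"
| "vars (Var x) = {x}"
| "vars (Bin f d e) = vars d \<union> vars e"
| "vars (Ite c d e) = vars c \<union> vars d \<union> vars e"
| "vars (Rec i a l e b) = {i, a} \<union> vars l \<union> vars e \<union> vars b"

primrec bound_vars :: "aexp \<Rightarrow> nat set" where
  "bound_vars (Num c) = {}"
| "bound_vars (Var x) = {}"
| "bound_vars (Bin f d e) = bound_vars d \<union> bound_vars e"
| "bound_vars (Ite c d e) = bound_vars c \<union> bound_vars d \<union> bound_vars e"
| "bound_vars (Rec i a l e b) = {i, a} \<union> bound_vars l \<union> bound_vars e \<union> bound_vars b"

text \<open>A loop body must not bind the counter or the accumulator of the loop around it. The
  length and the start value may reuse them, because they are evaluated before the loop writes these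
  cells and leave them zero.\<close>

primrec wf_exp :: "aexp \<Rightarrow> bool" where
  "wf_exp (Num c) \<longleftrightarrow> True"
| "wf_exp (Var x) \<longleftrightarrow> True"
| "wf_exp (Bin f d e) \<longleftrightarrow> wf_exp d \<and> wf_exp e"
| "wf_exp (Ite c d e) \<longleftrightarrow> wf_exp c \<and> wf_exp d \<and> wf_exp e"
| "wf_exp (Rec i a l e b) \<longleftrightarrow> i \<noteq> a \<and> i \<notin> bound_vars b \<and> a \<notin> bound_vars b \<and>
     wf_exp l \<and> wf_exp e \<and> wf_exp b"

text \<open>How far the compiled code reaches above its target cell. A variable counts 1 because it
  is copied by adding the zero cell next to the target.\<close>

primrec depth :: "aexp \<Rightarrow> nat" where
  "depth (Num c) = 0"
| "depth (Var x) = 1"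
| "depth (Bin f d e) = max (depth d) (Suc (depth e))"
| "depth (Ite c d e) = max (depth c) (max (depth d) (depth e))"
| "depth (Rec i a l e b) = max (depth l) (2 + max (depth e) (depth b))"

text \<open>
  \<open>compile e t\<close> leaves the value of \<open>e\<close> in cell \<open>t\<close>. The cells above \<open>t\<close> serve as scratch space; they
  and the bound variables of \<open>e\<close> must be zero before and are zero again afterwards, so that the
  memory changes in cell \<open>t\<close> only.
\<close>

primrec compile :: "aexp \<Rightarrow> nat \<Rightarrow> program" where
  "compile (Num c) t = Const t c"
| "compile (Var x) t = Arith Add t x (Suc t)"
| "compile (Bin f d e) t =
     Seq (compile d t) (Seq (compile e (Suc t)) (Seq (Arith f t t (Suc t)) (Const (Suc t) 0)))"
| "compile (Ite c d e) t =
     Seq (compile c t) (Cond t (Seq (Const t 0) (compile d t)) (compile e t))"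
| "compile (Rec i a l e b) t =
     Seq (compile l t) (Seq (compile e (Suc t)) (Seq (Arith Add a (Suc t) (t + 2))
     (Seq (Const (Suc t) 0)
     (Seq (While t
        (Seq (compile b (Suc t)) (Seq (Arith Add a (Suc t) (t + 2)) (Seq (Const (Suc t) 1)
        (Seq (Arith Add i i (Suc t)) (Seq (Arith Sub t t (Suc t)) (Const (Suc t) 0)))))))
     (Seq (Arith Add t a (Suc t)) (Seq (Const a 0) (Const i 0)))))))"

lemma aval_cong: "(\<And>x. x \<in> vars e \<Longrightarrow> M x = M' x) \<Longrightarrow> aval e M = aval e M'"
proof (induction e arbitrary: M M')
  case (Rec i a l e b)
  have "aval b (M(i := k, a := v)) = aval b (M'(i := k, a := v))" for k v
    using Rec.prems by (intro Rec.IH(3)) auto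
  moreover have "aval l M = aval l M'" "aval e M = aval e M'"
    using Rec.prems by (auto intro!: Rec.IH(1,2))
  ultimately show ?case by simp
next
  case (Bin f d e)
  then show ?case by (metis UnCI aval.simps(3) vars.simps(3))
next
  case (Ite c d e)
  have "aval c M = aval c M'" "aval d M = aval d M'" "aval e M = aval e M'"
    using Ite.prems by (auto intro!: Ite.IH)
  then show ?case by simp
qed auto

lemma fits_cong: "(\<And>x. x \<in> vars e \<Longrightarrow> M x = M' x) \<Longrightarrow> fits B e M = fits B e M'"
proof (induction e arbitrary: M M')
  case (Rec i a l e b)
  have "aval b (M(i := k, a := v)) = aval b (M'(i := k, a := v))" for k v
    using Rec.prems by (intro aval_cong) auto
  moreover have "fits B b (M(i := k, a := v)) = fits B b (M'(i := k, a := v))" for k v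
    using Rec.prems by (intro Rec.IH(3)) auto
  moreover have "aval l M = aval l M'" "aval e M = aval e M'"
    using Rec.prems by (auto intro!: aval_cong)
  moreover have "fits B l M = fits B l M'" "fits B e M = fits B e M'"
    using Rec.prems by (auto intro!: Rec.IH(1,2))
  ultimately show ?case by simp
next
  case (Bin f d e)
  have "aval d M = aval d M'" "aval e M = aval e M'" "fits B d M = fits B d M'" "fits B e M = fits B e M'"
    using Bin.prems by (auto intro!: Bin.IH aval_cong)
  then show ?case by simp
next
  case (Ite c d e)
  have "aval c M = aval c M'" "fits B c M = fits B c M'" "fits B d M = fits B d M'" "fits B e M = fits B e M'"
    using Ite.prems by (auto intro!: Ite.IH aval_cong)
  then show ?case by simp
qed auto

lemma fits_le: "fits B e M \<Longrightarrow> aval e M \<le> B"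
proof (induction e arbitrary: M)
  case (Rec i a l e b)
  show ?case
  proof (cases "aval l M")
    case 0
    then show ?thesis using Rec by simp
  next
    case (Suc k)
    then show ?thesis using Rec.prems Rec.IH(3) by (simp del: fun_upd_apply)
  qed
qed (auto split: if_splits)

definition clear :: "nat set \<Rightarrow> memory \<Rightarrow> bool" where
  "clear A M \<longleftrightarrow> (\<forall>x\<in>A. M x = 0)"

lemma clearD: "clear A M \<Longrightarrow> x \<in> A \<Longrightarrow> M x = 0"
  by (simp add: clear_def)

lemma clear_Un [simp]: "clear (A \<union> A') M \<longleftrightarrow> clear A M \<and> clear A' M"
  by (auto simp: clear_def)

lemma clear_insert [simp]: "clear (insert x A) M \<longleftrightarrow> M x = 0 \<and> clear A M"
  by (auto simp: clear_def)

lemma clear_empty [simp]: "clear {} M"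
  by (simp add: clear_def)

lemma clear_upd: "clear A M \<Longrightarrow> x \<notin> A \<Longrightarrow> clear A (M(x := v))"
  by (auto simp: clear_def)

lemma clear_upd_Suc: "clear {t..} M \<Longrightarrow> x \<le> t \<Longrightarrow> clear {Suc t..} (M(x := v))"
  by (auto simp: clear_def)

lemma lessThan_SucI: "A \<subseteq> {..<t} \<Longrightarrow> A \<subseteq> {..<Suc t}"
  by auto

text \<open>Induction with the target cell generalized: a second operand is compiled one cell
  higher, where the hypotheses still hold because all variables lie below \<open>t\<close>.
  Boundedness of the memory is maintained at every assignment and yields the space bound.\<close>

lemma runs_compile:
  assumes "wf_exp e" "fits B e M" "bounded_memory K B M" "clear (bound_vars e) M"
    "clear {t..} M" "vars e \<subseteq> {..<t}" "bound_vars e \<subseteq> {..<t}"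
    "t + depth e < K" "1 \<le> B"
  shows "runs K B (compile e t) M (return_pmf (M(t := aval e M)))"
  using assms
proof (induction e arbitrary: M t)
  case (Num c)
  then show ?case unfolding aval.simps compile.simps by (intro runs_Const) auto
next
  case (Var x)
  then show ?case
    unfolding aval.simps compile.simps by (intro runs_Arith) (auto simp: clear_def)
next
  case (Bin f d e)
  let ?M1 = "M(t := aval d M)"
  let ?M2 = "?M1(Suc t := aval e M)"
  let ?v = "arith_op f (aval d M) (aval e M)"
  have le: "aval d M \<le> B" "aval e M \<le> B" using Bin.prems(2) fits_le by auto
  have b1: "bounded_memory K B ?M1" using le Bin.prems by (intro bounded_memory_upd) auto
  have b2: "bounded_memory K B ?M2" using le Bin.prems by (intro bounded_memory_upd[OF b1]) auto
  have b3: "bounded_memory K B (?M2(t := ?v))"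
    using Bin.prems by (intro bounded_memory_upd[OF b2]) auto
  have e1: "aval e ?M1 = aval e M" "fits B e ?M1 = fits B e M"
    using Bin.prems(6) by (auto intro!: aval_cong fits_cong)
  have r1: "runs K B (compile d t) M (return_pmf ?M1)"
    using Bin.prems by (intro Bin.IH(1)) auto
  have r2: "runs K B (compile e (Suc t)) ?M1 (return_pmf ?M2)"
  proof -
    have "clear (bound_vars e) ?M1" using Bin.prems by (intro clear_upd) auto
    moreover have "clear {Suc t..} ?M1" using Bin.prems by (intro clear_upd_Suc) auto
    ultimately show ?thesis
      using Bin.IH(2)[OF _ _ b1, of "Suc t"] Bin.prems e1
      by (simp add: lessThan_SucI del: fun_upd_apply)
  qed
  have r3: "runs K B (Arith f t t (Suc t)) ?M2 (return_pmf (?M2(t := ?v)))"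
    using Bin.prems b2 by (intro runs_Arith) auto
  have r4: "runs K B (Const (Suc t) 0) (?M2(t := ?v)) (return_pmf (?M2(t := ?v, Suc t := 0)))"
    using Bin.prems b3 by (intro runs_Const) auto
  have eq: "?M2(t := ?v, Suc t := 0) = M(t := ?v)"
    using clearD[OF Bin.prems(5), of "Suc t"] by auto
  show ?case
    using r1 r2 r3 r4 unfolding eq compile.simps aval.simps by (blast intro: runs_Seq_det)
next
  case (Ite c d e)
  let ?M1 = "M(t := aval c M)"
  have le: "aval c M \<le> B" using Ite.prems(2) fits_le by auto
  have b1: "bounded_memory K B ?M1" using le Ite.prems by (intro bounded_memory_upd) auto
  have r1: "runs K B (compile c t) M (return_pmf ?M1)"
    using Ite.prems by (intro Ite.IH(1)) auto
  have r2: "runs K B (Cond t (Seq (Const t 0) (compile d t)) (compile e t)) ?M1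
     (return_pmf (M(t := aval (Ite c d e) M)))"
  proof (rule runs_Cond)
    assume nz: "?M1 t \<noteq> 0"
    have v: "aval (Ite c d e) M = aval d M" using nz by simp
    have M1: "?M1(t := 0) = M" using clearD[OF Ite.prems(5), of t] by auto
    have r: "runs K B (Const t 0) ?M1 (return_pmf (?M1(t := 0)))"
      using Ite.prems b1 by (intro runs_Const) auto
    show "runs K B (Seq (Const t 0) (compile d t)) ?M1
        (return_pmf (M(t := aval (Ite c d e) M)))"
      unfolding v using Ite.prems nz
      by (intro runs_Seq_det[OF r[unfolded M1]] Ite.IH(2)) auto
  next
    assume z: "?M1 t = 0"
    have v: "aval (Ite c d e) M = aval e M" using z by simp
    have M1: "?M1 = M" using z clearD[OF Ite.prems(5), of t] by auto
    show "runs K B (compile e t) ?M1 (return_pmf (M(t := aval (Ite c d e) M)))"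
      unfolding v M1 using Ite.prems z by (intro Ite.IH(3)) auto
  qed
  show ?case using r1 r2 unfolding compile.simps by (blast intro: runs_Seq_det)
next
  case (Rec i a l e b)
  define n where "n = aval l M"
  define h where "h = rec_nat (aval e M) (\<lambda>k v. aval b (M(i := k, a := v)))"
  have h0: "h 0 = aval e M" and hS: "\<And>k. h (Suc k) = aval b (M(i := k, a := h k))"
    by (simp_all add: h_def)
  have fb: "\<And>k. k < n \<Longrightarrow> fits B b (M(i := k, a := h k))"
    using Rec.prems(2) by (simp add: h_def n_def)
  have hB: "h k \<le> B" if "k \<le> n" for k
    using that fits_le[OF fb] Rec.prems(2) fits_le[of B e M] by (cases k) (auto simp: h0 hS)
  have nB: "n \<le> B" using Rec.prems(2) fits_le[of B l M] by (auto simp: n_def)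
  have ia: "i < t" "a < t" "i \<noteq> a" "M i = 0" "M a = 0" using Rec.prems by auto
  have K: "Suc (Suc t) < K" "t + depth l < K" "Suc t + depth e < K" "Suc t + depth b < K"
    using Rec.prems(8) by auto
  have t0: "M t = 0" "M (Suc t) = 0" "M (Suc (Suc t)) = 0"
    using clearD[OF Rec.prems(5)] by auto
  \<comment> \<open>Memory before pass \<open>k\<close>: cell \<open>t\<close> counts the remaining
    passes down while \<open>i\<close> counts up.\<close>
  define St where "St k = M(i := k, a := h k, t := n - k)" for k
  have bS: "bounded_memory K B (St k)" if "k \<le> n" for k
    unfolding St_def using that hB nB ia K Rec.prems(3)
    by (intro bounded_memory_upd) auto
  note bm = bounded_memory_upd
  have body: "runs K B (Seq (compile b (Suc t)) (Seq (Arith Add a (Suc t) (t + 2))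
        (Seq (Const (Suc t) 1) (Seq (Arith Add i i (Suc t)) (Seq (Arith Sub t t (Suc t))
          (Const (Suc t) 0)))))) (St k) (return_pmf (St (Suc k)))" if k: "k < n" for k
  proof -
    let ?M1 = "(St k)(Suc t := h (Suc k))"
    let ?M2 = "?M1(a := h (Suc k))"
    let ?M3 = "?M2(Suc t := 1)"
    let ?M4 = "?M3(i := Suc k)"
    let ?M5 = "?M4(t := n - Suc k)"
    have b0: "bounded_memory K B (St k)" using bS k by simp
    have b1: "bounded_memory K B ?M1" using hB[of "Suc k"] k K by (intro bm[OF b0]) auto
    have b2: "bounded_memory K B ?M2" using hB[of "Suc k"] k K ia by (intro bm[OF b1]) auto
    have b3: "bounded_memory K B ?M3" using K Rec.prems(9) by (intro bm[OF b2]) auto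
    have b4: "bounded_memory K B ?M4" using nB k K ia by (intro bm[OF b3]) auto
    have b5: "bounded_memory K B ?M5" using nB k K ia by (intro bm[OF b4]) auto
    have vb: "vars b \<subseteq> {..<t}" "bound_vars b \<subseteq> {..<t}" using Rec.prems by auto
    have av: "aval b (St k) = h (Suc k)" unfolding hS St_def using vb
      by (intro aval_cong) auto
    have fv: "fits B b (St k)"
    proof -
      have "fits B b (St k) = fits B b (M(i := k, a := h k))"
        unfolding St_def using vb by (intro fits_cong) auto
      then show ?thesis using fb k by simp
    qed
    have bv: "clear (bound_vars b) (St k)"
      unfolding St_def using Rec.prems vb by (intro clear_upd) auto
    have ct: "clear {Suc t..} (St k)"
      unfolding St_def using Rec.prems(5) ia by (auto simp: clear_def)
    have "runs K B (compile b (Suc t)) (St k) (return_pmf ((St k)(Suc t := aval b (St k))))"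
      using Rec.prems b0 fv bv ct vb K ia
      by (intro Rec.IH(3)) (simp_all add: lessThan_SucI)
    then have r1: "runs K B (compile b (Suc t)) (St k) (return_pmf ?M1)" by (simp add: av)
    have r2: "runs K B (Arith Add a (Suc t) (t + 2)) ?M1 (return_pmf ?M2)"
      using b1 ia K hB[of "Suc k"] k t0 by (intro runs_Arith) (auto simp: St_def)
    have r3: "runs K B (Const (Suc t) 1) ?M2 (return_pmf ?M3)"
      using b2 K Rec.prems(9) by (intro runs_Const) auto
    have r4: "runs K B (Arith Add i i (Suc t)) ?M3 (return_pmf ?M4)"
      using b3 ia K nB k by (intro runs_Arith) (auto simp: St_def)
    have r5: "runs K B (Arith Sub t t (Suc t)) ?M4 (return_pmf ?M5)"
      using b4 ia K nB k by (intro runs_Arith) (auto simp: St_def)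
    have r6: "runs K B (Const (Suc t) 0) ?M5 (return_pmf (?M5(Suc t := 0)))"
      using b5 K by (intro runs_Const) auto
    have eq: "?M5(Suc t := 0) = St (Suc k)"
      using ia t0 by (auto simp: St_def fun_eq_iff)
    show ?thesis using r1 r2 r3 r4 r5 r6 unfolding eq by (blast intro: runs_Seq_det)
  qed
  \<comment> \<open>The induction runs over the number \<open>m\<close> of remaining passes, hence
    the start in \<open>St (n - m)\<close>.\<close>
  have loop: "runs K B (While t (Seq (compile b (Suc t)) (Seq (Arith Add a (Suc t) (t + 2))
        (Seq (Const (Suc t) 1) (Seq (Arith Add i i (Suc t)) (Seq (Arith Sub t t (Suc t))
          (Const (Suc t) 0))))))) (St (n - m)) (return_pmf (St n))" if "m \<le> n" for m
    using that
  proof (induction m)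
    case 0
    have "St n t = 0" by (simp add: St_def)
    then show ?case unfolding diff_zero by (rule runs_While_0)
  next
    case (Suc m)
    have e: "Suc (n - Suc m) = n - m" using Suc.prems by simp
    have b: "n - Suc m < n" using Suc.prems by simp
    have nz: "St (n - Suc m) t \<noteq> 0" using ia Suc.prems by (simp add: St_def)
    have IH: "m \<le> n" using Suc.prems by simp
    show ?case
      by (rule runs_While_step[OF nz runs_Seq_det[OF body[OF b, unfolded e] Suc.IH[OF IH]]])
  qed
  let ?N1 = "M(t := n)" let ?N2 = "?N1(Suc t := h 0)"
  let ?N3 = "?N2(a := h 0)"
  have c1: "bounded_memory K B ?N1" using K nB Rec.prems(3) by (intro bm) auto
  have c2: "bounded_memory K B ?N2" using K hB[of 0] by (intro bm[OF c1]) auto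
  have c3: "bounded_memory K B ?N3" using K ia hB[of 0] by (intro bm[OF c2]) auto
  have q1: "runs K B (compile l t) M (return_pmf ?N1)"
    unfolding n_def using Rec.prems K by (intro Rec.IH(1)) auto
  have e1: "aval e ?N1 = aval e M" "fits B e ?N1 = fits B e M"
    using Rec.prems(6) by (auto intro!: aval_cong fits_cong)
  have "runs K B (compile e (Suc t)) ?N1 (return_pmf (?N1(Suc t := aval e ?N1)))"
  proof (rule Rec.IH(2))
    show "clear (bound_vars e) ?N1" using Rec.prems by (intro clear_upd) auto
    show "clear {Suc t..} ?N1" using Rec.prems by (intro clear_upd_Suc) auto
    show "wf_exp e" "vars e \<subseteq> {..<Suc t}" "bound_vars e \<subseteq> {..<Suc t}" "1 \<le> B"
      using Rec.prems by auto
    show "fits B e ?N1" using e1 Rec.prems by simp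
  qed (rule c1 K)+
  then have q2: "runs K B (compile e (Suc t)) ?N1 (return_pmf ?N2)" by (simp add: e1 h0)
  have q3: "runs K B (Arith Add a (Suc t) (t + 2)) ?N2 (return_pmf ?N3)"
    using c2 ia K hB[of 0] t0 by (intro runs_Arith) auto
  have q4: "runs K B (Const (Suc t) 0) ?N3 (return_pmf (?N3(Suc t := 0)))"
    using c3 K by (intro runs_Const) auto
  have eq1: "?N3(Suc t := 0) = St 0" using ia t0 by (auto simp: St_def fun_eq_iff)
  let ?O1 = "(St n)(t := h n)" let ?O2 = "?O1(a := 0)"
  have d1: "bounded_memory K B ?O1" using K hB[of n] bS[of n] by (intro bm) auto
  have d2: "bounded_memory K B ?O2" using K ia by (intro bm[OF d1]) auto
  have p1: "runs K B (Arith Add t a (Suc t)) (St n) (return_pmf ?O1)"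
    using bS[of n] ia K hB[of n] t0 by (intro runs_Arith) (auto simp: St_def)
  have p2: "runs K B (Const a 0) ?O1 (return_pmf ?O2)"
    using d1 ia K by (intro runs_Const) auto
  have p3: "runs K B (Const i 0) ?O2 (return_pmf (?O2(i := 0)))"
    using d2 ia K by (intro runs_Const) auto
  have eq2: "?O2(i := 0) = M(t := aval (Rec i a l e b) M)"
    using ia t0 by (auto simp: St_def fun_eq_iff h_def n_def)
  show ?case
    using q1 q2 q3 q4[unfolded eq1] loop[of n] p1 p2 p3[unfolded eq2]
    unfolding compile.simps diff_self_eq_0 by (blast intro: runs_Seq_det)
qed

section \<open>Evaluation rules for expressions\<close>

definition computes :: "nat \<Rightarrow> aexp \<Rightarrow> memory \<Rightarrow> nat \<Rightarrow> bool" where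
  "computes B e M v \<longleftrightarrow> aval e M = v \<and> fits B e M"

lemma computes_le: "computes B e M v \<Longrightarrow> v \<le> B"
  using fits_le by (auto simp: computes_def)

lemma computes_eq: "computes B e M v' \<Longrightarrow> v' = v \<Longrightarrow> computes B e M v"
  by simp

lemma computes_Num: "c \<le> B \<Longrightarrow> computes B (Num c) M c"
  by (simp add: computes_def)

lemma computes_Var: "M x = v \<Longrightarrow> v \<le> B \<Longrightarrow> computes B (Var x) M v"
  by (simp add: computes_def)

lemma computes_Add:
  "computes B d M u \<Longrightarrow> computes B e M v \<Longrightarrow> u + v \<le> B \<Longrightarrow> computes B (Bin Add d e) M (u + v)"
  by (simp add: computes_def)

lemma computes_Mult:
  "computes B d M u \<Longrightarrow> computes B e M v \<Longrightarrow> u * v \<le> B \<Longrightarrow> computes B (Bin Mult d e) M (u * v)"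
  by (simp add: computes_def)

lemma computes_Sub:
  "computes B d M u \<Longrightarrow> computes B e M v \<Longrightarrow> computes B (Bin Sub d e) M (u - v)"
  using computes_le[of B d M u] by (simp add: computes_def)

lemma computes_Div:
  "computes B d M u \<Longrightarrow> computes B e M v \<Longrightarrow> computes B (Bin Div d e) M (u div v)"
  using computes_le[of B d M u] by (auto simp: computes_def intro: le_trans[OF div_le_dividend])

lemma computes_Mod:
  "computes B d M u \<Longrightarrow> computes B e M v \<Longrightarrow> computes B (Bin Mod d e) M (u mod v)"
  using computes_le[of B d M u] by (auto simp: computes_def intro: le_trans[OF mod_less_eq_dividend])

lemma computes_Ite:
  "computes B c M u \<Longrightarrow> (u \<noteq> 0 \<Longrightarrow> computes B d M v) \<Longrightarrow> (u = 0 \<Longrightarrow> computes B e M w) \<Longrightarrow>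
    computes B (Ite c d e) M (if u \<noteq> 0 then v else w)"
  by (auto simp: computes_def)

text \<open>Truncated subtraction gives zero exactly if \<open>x\<close> is at most
  \<open>y\<close>, hence the exchanged branches.\<close>

definition IfLe :: "aexp \<Rightarrow> aexp \<Rightarrow> aexp \<Rightarrow> aexp \<Rightarrow> aexp" where
  "IfLe x y d e = Ite (Bin Sub x y) e d"

lemma computes_IfLe:
  assumes "computes B x M u" "computes B y M v" "u \<le> v \<Longrightarrow> computes B d M w" "v < u \<Longrightarrow> computes B e M z"
  shows "computes B (IfLe x y d e) M (if u \<le> v then w else z)"
  unfolding IfLe_def
  by (rule computes_eq[OF computes_Ite[OF computes_Sub[OF assms(1,2)], of e z d w]])
    (use assms in auto)

lemma computes_Rec:
  assumes "computes B l M n" "computes B e M (h 0)"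
    "\<And>k. k < n \<Longrightarrow> computes B b (M(i := k, a := h k)) (h (Suc k))"
  shows "computes B (Rec i a l e b) M (h n)"
proof -
  define H where "H = rec_nat (aval e M) (\<lambda>k v. aval b (M(i := k, a := v)))"
  have H: "H k = h k" if "k \<le> n" for k
    using that
  proof (induction k)
    case 0
    then show ?case using assms(2) by (simp add: H_def computes_def)
  next
    case (Suc k)
    then have "H (Suc k) = aval b (M(i := k, a := h k))" by (simp add: H_def)
    then show ?case using assms(3)[of k] Suc by (simp add: computes_def)
  qed
  have l: "aval l M = n" "fits B l M" "fits B e M" using assms(1,2) by (auto simp: computes_def)
  have "fits B b (M(i := k, a := H k))" if "k < n" for k
    using H[of k] assms(3)[OF that] that by (simp add: computes_def)
  then show ?thesis
    using H[of n] l unfolding computes_def by (simp add: H_def)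
qed

definition SumE :: "nat \<Rightarrow> nat \<Rightarrow> aexp \<Rightarrow> aexp \<Rightarrow> aexp" where
  "SumE i a l b = Rec i a l (Num 0) (Bin Add (Var a) b)"

lemma computes_SumE:
  fixes f :: "nat \<Rightarrow> nat"
  assumes "computes B l M n" "\<And>k s. k < n \<Longrightarrow> computes B b (M(i := k, a := s)) (f k)"
    and "(\<Sum>k<n. f k) \<le> B"
  shows "computes B (SumE i a l b) M (\<Sum>k<n. f k)"
  unfolding SumE_def
proof (rule computes_Rec[OF assms(1)])
  show "computes B (Num 0) M (\<Sum>k<0. f k)" by (simp add: computes_def)
  fix k assume k: "k < n"
  have le: "(\<Sum>j<Suc k. f j) \<le> (\<Sum>j<n. f j)" using k by (intro sum_mono2) auto
  show "computes B (Bin Add (Var a) b) (M(i := k, a := \<Sum>k<k. f k)) (\<Sum>k<Suc k. f k)"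
    unfolding sum.lessThan_Suc
    by (intro computes_Add computes_Var assms(2) k) (use le assms(3) in auto)
qed

definition PowE :: "nat \<Rightarrow> nat \<Rightarrow> aexp \<Rightarrow> aexp \<Rightarrow> aexp" where
  "PowE i a x e = Rec i a e (Num 1) (Bin Mult (Var a) x)"

lemma computes_PowE:
  assumes "computes B e M k" "\<And>j s. computes B x (M(i := j, a := s)) b" "b ^ k \<le> B" "1 \<le> B"
  shows "computes B (PowE i a x e) M (b ^ k)"
  unfolding PowE_def
proof (rule computes_Rec[OF assms(1)])
  show "computes B (Num 1) M (b ^ 0)" using assms(4) by (simp add: computes_def)
  fix j assume j: "j < k"
  have le: "b ^ i \<le> B" if "i \<le> k" for i
  proof (cases "b = 0")
    case True
    then show ?thesis using assms(4) by (cases i) auto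
  next
    case False
    then have "b ^ i \<le> b ^ k" using that by (intro power_increasing) auto
    then show ?thesis using assms(3) by simp
  qed
  have "computes B (Bin Mult (Var a) x) (M(i := j, a := b ^ j)) (b ^ j * b)"
    by (intro computes_Mult computes_Var assms(2)) (use le[of j] le[of "Suc j"] j in \<open>auto simp: mult.commute\<close>)
  then show "computes B (Bin Mult (Var a) x) (M(i := j, a := b ^ j)) (b ^ Suc j)"
    by (simp add: mult.commute)
qed

text \<open>The accumulator advances until \<open>stop\<close> holds and then stays, so after at
  least \<open>k0\<close> rounds it is the least stopping point. The body is evaluated only at
  candidates up to \<open>k0\<close>, which bounds its intermediate values.\<close>

lemma computes_search:
  assumes "computes B l M n" "stop k0" "\<And>k. k < k0 \<Longrightarrow> \<not> stop k" "k0 \<le> n"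
    and "\<And>j k. k \<le> k0 \<Longrightarrow> computes B b (M(i := j, a := k)) (if stop k then k else Suc k)"
  shows "computes B (Rec i a l (Num 0) b) M k0"
proof -
  have "computes B (Rec i a l (Num 0) b) M (min n k0)"
  proof (rule computes_Rec[where h = "\<lambda>j. min j k0", OF assms(1)])
    show "computes B (Num 0) M (min 0 k0)" by (simp add: computes_def)
    fix k
    have "computes B b (M(i := k, a := min k k0)) (if stop (min k k0) then min k k0 else Suc (min k k0))"
      by (rule assms(5)) simp
    moreover have "(if stop (min k k0) then min k k0 else Suc (min k k0)) = min (Suc k) k0"
      using assms(2) assms(3)[of k] by (auto simp: min_def not_less_eq_eq)
    ultimately show "computes B b (M(i := k, a := min k k0)) (min (Suc k) k0)" by simp
  qed
  then show ?thesis using assms(4) by simp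
qed

primrec TableE :: "nat \<Rightarrow> (nat \<Rightarrow> nat) \<Rightarrow> nat \<Rightarrow> aexp" where
  "TableE x f 0 = Num (f 0)"
| "TableE x f (Suc k) = Ite (Bin Sub (Var x) (Num k)) (Num (f (Suc k))) (TableE x f k)"

lemma computes_TableE:
  assumes "M x \<le> k" "k \<le> B" "\<And>j. j \<le> k \<Longrightarrow> f j \<le> B"
  shows "computes B (TableE x f k) M (f (M x))"
  using assms
proof (induction k)
  case 0
  then show ?case by (simp add: computes_def)
next
  case (Suc k)
  have "computes B (TableE x f (Suc k)) M (if M x - k \<noteq> 0 then f (Suc k) else f (M x))"
    unfolding TableE.simps
    by (rule computes_Ite[OF computes_Sub[OF computes_Var computes_Num]]) (use Suc in \<open>auto intro: computes_Num\<close>)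
  then show ?case using Suc.prems(1) by (auto split: if_splits simp: le_Suc_eq)
qed

text \<open>Program variables are the cells below 30, bound variables those below 40.\<close>

definition static :: "aexp \<Rightarrow> bool" where
  "static e \<longleftrightarrow> wf_exp e \<and> vars e \<subseteq> {..<40} \<and> bound_vars e \<subseteq> {30..<40} \<and> depth e < 40"

lemma static_TableE:
  shows "wf_exp (TableE x f k)" "vars (TableE x f k) \<subseteq> {x}" "bound_vars (TableE x f k) = {}"
    "depth (TableE x f k) \<le> 1"
  by (induction k) auto

definition ready :: "nat \<Rightarrow> memory \<Rightarrow> bool" where
  "ready B M \<longleftrightarrow> bounded_memory 80 B M \<and> clear {30..} M \<and> 1 \<le> B"

lemma ready_upd: "ready B M \<Longrightarrow> x < 30 \<Longrightarrow> v \<le> B \<Longrightarrow> ready B (M(x := v))"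
  by (auto simp: ready_def bounded_memory_upd clear_upd)

abbreviation run :: "nat \<Rightarrow> program \<Rightarrow> memory \<Rightarrow> memory pmf \<Rightarrow> bool" where
  "run \<equiv> runs 80"

definition asg :: "nat \<Rightarrow> aexp \<Rightarrow> program" where
  "asg x e = Seq (compile e 40) (Seq (Arith Add x 40 41) (Const 40 0))"

lemma run_asg:
  assumes "static e" "computes B e M v" "ready B M" "x < 30"
  shows "run B (asg x e) M (return_pmf (M(x := v)))"
proof -
  have v: "v \<le> B" "aval e M = v" "fits B e M" using assms(2) computes_le by (auto simp: computes_def)
  have M: "bounded_memory 80 B M" "clear {30..} M" "1 \<le> B" using assms(3) by (auto simp: ready_def)
  have M0: "M 40 = 0" "M 41 = 0" using clearD[OF M(2)] by auto
  have "bound_vars e \<subseteq> {30..}" "bound_vars e \<subseteq> {..<40}" using assms(1) by (auto simp: static_def)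
  then have "clear (bound_vars e) M" "clear {40..} M" "bound_vars e \<subseteq> {..<40}"
    using M(2) by (auto simp: clear_def)
  then have 1: "run B (compile e 40) M (return_pmf (M(40 := v)))"
    using runs_compile[of e B M 80 40] assms(1) v M by (simp add: static_def)
  have b1: "bounded_memory 80 B (M(40 := v))" using M v by (intro bounded_memory_upd) auto
  have b2: "bounded_memory 80 B (M(40 := v, x := v))" using v assms(4) by (intro bounded_memory_upd[OF b1]) auto
  have 2: "run B (Arith Add x 40 41) (M(40 := v)) (return_pmf (M(40 := v, x := v)))"
    using b1 v assms(4) M0 by (intro runs_Arith) auto
  have 3: "run B (Const 40 0) (M(40 := v, x := v)) (return_pmf (M(40 := v, x := v, 40 := 0)))"
    using b2 by (intro runs_Const) auto
  have "M(40 := v, x := v, 40 := 0) = M(x := v)" using assms(4) M0 by auto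
  then show ?thesis
    unfolding asg_def using runs_Seq_det[OF 1 runs_Seq_det[OF 2 3]] by simp
qed

lemma runs_unique:
  assumes "runs K B p M D" "runs K B p M D'"
  shows "D = D'"
proof -
  obtain s :: config where s: "mem s = M" by (metis config.select_convs(1))
  obtain G G' where "exec p s = spmf_of_pmf G" "map_pmf mem G = D"
    "exec p s = spmf_of_pmf G'" "map_pmf mem G' = D'"
    using assms s unfolding runs_def by metis
  then show ?thesis by (metis pmf_eqI spmf_spmf_of_pmf)
qed

text \<open>The distribution of memories is presented as the image of a distribution of abstract
  states. As \<open>g\<close> need not be injective, \<open>F\<close> is transported to memories by
  uniqueness of the resulting distribution.\<close>

lemma runs_Seq_map:
  assumes p: "runs K B p M (map_pmf g D)" and q: "\<And>x. x \<in> set_pmf D \<Longrightarrow> runs K B q (g x) (F x)"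
  shows "runs K B (Seq p q) M (bind_pmf D F)"
proof -
  define F' where "F' M' = (SOME D'. runs K B q M' D')" for M'
  have F': "F' (g x) = F x" if "x \<in> set_pmf D" for x
    unfolding F'_def using q[OF that] runs_unique by (metis someI)
  have "runs K B (Seq p q) M (bind_pmf (map_pmf g D) F')"
    using p q F' by (intro runs_Seq) auto
  moreover have "bind_pmf (map_pmf g D) F' = bind_pmf D F"
    unfolding bind_map_pmf by (intro bind_pmf_cong refl F')
  ultimately show ?thesis by simp
qed

section \<open>Loops driven by a counter and by coin flips\<close>

primrec iter_pmf :: "(nat \<Rightarrow> 'a \<Rightarrow> 'a pmf) \<Rightarrow> nat \<Rightarrow> 'a \<Rightarrow> 'a pmf" where
  "iter_pmf D 0 \<sigma> = return_pmf \<sigma>"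
| "iter_pmf D (Suc k) \<sigma> = bind_pmf (D k \<sigma>) (iter_pmf D k)"

text \<open>\<open>mm \<sigma> k\<close> is the memory that represents the abstract state
  \<open>\<sigma>\<close> with \<open>k\<close> rounds left, and \<open>I\<close> is an invariant
  along the reachable states.\<close>

lemma runs_counter_loop:
  assumes body: "\<And>k \<sigma>. I (Suc k) \<sigma> \<Longrightarrow> runs K B body (mm \<sigma> (Suc k)) (map_pmf (\<lambda>\<sigma>'. mm \<sigma>' k) (D k \<sigma>))"
    and inv: "\<And>k \<sigma> \<sigma>'. I (Suc k) \<sigma> \<Longrightarrow> \<sigma>' \<in> set_pmf (D k \<sigma>) \<Longrightarrow> I k \<sigma>'"
    and counter: "\<And>k \<sigma>. mm \<sigma> k c = k"
  shows "I k \<sigma> \<Longrightarrow> runs K B (While c body) (mm \<sigma> k) (map_pmf (\<lambda>\<sigma>'. mm \<sigma>' 0) (iter_pmf D k \<sigma>))"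
proof (induction k arbitrary: \<sigma>)
  case 0
  then show ?case using runs_While_0[of "mm \<sigma> 0" c] counter by simp
next
  case (Suc k)
  have "runs K B (Seq body (While c body)) (mm \<sigma> (Suc k))
      (bind_pmf (D k \<sigma>) (\<lambda>\<sigma>'. map_pmf (\<lambda>\<sigma>'. mm \<sigma>' 0) (iter_pmf D k \<sigma>')))"
    by (rule runs_Seq_map[OF body[OF Suc.prems] Suc.IH[OF inv[OF Suc.prems]]])
  then show ?case
    using counter by (intro runs_While_step) (simp_all add: map_bind_pmf)
qed

lemma bind_coin: "pmf (bind_pmf (pmf_of_set (UNIV :: bool set)) f) x = (pmf (f True) x + pmf (f False) x) / 2"
  by (simp add: pmf_bind_pmf_of_set UNIV_bool)

lemma iter_and_coins:
  "iter_pmf (\<lambda>_ b. map_pmf (\<lambda>c. b \<and> c) (pmf_of_set UNIV)) k True = bernoulli_pmf (1 / 2 ^ k)"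
proof -
  let ?D = "\<lambda>(_::nat) b. map_pmf (\<lambda>c. b \<and> c) (pmf_of_set (UNIV :: bool set))"
  have F: "iter_pmf ?D k False = return_pmf False" for k
    by (induction k) (simp_all add: bind_map_pmf)
  show ?thesis
  proof (induction k)
    case 0
    show ?case by (rule pmf_eqI, case_tac i) simp_all
  next
    case (Suc k)
    have "iter_pmf ?D (Suc k) True = bind_pmf (pmf_of_set UNIV) (\<lambda>c. iter_pmf ?D k c)"
      by (simp add: bind_map_pmf)
    moreover have "(1::real) / 2 ^ k \<le> 1" by simp
    moreover have "(1::real) / (2 * 2 ^ k) \<le> 1" by (simp add: field_simps order_trans[of 1 "2 * 1"])
    ultimately show ?case
      by (intro pmf_eqI) (case_tac i; simp add: bind_coin Suc F field_simps)
  qed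
qed

lemma iter_double_coins:
  "iter_pmf (\<lambda>_ r. map_pmf (\<lambda>b. 2 * r + of_bool b) (pmf_of_set UNIV)) k (0::nat) = pmf_of_set {..<2 ^ k}"
proof -
  let ?D = "\<lambda>(_::nat) (r::nat). map_pmf (\<lambda>b. 2 * r + of_bool b) (pmf_of_set (UNIV :: bool set))"
  \<comment> \<open>Generalized to a start value \<open>r\<close>: after \<open>k\<close> more bits
    the number is uniform on the \<open>2 ^ k\<close> numbers with leading part
    \<open>r\<close>.\<close>
  have "pmf (iter_pmf ?D k r) x = (if r * 2 ^ k \<le> x \<and> x < Suc r * 2 ^ k then 1 / 2 ^ k else 0)" for r x
  proof (induction k arbitrary: r)
    case 0
    show ?case by (auto simp: indicator_def)
  next
    case (Suc k)
    have "iter_pmf ?D (Suc k) r = bind_pmf (pmf_of_set UNIV) (\<lambda>b. iter_pmf ?D k (2 * r + of_bool b))"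
      by (simp add: bind_map_pmf)
    then have "pmf (iter_pmf ?D (Suc k) r) x =
        (pmf (iter_pmf ?D k (2 * r + 1)) x + pmf (iter_pmf ?D k (2 * r)) x) / 2"
      by (simp add: bind_coin)
    also have "\<dots> = (if r * 2 ^ Suc k \<le> x \<and> x < Suc r * 2 ^ Suc k then 1 / 2 ^ Suc k else 0)"
      unfolding Suc by (auto simp: algebra_simps)
    finally show ?case .
  qed
  moreover have "pmf (pmf_of_set {..<(2::nat) ^ k}) x = indicator {..<2 ^ k} x / 2 ^ k" for x
    by (subst pmf_of_set) (auto simp: lessThan_empty_iff)
  ultimately show ?thesis
    by (intro pmf_eqI) (simp add: indicator_def)
qed

section \<open>The sketching algorithm\<close>

text \<open>
  The cells 0 to 3 hold the current stream item. The others hold: 4 \<open>n\<close>; 5 the size \<open>L\<close> up to which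
  components are counted; 6 the number \<open>T\<close> of thresholds; 7 \<open>a\<close>, where vertices are sampled with
  probability \<open>1 / 2 ^ a\<close>; 8 the prime \<open>P\<close>; 9 the random point \<open>r\<close>; 10 the sampled vertices as digits
  to the base \<open>n + 1\<close>; 11 their number; 12 the fingerprints as digits to the base \<open>P\<close>, that of the
  \<open>i\<close>-th vertex for the threshold \<open>j\<close> at position \<open>i * T + j\<close>; 13 the numerator of the answer, whose
  denominator is 2; 14 the sum \<open>G\<close> of the gaps between the thresholds; 15 the maximal number of
  sampled vertices; 16 and 17 bounds that determine \<open>P\<close>; 18 to 25 intermediate results. The cells 30
  to 39 are bound variables, and from 40 on is the scratch space of compiled expressions.
\<close>

definition IfEq :: "aexp \<Rightarrow> aexp \<Rightarrow> aexp \<Rightarrow> aexp \<Rightarrow> aexp" where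
  "IfEq x y d e = Ite (Bin Add (Bin Sub x y) (Bin Sub y x)) e d"

lemma computes_IfEq:
  assumes "computes B x M u" "computes B y M v" "u = v \<Longrightarrow> computes B d M w" "u \<noteq> v \<Longrightarrow> computes B e M z"
  shows "computes B (IfEq x y d e) M (if u = v then w else z)"
proof -
  have "(u - v) + (v - u) \<le> B" using computes_le[OF assms(1)] computes_le[OF assms(2)] by auto
  then have "computes B (IfEq x y d e) M (if (u - v) + (v - u) \<noteq> 0 then z else w)"
    unfolding IfEq_def
    by (intro computes_Ite computes_Add computes_Sub assms(1,2)) (use assms in auto)
  then show ?thesis by (rule computes_eq) auto
qed

definition bitE :: "nat \<Rightarrow> nat \<Rightarrow> aexp" where
  "bitE c i = Bin Mod (Bin Div (Var c) (PowE 38 39 (Num 2) (Var i))) (Num 2)"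

definition digE :: "nat \<Rightarrow> aexp \<Rightarrow> aexp \<Rightarrow> aexp" where
  "digE x b k = Bin Mod (Bin Div (Var x) (PowE 38 39 b k)) b"

definition popE :: "nat \<Rightarrow> aexp" where
  "popE c = SumE 36 37 (Var 11) (bitE c 36)"

definition msumE :: "nat \<Rightarrow> nat \<Rightarrow> aexp" where
  "msumE c j = Bin Mod (SumE 36 37 (Var 11)
     (Bin Mult (bitE c 36) (digE 12 (Var 8) (Bin Add (Bin Mult (Var 36) (Var 6)) (Var j))))) (Var 8)"

definition excessE :: "nat \<Rightarrow> nat \<Rightarrow> aexp" where
  "excessE c' c = SumE 36 37 (Var 11) (Ite (Bin Sub (bitE c' 36) (bitE c 36)) (Num 1) (Num 0))"

definition zsubE :: "nat \<Rightarrow> nat \<Rightarrow> aexp" where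
  "zsubE c j = SumE 34 35 (Var c)
     (Ite (Var 34) (Ite (excessE 34 c) (Num 0) (Ite (msumE 34 j) (Num 0) (Num 1))) (Num 0))"

definition atomE :: "nat \<Rightarrow> aexp" where
  "atomE j = SumE 32 33 (PowE 38 39 (Num 2) (Var 11))
     (Ite (Var 32) (Ite (Bin Sub (popE 32) (Var 5)) (Num 0) (Ite (msumE 32 j) (Num 0)
       (Ite (zsubE 32 j) (Num 0) (PowE 38 39 (Num 2) (Bin Mult (Var 7) (popE 32)))))) (Num 0))"

text \<open>The amount added to the digit at position \<open>Var 30\<close>, whose remainder and
  quotient by \<open>T\<close> are the threshold and the index of the sampled vertex. A subtraction
  becomes the addition of the complement to \<open>P\<close>, so that all digits remain natural
  numbers.\<close>

definition deltaE :: aexp where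
  "deltaE = IfLe (Var 25) (Bin Mod (Var 30) (Var 6))
     (IfEq (digE 10 (Bin Add (Var 4) (Num 1)) (Bin Div (Var 30) (Var 6))) (Var 22) (Var 24)
       (IfEq (digE 10 (Bin Add (Var 4) (Num 1)) (Bin Div (Var 30) (Var 6))) (Var 23)
         (Bin Sub (Var 8) (Var 24)) (Num 0)))
     (Num 0)"

definition updateE :: aexp where
  "updateE = SumE 30 31 (Bin Mult (Var 11) (Var 6))
     (Bin Mult (Bin Mod (Bin Add (digE 12 (Var 8) (Var 30)) deltaE) (Var 8)) (PowE 38 39 (Var 8) (Var 30)))"

definition loE :: aexp where
  "loE = IfLe (Var 1) (Var 2) (Var 1) (Var 2)"

definition hiE :: aexp where
  "hiE = IfLe (Var 1) (Var 2) (Var 2) (Var 1)"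

text \<open>Plain repeated multiplication, as often as the edge index says, is affordable because
  the time per stream item is not bounded. Reducing in each round keeps all products below
  \<open>P ^ 2\<close>.\<close>

definition powerE :: aexp where
  "powerE = Rec 30 31 (Bin Add (Bin Mult loE (Bin Add (Var 4) (Num 1))) hiE) (Num 1)
     (Bin Mod (Bin Mult (Var 31) (Var 9)) (Var 8))"

text \<open>
  \<open>LA\<close> and \<open>CA\<close> are the parameters used if \<open>2 ^ W \<le> n\<close>, and \<open>LB\<close>, \<open>TB\<close>, \<open>GB\<close>, \<open>clB\<close>, \<open>gapB\<close> those for
  \<open>n < 2 ^ W\<close>. Since \<open>W\<close> is fixed, the functions \<open>clB\<close> and \<open>gapB\<close> are tables in the program text.
\<close>

locale sketch =
  fixes W LA LB TB GB CA :: nat and clB gapB :: "nat \<Rightarrow> nat"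
begin

definition largeE :: "aexp \<Rightarrow> aexp \<Rightarrow> aexp" where
  "largeE d e = IfLe (Num (2 ^ W)) (Var 4) d e"

definition classE :: aexp where
  "classE = largeE (Bin Sub (Var 3) (Num 1)) (TableE 3 clB W)"

definition gapE :: aexp where
  "gapE = largeE (Num 1) (TableE 30 gapB TB)"

definition totalE :: aexp where
  "totalE = SumE 30 31 (Var 6) (Bin Mult gapE (atomE 30))"

text \<open>Twice the estimate, which clears the halves. Each gap is multiplied by the estimated
  number of small components, plus half of \<open>n div (L + 1)\<close> for the large ones, minus 1;
  as the gaps sum to \<open>G\<close>, the last two corrections are multiples of \<open>G\<close>.
  The subtraction comes last, so that truncation merely clips a negative estimate at 0.\<close>

definition numerE :: aexp where
  "numerE = Bin Sub (Bin Add (Bin Add (Bin Mult (Num 2) (Bin Sub (Var 4) (Num 1))) (Bin Mult (Num 2) totalE))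
     (Bin Mult (Var 14) (Bin Div (Var 4) (Bin Add (Var 5) (Num 1))))) (Bin Mult (Num 2) (Var 14))"

text \<open>Cells 22 and 23 receive the end points whose fingerprints gain and lose the power. A
  deletion swaps them, which negates the contribution of the edge.\<close>

definition step_program :: program where
  "step_program = Seq (asg 22 (Ite (Var 0) loE hiE)) (Seq (asg 23 (Ite (Var 0) hiE loE))
     (Seq (asg 24 powerE) (Seq (asg 25 classE) (Seq (asg 12 updateE) (asg 13 numerE)))))"

lemmas macro_defs = IfLe_def IfEq_def SumE_def PowE_def bitE_def digE_def popE_def msumE_def
  excessE_def zsubE_def atomE_def deltaE_def updateE_def loE_def hiE_def powerE_def
  largeE_def classE_def gapE_def totalE_def numerE_def

lemma static_step:
  "static (Ite (Var 0) loE hiE)" "static (Ite (Var 0) hiE loE)" "static powerE" "static classE"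
  "static updateE" "static numerE"
  using static_TableE(1-3)[of 3 clB W] static_TableE(4)[of 3 clB W]
    static_TableE(1-3)[of 30 gapB TB] static_TableE(4)[of 30 gapB TB]
  by (auto simp: static_def macro_defs)

end

section \<open>Values and magnitudes in the update step\<close>

locale sketch_run = sketch +
  fixes n L T G a P N cap X :: nat
  assumes n2: "2 \<le> n" and T1: "1 \<le> T"
    and L_eq: "L = (if 2 ^ W \<le> n then LA else min n LB)"
    and T_eq: "T = (if 2 ^ W \<le> n then W - 1 else TB)"
    and G_eq: "G = (if 2 ^ W \<le> n then W - 1 else GB)"
    and P_prime: "prime P" and P_ge: "2 ^ N \<le> P"
    and cap1: "1 \<le> cap"
    and X_W: "2 ^ W \<le> X" and X_n: "(n + 1) ^ 2 \<le> X" and X_L: "L + 2 \<le> X" and X_T: "T \<le> X"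
    and X_G: "G \<le> X" and X_LB: "n < 2 ^ W \<Longrightarrow> LB \<le> X" and X_cl: "\<And>w. n < 2 ^ W \<Longrightarrow> w \<le> W \<Longrightarrow> clB w \<le> X"
    and X_gap: "\<And>j. n < 2 ^ W \<Longrightarrow> j \<le> TB \<Longrightarrow> gapB j \<le> X"
    and X_a: "a \<le> X" "2 ^ (a * L) \<le> X"
    and X_cap: "cap \<le> X" "2 ^ cap \<le> X" "(n + 1) ^ cap \<le> X" "P ^ (cap * T) \<le> X"
begin

definition cls :: "nat \<Rightarrow> nat" where
  "cls w = (if 2 ^ W \<le> n then w - 1 else clB w)"

definition gap :: "nat \<Rightarrow> nat" where
  "gap j = (if 2 ^ W \<le> n then 1 else gapB j)"

text \<open>Every intermediate value is bounded by a product of a few quantities that are at most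
  \<open>X\<close>. Passing to a fixed power costs only a constant factor in bits.\<close>

definition B :: nat where "B = X ^ 8"

lemma X_ge: "9 \<le> X"
proof -
  have "3 ^ 2 \<le> (n + 1) ^ 2" using n2 by (intro power_mono) auto
  then show ?thesis using X_n by simp
qed

lemma le_B: "x \<le> X ^ k \<Longrightarrow> k \<le> 8 \<Longrightarrow> x \<le> B"
  unfolding B_def using power_increasing[of k 8 X] X_ge by linarith

lemma le_B1: "x \<le> X \<Longrightarrow> x \<le> B"
  using le_B[of x 1] by simp

lemma le_B2: "x \<le> X \<Longrightarrow> y \<le> X \<Longrightarrow> x * y \<le> B"
  using le_B[of "x * y" 2] by (simp add: power2_eq_square mult_le_mono)

lemma one_le_B: "1 \<le> B" "2 \<le> B" "Suc 0 \<le> B"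
  using le_B1[of 1] le_B1[of 2] X_ge by auto

lemma n_X: "n + 1 \<le> X"
  using X_n n2 by (simp add: power2_eq_square)

lemma P2: "2 \<le> P" using P_prime prime_ge_2_nat by blast

lemma P_X: "P \<le> X"
proof -
  have "P ^ 1 \<le> P ^ (cap * T)" using cap1 T1 P2 by (intro power_increasing) auto
  then show ?thesis using X_cap by simp
qed

end

locale sketch_table = sketch_run +
  fixes m r S F :: nat
  assumes m: "m \<le> cap" and r: "r < P" and S: "S \<le> X" and F: "F < P ^ (m * T)"
begin

definition params :: "memory \<Rightarrow> bool" where
  "params M \<longleftrightarrow> M 4 = n \<and> M 5 = L \<and> M 6 = T \<and> M 7 = a \<and> M 8 = P \<and> M 9 = r \<and> M 10 = S \<and> M 11 = m \<and>
     M 12 = F \<and> M 14 = G"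

lemma params_upd: "30 \<le> x \<Longrightarrow> params (M(x := v)) \<longleftrightarrow> params M"
  by (auto simp: params_def)

lemma paramsD:
  assumes "params M"
  shows "M 4 = n" "M 5 = L" "M 6 = T" "M 7 = a" "M 8 = P" "M 9 = r" "M 10 = S" "M 11 = m" "M 12 = F" "M 14 = G"
  using assms by (auto simp: params_def)

lemma m_X: "m \<le> X" "2 ^ m \<le> X" "(n + 1) ^ m \<le> X" "P ^ (m * T) \<le> X" "F \<le> X"
proof -
  show "m \<le> X" using m X_cap by simp
  have "(2::nat) ^ m \<le> 2 ^ cap" using m by simp
  then show "2 ^ m \<le> X" using X_cap by linarith
  have "(n + 1) ^ m \<le> (n + 1) ^ cap" using m by (intro power_increasing) auto
  then show "(n + 1) ^ m \<le> X" using X_cap by linarith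
  have "P ^ (m * T) \<le> P ^ (cap * T)" using m P2 by (intro power_increasing) auto
  then show "P ^ (m * T) \<le> X" using X_cap by linarith
  then show "F \<le> X" using F by simp
qed

lemma pow_P_le: "k \<le> m * T \<Longrightarrow> P ^ k \<le> B"
  using power_increasing[of k "m * T" P] P2 m_X by (intro le_B1) linarith

lemma pow_n_le: "k \<le> m \<Longrightarrow> Suc n ^ k \<le> B"
  using power_increasing[of k m "n + 1"] m_X by (intro le_B1) simp

lemma pow_2_le: "k \<le> m \<Longrightarrow> 2 ^ k \<le> B"
  using power_increasing[of k m "2::nat"] m_X by (intro le_B1) linarith

lemmas bnds = le_B1[OF P_X] le_B1[OF m_X(1)] le_B1[OF m_X(2)] le_B1[OF m_X(5)] le_B1[OF X_T] one_le_B
  le_B1[OF S]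

lemma computes_bitE:
  assumes "M c \<le> B" "M i < m" "c < 38" "i < 38"
  shows "computes B (bitE c i) M (bitn (M c) (M i))"
  unfolding bitE_def bitn_def
  by (intro computes_Mod computes_Div computes_Var computes_PowE computes_Num)
    (use assms bnds(2) pow_2_le[of "M i"] in \<open>auto simp: one_le_B\<close>)

lemma index_less: "i < m \<Longrightarrow> j < T \<Longrightarrow> i * T + j < m * T"
proof -
  assume "i < m" "j < T"
  then have "i * T + j < Suc i * T" by simp
  also have "\<dots> \<le> m * T" using \<open>i < m\<close> by (intro mult_le_mono1) simp
  finally show ?thesis .
qed

lemma index_B: "k \<le> m * T \<Longrightarrow> k \<le> B"
  using le_B2[OF m_X(1) X_T] by simp

lemma computes_digit_F:
  assumes "params M" "computes B e M k" "k < m * T"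
  shows "computes B (digE 12 (Var 8) e) M (digit P F k)"
  unfolding digE_def digit_def
  by (intro computes_Mod computes_Div computes_Var computes_PowE assms(2))
    (use assms bnds pow_P_le[of k] in \<open>auto simp: paramsD\<close>)

lemma computes_popE:
  assumes "params M" "M c \<le> B" "c < 36"
  shows "computes B (popE c) M (popcount m (M c))"
  unfolding popE_def popcount_def
proof (rule computes_SumE)
  show "computes B (Var 11) M m" using assms bnds by (intro computes_Var) (auto simp: paramsD)
  fix k s assume k: "k < m"
  show "computes B (bitE c 36) (M(36 := k, 37 := s)) (bitn (M c) k)"
    using computes_bitE[of "M(36 := k, 37 := s)" c 36] assms k by simp
next
  have "(\<Sum>k<m. bitn (M c) k) \<le> (\<Sum>k<m. 1)" by (intro sum_mono) (simp add: bitn_def)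
  then show "(\<Sum>k<m. bitn (M c) k) \<le> B" using bnds(2) by simp
qed

lemma digit_less: "digit P F k < P"
  using P2 by (simp add: digit_def)

lemma computes_msumE:
  assumes "params M" "M c \<le> B" "c < 36" "j < 36" "M j < T"
  shows "computes B (msumE c j) M (mask_sum P (\<lambda>i. digit P F (i * T + M j)) m (M c))"
  unfolding msumE_def mask_sum_def
proof (intro computes_Mod computes_SumE)
  show "computes B (Var 11) M m" using assms bnds by (intro computes_Var) (auto simp: paramsD)
  show "computes B (Var 8) M P" using assms bnds by (intro computes_Var) (auto simp: paramsD)
  have le: "bitn (M c) k * digit P F (k * T + M j) \<le> P" for k
  proof -
    have "bitn (M c) k \<le> 1" by (simp add: bitn_def)
    then have "bitn (M c) k * digit P F (k * T + M j) \<le> 1 * P"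
      using digit_less[of "k * T + M j"] by (intro mult_le_mono) auto
    then show ?thesis by simp
  qed
  have "(\<Sum>k<m. bitn (M c) k * digit P F (k * T + M j)) \<le> m * P"
    using sum_mono[of "{..<m}" "\<lambda>k. bitn (M c) k * digit P F (k * T + M j)" "\<lambda>_. P"] le by simp
  then show "(\<Sum>k<m. bitn (M c) k * digit P F (k * T + M j)) \<le> B"
    using le_B2[OF m_X(1) P_X] by simp
  fix k s assume k: "k < m"
  let ?M = "M(36 := k, 37 := s)"
  have pM: "params ?M" using assms(1) by (simp add: params_upd)
  have 1: "computes B (bitE c 36) ?M (bitn (M c) k)"
    using computes_bitE[of ?M c 36] assms k by simp
  have ix: "k * T + M j < m * T" using index_less k assms(5) by simp
  have kT: "k * T \<le> B" "k * T + M j \<le> B" using ix index_B[of "k * T"] index_B[of "k * T + M j"] by linarith+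
  have "computes B (Bin Add (Bin Mult (Var 36) (Var 6)) (Var j)) ?M (k * T + M j)"
    using kT assms k bnds
    by (intro computes_Add computes_Mult computes_Var) (auto simp: paramsD)
  then have 2: "computes B (digE 12 (Var 8) (Bin Add (Bin Mult (Var 36) (Var 6)) (Var j))) ?M (digit P F (k * T + M j))"
    by (intro computes_digit_F pM ix)
  show "computes B (Bin Mult (bitE c 36) (digE 12 (Var 8) (Bin Add (Bin Mult (Var 36) (Var 6)) (Var j)))) ?M
      (bitn (M c) k * digit P F (k * T + M j))"
    using computes_Mult[OF 1 2] le[of k] bnds(1) by simp
qed

lemma computes_excessE:
  assumes "params M" "M c \<le> B" "M c' \<le> B" "c < 36" "c' < 36"
  shows "computes B (excessE c' c) M (mask_excess m (M c') (M c))"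
  unfolding excessE_def mask_excess_def
proof (rule computes_SumE)
  show "computes B (Var 11) M m" using assms bnds by (intro computes_Var) (auto simp: paramsD)
  fix k s assume k: "k < m"
  let ?M = "M(36 := k, 37 := s)"
  have 1: "computes B (bitE c 36) ?M (bitn (M c) k)" "computes B (bitE c' 36) ?M (bitn (M c') k)"
    using computes_bitE[of ?M c 36] computes_bitE[of ?M c' 36] assms k by simp_all
  show "computes B (Ite (Bin Sub (bitE c' 36) (bitE c 36)) (Num 1) (Num 0)) ?M
      (if bitn (M c') k - bitn (M c) k \<noteq> 0 then 1 else 0)"
    by (intro computes_Ite computes_Sub 1 computes_Num) (auto simp: one_le_B)
next
  have "(\<Sum>k<m. if bitn (M c') k - bitn (M c) k \<noteq> 0 then 1 else 0) \<le> (\<Sum>k<m. 1::nat)" by (intro sum_mono) auto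
  then show "(\<Sum>k<m. if bitn (M c') k - bitn (M c) k \<noteq> 0 then 1 else 0) \<le> B" using bnds(2) by simp
qed

lemma computes_zsubE:
  assumes "params M" "M c \<le> B" "c < 34" "j < 34" "M j < T"
  shows "computes B (zsubE c j) M (zero_submasks P (\<lambda>i. digit P F (i * T + M j)) m (M c))"
  unfolding zsubE_def zero_submasks_def
proof (rule computes_SumE)
  show "computes B (Var c) M (M c)" using assms by (intro computes_Var) auto
  fix k s assume k: "k < M c"
  let ?M = "M(34 := k, 35 := s)"
  have pM: "params ?M" using assms(1) by (simp add: params_upd)
  have 1: "computes B (excessE 34 c) ?M (mask_excess m k (M c))"
    using computes_excessE[OF pM, of c 34] assms k by simp
  have 2: "computes B (msumE 34 j) ?M (mask_sum P (\<lambda>i. digit P F (i * T + M j)) m k)"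
    using computes_msumE[OF pM, of 34 j] assms k by simp
  show "computes B (Ite (Var 34) (Ite (excessE 34 c) (Num 0) (Ite (msumE 34 j) (Num 0) (Num 1))) (Num 0)) ?M
     (if k \<noteq> 0 then if mask_excess m k (M c) \<noteq> 0 then 0
       else if mask_sum P (\<lambda>i. digit P F (i * T + M j)) m k \<noteq> 0 then 0 else 1 else 0)"
    by (intro computes_Ite 1 2 computes_Num computes_Var) (use assms k in \<open>auto simp: one_le_B\<close>)
next
  have "(\<Sum>k<M c. if k \<noteq> 0 then if mask_excess m k (M c) \<noteq> 0 then 0
       else if mask_sum P (\<lambda>i. digit P F (i * T + M j)) m k \<noteq> 0 then 0 else 1 else 0) \<le> (\<Sum>k<M c. 1::nat)"
    by (intro sum_mono) auto
  then show "(\<Sum>k<M c. if k \<noteq> 0 then if mask_excess m k (M c) \<noteq> 0 then 0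
       else if mask_sum P (\<lambda>i. digit P F (i * T + M j)) m k \<noteq> 0 then 0 else 1 else 0) \<le> B"
    using assms(2) by simp
qed

text \<open>There are \<open>2 ^ m\<close> masks, and each contributes at most
  \<open>2 ^ (a * L)\<close>.\<close>

lemma atom_sum_le: "atom_sum p d m L a \<le> X ^ 2"
proof -
  have "atom_sum p d m L a \<le> (\<Sum>c<(2::nat) ^ m. 2 ^ (a * L))"
    unfolding atom_sum_def by (intro sum_mono) (auto intro!: power_increasing)
  also have "\<dots> = 2 ^ m * 2 ^ (a * L)" by simp
  also have "\<dots> \<le> X * X" using m_X X_a by (intro mult_le_mono)
  finally show ?thesis by (simp add: power2_eq_square)
qed

lemma computes_atomE:
  assumes "params M" "j < 32" "M j < T"
  shows "computes B (atomE j) M (atom_sum P (\<lambda>i. digit P F (i * T + M j)) m L a)"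
  unfolding atomE_def atom_sum_def
proof (rule computes_SumE)
  show "computes B (PowE 38 39 (Num 2) (Var 11)) M (2 ^ m)"
    using assms bnds by (intro computes_PowE computes_Var computes_Num) (auto simp: paramsD)
  show "(\<Sum>c<2 ^ m. if c \<noteq> 0 then if popcount m c - L \<noteq> 0 then 0
     else if mask_sum P (\<lambda>i. digit P F (i * T + M j)) m c \<noteq> 0 then 0
     else if zero_submasks P (\<lambda>i. digit P F (i * T + M j)) m c \<noteq> 0 then 0
     else 2 ^ (a * popcount m c) else 0) \<le> B"
    using atom_sum_le[of P "\<lambda>i. digit P F (i * T + M j)"] unfolding atom_sum_def
    by (rule le_B) simp
  fix k s assume k: "k < (2::nat) ^ m"
  let ?M = "M(32 := k, 33 := s)"
  have pM: "params ?M" using assms(1) by (simp add: params_upd)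
  have kB: "k \<le> B" using k bnds(3) by simp
  have LB: "L \<le> B" using le_B1 X_L by simp
  have 0: "computes B (popE 32) ?M (popcount m k)" using computes_popE[OF pM, of 32] kB by simp
  have 1: "computes B (msumE 32 j) ?M (mask_sum P (\<lambda>i. digit P F (i * T + M j)) m k)"
    using computes_msumE[OF pM, of 32 j] assms kB by simp
  have 2: "computes B (zsubE 32 j) ?M (zero_submasks P (\<lambda>i. digit P F (i * T + M j)) m k)"
    using computes_zsubE[OF pM, of 32 j] assms kB by simp
  \<comment> \<open>The power is evaluated only behind the test for at most \<open>L\<close>
    elements; for larger masks it might exceed \<open>B\<close>.\<close>
  have 3: "computes B (PowE 38 39 (Num 2) (Bin Mult (Var 7) (popE 32))) ?M (2 ^ (a * popcount m k))"
    if "popcount m k - L = 0"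
  proof (intro computes_PowE computes_Mult computes_Var computes_Num 0)
    have "popcount m k \<le> L" using that by simp
    then have "(2::nat) ^ (a * popcount m k) \<le> 2 ^ (a * L)" by (intro power_increasing) auto
    then show "2 ^ (a * popcount m k) \<le> B" using X_a(2) by (intro le_B1) linarith
    show "a * popcount m k \<le> B" using \<open>popcount m k \<le> L\<close> X_L by (intro le_B2 X_a(1)) simp
  qed (use paramsD[OF assms(1)] X_a one_le_B le_B1 in auto)
  show "computes B (Ite (Var 32) (Ite (Bin Sub (popE 32) (Var 5)) (Num 0) (Ite (msumE 32 j) (Num 0)
       (Ite (zsubE 32 j) (Num 0) (PowE 38 39 (Num 2) (Bin Mult (Var 7) (popE 32)))))) (Num 0)) ?M
    (if k \<noteq> 0 then if popcount m k - L \<noteq> 0 then 0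
     else if mask_sum P (\<lambda>i. digit P F (i * T + M j)) m k \<noteq> 0 then 0
     else if zero_submasks P (\<lambda>i. digit P F (i * T + M j)) m k \<noteq> 0 then 0
     else 2 ^ (a * popcount m k) else 0)"
    by (intro computes_Ite computes_Sub 0 1 2 3 computes_Num computes_Var)
      (use kB LB paramsD[OF pM] in auto)
qed

lemma computes_largeE:
  assumes "params M" "2 ^ W \<le> n \<Longrightarrow> computes B d M u" "n < 2 ^ W \<Longrightarrow> computes B e M v"
  shows "computes B (largeE d e) M (if 2 ^ W \<le> n then u else v)"
  unfolding largeE_def using assms le_B1[OF X_W] le_B1[of n] n_X
  by (intro computes_IfLe computes_Num computes_Var) (auto simp: paramsD)

lemma computes_gapE:
  assumes "params M" "M 30 < T"
  shows "computes B gapE M (gap (M 30))" "gap (M 30) \<le> X"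
proof -
  show "computes B gapE M (gap (M 30))"
    unfolding gapE_def gap_def
  proof (rule computes_largeE[OF assms(1)])
    show "computes B (Num 1) M 1" by (intro computes_Num one_le_B)
    assume n: "n < 2 ^ W"
    then show "computes B (TableE 30 gapB TB) M (gapB (M 30))"
      using assms(2) T_eq X_T by (intro computes_TableE) (auto intro!: le_B1 X_gap)
  qed
  show "gap (M 30) \<le> X"
    using X_gap[of "M 30"] assms(2) T_eq X_ge by (auto simp: gap_def)
qed

definition total :: nat where
  "total = (\<Sum>j<T. gap j * atom_sum P (\<lambda>i. digit P F (i * T + j)) m L a)"

lemma total_le: "total \<le> X ^ 4"
proof -
  have "gap j * atom_sum P (\<lambda>i. digit P F (i * T + j)) m L a \<le> X * X ^ 2" if "j < T" for j
  proof (rule mult_le_mono)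
    show "gap j \<le> X" using X_gap[of j] that T_eq X_ge by (auto simp: gap_def)
  qed (rule atom_sum_le)
  then have "total \<le> (\<Sum>j<T. X * X ^ 2)" unfolding total_def by (intro sum_mono) auto
  also have "\<dots> \<le> X * (X * X ^ 2)" using X_T by simp
  finally show ?thesis by (simp add: eval_nat_numeral)
qed

lemma computes_numerE:
  assumes "params M"
  shows "computes B numerE M (2 * (n - 1) + 2 * total + G * (n div (L + 1)) - 2 * G)"
proof -
  have T: "computes B totalE M total"
    unfolding totalE_def total_def
  proof (rule computes_SumE)
    show "computes B (Var 6) M T" using assms bnds by (intro computes_Var) (auto simp: paramsD)
    show "(\<Sum>j<T. gap j * atom_sum P (\<lambda>i. digit P F (i * T + j)) m L a) \<le> B"
      using total_le unfolding total_def by (rule le_B) simp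
    fix k s assume k: "k < T"
    let ?M = "M(30 := k, 31 := s)"
    have pM: "params ?M" using assms(1) by (simp add: params_upd)
    have 1: "computes B gapE ?M (gap k)" "gap k \<le> X" using computes_gapE[OF pM] k by auto
    have 2: "computes B (atomE 30) ?M (atom_sum P (\<lambda>i. digit P F (i * T + k)) m L a)"
      using computes_atomE[OF pM, of 30] k by simp
    have "gap k * atom_sum P (\<lambda>i. digit P F (i * T + k)) m L a \<le> X * X ^ 2"
      by (intro mult_le_mono 1 atom_sum_le)
    then have "gap k * atom_sum P (\<lambda>i. digit P F (i * T + k)) m L a \<le> B"
      using le_B[of _ 3] by (simp add: eval_nat_numeral)
    then show "computes B (Bin Mult gapE (atomE 30)) ?M (gap k * atom_sum P (\<lambda>i. digit P F (i * T + k)) m L a)"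
      by (intro computes_Mult 1 2)
  qed
  have X4: "X \<le> X ^ 4" "X * X \<le> X ^ 4" "9 * X ^ 4 \<le> X ^ 5" "X ^ 5 \<le> B"
  proof -
    show "X \<le> X ^ 4" using power_increasing[of 1 4 X] X_ge by simp
    show "X * X \<le> X ^ 4" using power_increasing[of 2 4 X] X_ge by (simp add: power2_eq_square)
    have "9 * X ^ 4 \<le> X * X ^ 4" using X_ge by (intro mult_le_mono1) simp
    then show "9 * X ^ 4 \<le> X ^ 5" by (simp add: eval_nat_numeral)
    show "X ^ 5 \<le> B" by (rule le_B) auto
  qed
  have H: "G * (n div (L + 1)) \<le> X * X"
  proof (intro mult_le_mono X_G)
    show "n div (L + 1) \<le> X" using n_X by (intro le_trans[OF div_le_dividend]) simp
  qed
  have b: "2 * (n - 1) \<le> B" "2 * total \<le> B" "G * (n div (L + 1)) \<le> B" "2 * G \<le> B" "L + 1 \<le> B"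
     "2 * (n - 1) + 2 * total \<le> B" "2 * (n - 1) + 2 * total + G * (n div (L + 1)) \<le> B" "n \<le> B" "G \<le> B" "L \<le> B"
    using total_le X4 H X_G n_X X_L by (linarith, linarith, linarith, linarith, linarith, linarith, linarith, linarith, linarith, linarith)
  show ?thesis
    unfolding numerE_def
    by (intro computes_Sub computes_Add computes_Mult computes_Div computes_Num computes_Var T)
      (use b one_le_B paramsD[OF assms] in auto)
qed

definition delta :: "nat \<Rightarrow> nat \<Rightarrow> nat \<Rightarrow> nat \<Rightarrow> nat \<Rightarrow> nat" where
  "delta pos neg pw c k = (if c \<le> k mod T then if digit (n + 1) S (k div T) = pos then pw
     else if digit (n + 1) S (k div T) = neg then P - pw else 0 else 0)"

lemma computes_updateE:
  assumes "params M" "M 22 \<le> B" "M 23 \<le> B" "M 24 < P" "M 25 \<le> B"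
  shows "computes B updateE M
    (digits_num P (\<lambda>k. (digit P F k + delta (M 22) (M 23) (M 24) (M 25) k) mod P) (m * T))"
proof -
  let ?f = "\<lambda>k. (digit P F k + delta (M 22) (M 23) (M 24) (M 25) k) mod P"
  have fP: "?f k < P" for k using P2 by simp
  show ?thesis
    unfolding updateE_def digits_num_def
  proof (rule computes_SumE)
    show "computes B (Bin Mult (Var 11) (Var 6)) M (m * T)"
      using assms bnds index_B[of "m * T"] by (intro computes_Mult computes_Var) (auto simp: paramsD)
    have "digits_num P ?f (m * T) < P ^ (m * T)" by (rule digits_num_less) (rule fP)
    then show "(\<Sum>k<m * T. ?f k * P ^ k) \<le> B"
      using pow_P_le[of "m * T"] by (simp add: digits_num_def)
    fix k s assume k: "k < m * T"
    let ?M = "M(30 := k, 31 := s)"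
    have pM: "params ?M" using assms(1) by (simp add: params_upd)
    note lk = paramsD[OF pM]
    have kB: "k \<le> B" using k index_B by simp
    have vk: "computes B (Var 30) ?M k" using kB by (intro computes_Var) auto
    have kd: "k div T < m" using k T1 by (simp add: less_mult_imp_div_less)
    have n1: "computes B (Bin Add (Var 4) (Num 1)) (?M(38 := x, 39 := y)) (n + 1)" for x y
      using lk le_B1[OF n_X] one_le_B by (intro computes_Add computes_Var computes_Num) auto
    have n1': "computes B (Bin Add (Var 4) (Num 1)) ?M (n + 1)"
      using lk le_B1[OF n_X] one_le_B by (intro computes_Add computes_Var computes_Num) auto
    have dS: "computes B (digE 10 (Bin Add (Var 4) (Num 1)) (Bin Div (Var 30) (Var 6))) ?M
        (digit (n + 1) S (k div T))"
      unfolding digE_def digit_def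
      by (intro computes_Mod computes_Div computes_PowE n1 n1' vk computes_Var)
        (use lk bnds pow_n_le[of "k div T"] kd one_le_B in auto)
    have dlt: "computes B deltaE ?M (delta (M 22) (M 23) (M 24) (M 25) k)"
      unfolding deltaE_def delta_def
      by (intro computes_IfLe computes_IfEq computes_Sub computes_Mod computes_Num computes_Var dS)
        (use lk assms bnds kB in auto)
    have dF: "computes B (digE 12 (Var 8) (Var 30)) ?M (digit P F k)"
      by (rule computes_digit_F[OF pM vk k])
    have dle: "delta (M 22) (M 23) (M 24) (M 25) k \<le> P" using assms(4) by (auto simp: delta_def)
    have "digit P F k + delta (M 22) (M 23) (M 24) (M 25) k \<le> 2 * P" using dle digit_less[of k] by simp
    then have ad: "digit P F k + delta (M 22) (M 23) (M 24) (M 25) k \<le> B"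
      using le_B2[of 2 P] P_X X_ge by simp
    \<comment> \<open>A digit at position \<open>k\<close> is at most \<open>P\<close>, and
      \<open>P ^ (k + 1)\<close> does not exceed \<open>P ^ (m * T)\<close> because \<open>k\<close>
      is not beyond the last position.\<close>
    have ml: "?f k * P ^ k \<le> B"
    proof -
      have "?f k * P ^ k \<le> P * P ^ k" using fP[of k] by (intro mult_le_mono1) simp
      also have "\<dots> \<le> B" using pow_P_le[of "Suc k"] k by simp
      finally show ?thesis .
    qed
    have pw: "computes B (PowE 38 39 (Var 8) (Var 30)) ?M (P ^ k)"
      by (intro computes_PowE vk computes_Var) (use lk bnds pow_P_le[of k] k in auto)
    show "computes B (Bin Mult (Bin Mod (Bin Add (digE 12 (Var 8) (Var 30)) deltaE) (Var 8)) (PowE 38 39 (Var 8) (Var 30))) ?M (?f k * P ^ k)"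
      by (intro computes_Mult computes_Mod computes_Add dF dlt pw ad ml computes_Var)
        (use lk bnds in auto)
  qed
qed

end

section \<open>Graphs along a stream and the invariant of the sketch\<close>

definition weighted_graph_on :: "nat \<Rightarrow> nat \<Rightarrow> wgraph \<Rightarrow> bool" where
  "weighted_graph_on n W g \<longleftrightarrow> edges_on {1..n} (dom g) \<and> (\<forall>e\<in>dom g. the (g e) \<in> {1..W})"

lemma weighted_graph_on_empty: "weighted_graph_on n W (\<lambda>_. None)"
  by (simp add: weighted_graph_on_def edges_on_def)

text \<open>For a deletion the ranges are not part of \<open>valid_item\<close>; they are inherited
  from the graph that contains the edge.\<close>

lemma valid_item_bounds:
  assumes g: "weighted_graph_on n W g" and x: "valid_item n W g x" "x = Insertion u v w \<or> x = Deletion u v w"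
  shows "u \<in> {1..n} \<and> v \<in> {1..n} \<and> u \<noteq> v \<and> w \<in> {1..W}"
  using x(2)
proof
  assume "x = Deletion u v w"
  then have "g {u, v} = Some w" using x(1) by simp
  then have "{u, v} \<in> dom g" "the (g {u, v}) = w" by auto
  then show ?thesis
    using g edges_onD[of "{1..n}" "dom g" u v] unfolding weighted_graph_on_def by metis
qed (use x(1) in simp)

lemma weighted_graph_on_apply:
  assumes "weighted_graph_on n W g" "valid_item n W g x"
  shows "weighted_graph_on n W (apply_item x g)"
proof (cases x)
  case (Insertion u v w)
  have "u \<noteq> v" "u \<in> {1..n}" "v \<in> {1..n}" "edges_on {1..n} (dom g)"
    using assms unfolding Insertion weighted_graph_on_def by auto
  then have "edges_on {1..n} (insert {u, v} (dom g))" unfolding edges_on_def by blast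
  then show ?thesis using assms unfolding Insertion weighted_graph_on_def by auto
next
  case (Deletion u v w)
  then show ?thesis
    using assms edges_on_subset[of "{1..n}" "dom g" "dom g - {{u, v}}"]
    unfolding Deletion weighted_graph_on_def by auto
qed

lemma weighted_graph_on_fold:
  assumes "weighted_graph_on n W g"
    and "\<And>i. i < length xs \<Longrightarrow> valid_item n W (fold apply_item (take i xs) g) (xs ! i)"
  shows "weighted_graph_on n W (fold apply_item xs g)"
  using assms
proof (induction xs arbitrary: g)
  case (Cons x xs)
  have "valid_item n W g x" using Cons.prems(2)[of 0] by simp
  then have "weighted_graph_on n W (apply_item x g)" by (rule weighted_graph_on_apply[OF Cons.prems(1)])
  moreover have "valid_item n W (fold apply_item (take i xs) (apply_item x g)) (xs ! i)" if "i < length xs" for i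
    using Cons.prems(2)[of "Suc i"] that by simp
  ultimately show ?case using Cons.IH by simp
qed simp

context sketch_run
begin

definition level_of :: "wgraph \<Rightarrow> nat \<Rightarrow> nat set set" where
  "level_of g j = {e \<in> dom g. cls (the (g e)) \<le> j}"

abbreviation good_graph :: "wgraph \<Rightarrow> bool" where
  "good_graph \<equiv> weighted_graph_on n W"

definition print_digit :: "wgraph \<Rightarrow> nat list \<Rightarrow> nat \<Rightarrow> nat \<Rightarrow> nat" where
  "print_digit g l r k = nat (fingerprint n r (level_of g (k mod T)) (l ! (k div T)) mod int P)"

definition table :: "wgraph \<Rightarrow> nat list \<Rightarrow> nat \<Rightarrow> nat" where
  "table g l r = digits_num P (print_digit g l r) (length l * T)"

definition list_code :: "nat list \<Rightarrow> nat" where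
  "list_code l = digits_num (n + 1) ((!) l) (length l)"

definition valid_sample :: "nat list \<Rightarrow> nat \<Rightarrow> bool" where
  "valid_sample l r \<longleftrightarrow> set l \<subseteq> {1..n} \<and> length l \<le> cap \<and> r < P"

lemma print_digit_less: "print_digit g l r k < P"
  using P2 by (simp add: print_digit_def nat_less_iff)

lemma digit_table:
  assumes "k < length l * T"
  shows "digit P (table g l r) k = print_digit g l r k"
  unfolding table_def by (rule digit_digits_num) (use assms print_digit_less in auto)

lemma nth_le: "set l \<subseteq> {1..n} \<Longrightarrow> i < length l \<Longrightarrow> l ! i < n + 1"
  using nth_mem by fastforce

lemma digit_list_code:
  assumes "set l \<subseteq> {1..n}" "i < length l"
  shows "digit (n + 1) (list_code l) i = l ! i"
  unfolding list_code_def by (rule digit_digits_num) (use assms nth_le in auto)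

lemma list_code_le:
  assumes "set l \<subseteq> {1..n}" "length l \<le> cap"
  shows "list_code l \<le> X"
proof -
  have "list_code l < (n + 1) ^ length l"
    unfolding list_code_def using assms nth_le by (intro digits_num_less) auto
  also have "\<dots> \<le> (n + 1) ^ cap" using assms by (intro power_increasing) auto
  finally show ?thesis using X_cap by linarith
qed

lemma sketch_tableI:
  assumes "valid_sample l r"
  shows "sketch_table W LA LB TB GB clB gapB n L T G a P N cap X (length l) r (list_code l) (table g l r)"
proof unfold_locales
  show "table g l r < P ^ (length l * T)"
    unfolding table_def by (intro digits_num_less print_digit_less)
qed (use assms list_code_le in \<open>auto simp: valid_sample_def\<close>)

lemma good_graph_level: "good_graph g \<Longrightarrow> edges_on {1..n} (level_of g j)"
  unfolding weighted_graph_on_def level_of_def by (auto intro: edges_on_subset)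

fun item_edge :: "stream_item \<Rightarrow> nat set" where
  "item_edge (Insertion u v w) = {u, v}"
| "item_edge (Deletion u v w) = {u, v}"

fun item_weight :: "stream_item \<Rightarrow> nat" where
  "item_weight (Insertion u v w) = w"
| "item_weight (Deletion u v w) = w"

fun item_sign :: "stream_item \<Rightarrow> int" where
  "item_sign (Insertion u v w) = 1"
| "item_sign (Deletion u v w) = -1"

text \<open>Linearity: the change of a fingerprint is determined by the item and the point alone.
  Validity ensures that an inserted edge was absent and a deleted one present with the same weight,
  so exactly the levels from its class on gain or lose it.\<close>

lemma fingerprint_apply_item:
  assumes g: "good_graph g" and x: "valid_item n W g x"
  shows "fingerprint n r (level_of (apply_item x g) j) s = fingerprint n r (level_of g j) s +
    (if cls (item_weight x) \<le> j
     then item_sign x * (edge_sign (item_edge x) s * int r ^ edge_index n (item_edge x)) else 0)"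
proof -
  have fin: "finite (level_of g j)"
    using finite_edges_on[OF _ good_graph_level[OF g]] by simp
  show ?thesis
  proof (cases x)
    case (Insertion u v w)
    have notin: "{u, v} \<notin> dom g" using x Insertion by auto
    have "level_of (apply_item x g) j =
        (if cls w \<le> j then insert {u, v} (level_of g j) else level_of g j)"
      using notin unfolding level_of_def Insertion by auto
    moreover have "{u, v} \<notin> level_of g j" using notin by (auto simp: level_of_def)
    ultimately show ?thesis using fin by (simp add: Insertion fingerprint_def)
  next
    case (Deletion u v w)
    have ing: "g {u, v} = Some w" using x Deletion by auto
    have eq: "level_of (apply_item x g) j = level_of g j - {{u, v}}"
      unfolding level_of_def Deletion by auto
    have "{u, v} \<in> level_of g j \<longleftrightarrow> cls w \<le> j" using ing by (auto simp: level_of_def)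
    then show ?thesis
      using fin unfolding eq by (simp add: Deletion fingerprint_def sum_diff1)
  qed
qed

definition state :: "wgraph \<Rightarrow> nat list \<Rightarrow> nat \<Rightarrow> memory \<Rightarrow> bool" where
  "state g l r M \<longleftrightarrow> sketch_table.params n L T G a P (length l) r (list_code l) (table g l r) M \<and> ready B M"

definition numer :: "wgraph \<Rightarrow> nat list \<Rightarrow> nat \<Rightarrow> nat" where
  "numer g l r = 2 * (n - 1)
     + 2 * (\<Sum>j<T. gap j * atom_sum P (\<lambda>i. digit P (table g l r) (i * T + j)) (length l) L a)
     + G * (n div (L + 1)) - 2 * G"

fun item_memory :: "stream_item \<Rightarrow> memory \<Rightarrow> memory" where
  "item_memory (Insertion u v w) M = M(0 := 1, 1 := u, 2 := v, 3 := w)"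
| "item_memory (Deletion u v w) M = M(0 := 0, 1 := u, 2 := v, 3 := w)"

text \<open>The rebuilt number is recognized as the table of the updated graph by comparing digits
  modulo \<open>P\<close>; the answer is then computed afresh from this table.\<close>

lemma run_step:
  assumes g: "good_graph g" and x: "valid_item n W g x" and l: "valid_sample l r" and st: "state g l r M"
  shows "\<exists>M'. run B step_program (item_memory x M) (return_pmf M') \<and> state (apply_item x g) l r M' \<and>
    M' 13 = numer (apply_item x g) l r"
proof -
  interpret sketch_table W LA LB TB GB CA clB gapB n L T G a P N cap X "length l" r "list_code l" "table g l r"
    by (rule sketch_tableI[OF l])
  let ?g = "apply_item x g"
  \<comment> \<open>The same parameters with the table of the updated graph, from which the answer
    is computed.\<close>
  interpret new: sketch_table W LA LB TB GB CA clB gapB n L T G a P N cap X "length l" r "list_code l" "table ?g l r"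
    by (rule sketch_tableI[OF l])
  obtain op u v w where M0: "item_memory x M = M(0 := op, 1 := u, 2 := v, 3 := w)"
    and x_eq: "x = (if op = 0 then Deletion u v w else Insertion u v w)" and op: "op \<le> 1"
  proof (cases x)
    case (Insertion u v w)
    then show ?thesis using that[of 1 u v w] by simp
  next
    case (Deletion u v w)
    then show ?thesis using that[of 0 u v w] by simp
  qed
  define e where "e = {u, v}"
  have e: "item_edge x = e" "item_weight x = w" "item_sign x = (if op = 0 then -1 else 1)"
    using x_eq by (auto simp: e_def)
  have uvw: "u \<in> {1..n}" "v \<in> {1..n}" "u \<noteq> v" "w \<in> {1..W}"
    using valid_item_bounds[OF g x, of u v w] x_eq by (auto split: if_splits)
  have mm: "Min e = min u v" "Max e = max u v" by (auto simp: e_def)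
  have WB: "W \<le> X" using X_W less_exp[of W] by linarith
  have small: "op \<le> B" "u \<le> B" "v \<le> B" "w \<le> B" "n \<le> B" "r \<le> B" "L \<le> B"
    using op uvw n_X WB X_L one_le_B l P_X by (auto intro!: le_B1 simp: valid_sample_def)
  define M0 where "M0 = M(0 := op, 1 := u, 2 := v, 3 := w)"
  have rM: "ready B M" and pM: "params M" using st by (auto simp: state_def)
  have r0: "ready B M0" unfolding M0_def using rM small by (intro ready_upd) auto
  have p0: "params M0" using pM by (simp add: M0_def params_def)
  have lo: "computes B loE M' (min u v)" and hi: "computes B hiE M' (max u v)"
    if "M' 1 = u" "M' 2 = v" for M'
  proof -
    show "computes B loE M' (min u v)"
      unfolding loE_def min_def using that small by (intro computes_IfLe computes_Var) auto
    show "computes B hiE M' (max u v)"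
      unfolding hiE_def max_def using that small by (intro computes_IfLe computes_Var) auto
  qed
  define pos where "pos = (if op \<noteq> 0 then min u v else max u v)"
  define neg where "neg = (if op \<noteq> 0 then max u v else min u v)"
  define ix where "ix = edge_index n e"
  define pw where "pw = r ^ ix mod P"
  define c where "c = cls w"
  have pn: "pos \<le> B" "neg \<le> B" using small by (auto simp: pos_def neg_def)
  have modX: "y mod P \<le> X" for y using mod_less_divisor[of P y] P2 P_X by linarith
  have pwP: "pw < P" "pw \<le> B" using P2 le_B1[OF modX] by (auto simp: pw_def)
  have cB: "c \<le> B"
    using uvw WB X_cl[of w] by (auto simp: c_def cls_def intro!: le_B1)
  define M1 where "M1 = M0(22 := pos)"
  define M2 where "M2 = M1(23 := neg)"
  define M3 where "M3 = M2(24 := pw)"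
  define M4 where "M4 = M3(25 := c)"
  define M5 where "M5 = M4(12 := table ?g l r)"
  have r1: "ready B M1" unfolding M1_def using r0 pn by (intro ready_upd) auto
  have r2: "ready B M2" unfolding M2_def using r1 pn by (intro ready_upd) auto
  have r3: "ready B M3" unfolding M3_def using r2 pwP by (intro ready_upd) auto
  have r4: "ready B M4" unfolding M4_def using r3 cB by (intro ready_upd) auto
  have r5: "ready B M5" unfolding M5_def using r4 le_B1[OF new.m_X(5)] by (intro ready_upd) auto
  have look: "M0 0 = op" "M0 1 = u" "M0 2 = v" "M0 3 = w" by (auto simp: M0_def)
  have s1: "run B (asg 22 (Ite (Var 0) loE hiE)) M0 (return_pmf M1)"
    unfolding M1_def pos_def
    by (intro run_asg static_step computes_Ite lo hi r0 computes_Var) (use look small in auto)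
  have s2: "run B (asg 23 (Ite (Var 0) hiE loE)) M1 (return_pmf M2)"
    unfolding M2_def neg_def
    by (intro run_asg static_step computes_Ite lo hi r1 computes_Var) (use look small in \<open>auto simp: M1_def\<close>)
  have p2: "params M2" using p0 by (simp add: M2_def M1_def params_def)
  have pwc: "computes B powerE M2 pw"
  proof -
    have ixle: "min u v * (n + 1) \<le> B" "min u v * (n + 1) + max u v \<le> B"
    proof -
      have "min u v * (n + 1) + max u v \<le> (n + 1) * (n + 1) + (n + 1)"
        using uvw by (intro add_mono mult_le_mono1) auto
      also have "\<dots> \<le> X + X" using X_n n_X by (simp add: power2_eq_square)
      also have "\<dots> \<le> X * X" using X_ge by (cases X) auto
      finally show "min u v * (n + 1) + max u v \<le> B" using le_B2[of X X] by simp
      then show "min u v * (n + 1) \<le> B" by simp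
    qed
    have "computes B powerE M2 (r ^ ix mod P)"
      unfolding powerE_def
    proof (rule computes_Rec[where h = "\<lambda>k. r ^ k mod P"])
      show "computes B (Bin Add (Bin Mult loE (Bin Add (Var 4) (Num 1))) hiE) M2 ix"
        unfolding ix_def edge_index_def mm
        by (intro computes_Add computes_Mult lo hi computes_Var computes_Num)
          (use ixle paramsD[OF p2] look small le_B1[OF n_X] one_le_B in \<open>auto simp: M2_def M1_def\<close>)
      show "computes B (Num 1) M2 (r ^ 0 mod P)" using P2 one_le_B by (simp add: computes_def)
      fix k
      have pk: "params (M2(30 := k, 31 := r ^ k mod P))" using p2 by (simp add: params_upd)
      have kP: "r ^ k mod P \<le> X" by (rule modX)
      have rX: "r \<le> X" using l P_X by (auto simp: valid_sample_def)
      have "computes B (Bin Mod (Bin Mult (Var 31) (Var 9)) (Var 8)) (M2(30 := k, 31 := r ^ k mod P))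
          ((r ^ k mod P * r) mod P)"
        by (intro computes_Mod computes_Mult computes_Var le_B2 kP rX)
          (use paramsD[OF pk] le_B1[OF kP] small bnds in auto)
      then show "computes B (Bin Mod (Bin Mult (Var 31) (Var 9)) (Var 8)) (M2(30 := k, 31 := r ^ k mod P))
          (r ^ Suc k mod P)"
        by (simp add: mod_mult_right_eq mult.commute)
    qed
    then show ?thesis by (simp add: pw_def)
  qed
  have s3: "run B (asg 24 powerE) M2 (return_pmf M3)"
    unfolding M3_def by (intro run_asg static_step pwc r2) simp
  have p3: "params M3" using p2 by (simp add: M3_def params_def)
  have clc: "computes B classE M3 c"
    unfolding classE_def c_def cls_def
  proof (rule computes_largeE[OF p3])
    show "computes B (Bin Sub (Var 3) (Num 1)) M3 (w - 1)"
      by (intro computes_Sub computes_Var computes_Num)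
        (use look small one_le_B in \<open>auto simp: M3_def M2_def M1_def\<close>)
    assume nW: "n < 2 ^ W"
    have w3: "M3 3 = w" using look by (simp add: M3_def M2_def M1_def)
    have "computes B (TableE 3 clB W) M3 (clB (M3 3))"
      using uvw WB w3 nW by (intro computes_TableE) (auto intro!: le_B1 X_cl)
    then show "computes B (TableE 3 clB W) M3 (clB w)" by (simp add: w3)
  qed
  have s4: "run B (asg 25 classE) M3 (return_pmf M4)"
    unfolding M4_def by (intro run_asg static_step clc r3) simp
  have p4: "params M4" using p3 by (simp add: M4_def params_def)
  have l4: "M4 22 = pos" "M4 23 = neg" "M4 24 = pw" "M4 25 = c"
    by (simp_all add: M4_def M3_def M2_def M1_def)
  have upd: "digits_num P (\<lambda>k. (digit P (table g l r) k + delta pos neg pw c k) mod P) (length l * T) = table ?g l r"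
    unfolding table_def[of ?g]
  proof (rule digits_num_cong)
    fix k assume k: "k < length l * T"
    define s where "s = l ! (k div T)"
    have kl: "k div T < length l" using k T1 by (simp add: less_mult_imp_div_less)
    have sd: "digit (n + 1) (list_code l) (k div T) = s"
      unfolding s_def using l kl by (intro digit_list_code) (auto simp: valid_sample_def)
    have dg: "digit P (table g l r) k = print_digit g l r k" using digit_table[OF k] .
    have id: "int (print_digit h l r k) = fingerprint n r (level_of h (k mod T)) s mod int P" for h
      using P2 by (simp add: print_digit_def s_def)
    have del: "int (delta pos neg pw c k) mod int P =
        (if c \<le> k mod T then item_sign x * (edge_sign e s * int r ^ ix) else 0) mod int P"
    proof -
      have ipw: "int pw mod int P = int r ^ ix mod int P" by (simp add: pw_def zmod_int)
      \<comment> \<open>Modulo \<open>P\<close>, the complement \<open>P - pw\<close> stands for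
        minus the power.\<close>
      have ineg: "int (P - pw) mod int P = (- (int r ^ ix)) mod int P"
      proof -
        have "int (P - pw) = int P - int pw" using pwP by simp
        then have "int (P - pw) mod int P = (- int pw + int P) mod int P" by simp
        also have "\<dots> = (- int pw) mod int P" by (rule mod_add_self2)
        also have "\<dots> = (- (int r ^ ix)) mod int P" by (rule mod_minus_cong[OF ipw])
        finally show ?thesis .
      qed
      have ne: "min u v \<noteq> max u v" using uvw by auto
      show ?thesis
        unfolding delta_def sd e(3) edge_sign_def mm pos_def neg_def
        using ipw ineg ne by auto
    qed
    have "int ((digit P (table g l r) k + delta pos neg pw c k) mod P) =
        (int (print_digit g l r k) + int (delta pos neg pw c k)) mod int P"
      by (simp add: dg zmod_int)
    also have "\<dots> = (fingerprint n r (level_of g (k mod T)) s +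
        (if c \<le> k mod T then item_sign x * (edge_sign e s * int r ^ ix) else 0)) mod int P"
      unfolding id by (rule mod_add_cong[OF _ del]) simp
    also have "\<dots> = fingerprint n r (level_of ?g (k mod T)) s mod int P"
      unfolding fingerprint_apply_item[OF g x] e c_def ix_def ..
    also have "\<dots> = int (print_digit ?g l r k)" by (simp add: id)
    finally show "(digit P (table g l r) k + delta pos neg pw c k) mod P = print_digit ?g l r k" by simp
  qed
  have s5: "run B (asg 12 updateE) M4 (return_pmf M5)"
  proof -
    have "computes B updateE M4 (table ?g l r)"
      using computes_updateE[OF p4] unfolding l4 using pn pwP cB upd by simp
    then show ?thesis unfolding M5_def by (intro run_asg static_step r4) simp_all
  qed
  have p5: "new.params M5" using p4 by (simp add: M5_def params_def new.params_def)
  have nc: "computes B numerE M5 (numer ?g l r)"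
    using new.computes_numerE[OF p5] unfolding numer_def new.total_def .
  have s6: "run B (asg 13 numerE) M5 (return_pmf (M5(13 := numer ?g l r)))"
    by (intro run_asg static_step nc r5) simp
  have "run B step_program M0 (return_pmf (M5(13 := numer ?g l r)))"
    unfolding step_program_def
    by (rule runs_Seq_det[OF s1 runs_Seq_det[OF s2 runs_Seq_det[OF s3 runs_Seq_det[OF s4 runs_Seq_det[OF s5 s6]]]]])
  moreover have "state ?g l r (M5(13 := numer ?g l r))"
    unfolding state_def using p5 r5 computes_le[OF nc] by (auto simp: new.params_def intro!: ready_upd)
  ultimately show ?thesis using \<open>item_memory x M = _\<close> unfolding M0_def by auto
qed

end

section \<open>Initialization: parameters, sample and random point\<close>

context sketch
begin

definition L_E :: aexp where
  "L_E = largeE (Num LA) (IfLe (Var 4) (Num LB) (Var 4) (Num LB))"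

definition T_E :: aexp where
  "T_E = largeE (Num (W - 1)) (Num TB)"

definition G_E :: aexp where
  "G_E = largeE (Num (W - 1)) (Num GB)"

text \<open>For large \<open>n\<close>, the first exponent whose successor violates the bound
  \<open>CA * 2 ^ (a * L) \<le> n\<close>. It is 0, so that every vertex is sampled, if already the
  exponent 1 violates it.\<close>

definition a_E :: aexp where
  "a_E = largeE (Rec 30 31 (Var 4) (Num 0)
     (IfLe (Bin Mult (Num CA) (PowE 32 33 (Num 2) (Bin Mult (Bin Add (Var 31) (Num 1)) (Var 5)))) (Var 4)
       (Bin Add (Var 31) (Num 1)) (Var 31))) (Num 0)"

text \<open>Twelve times the bound on the number of bad points, so that a random point below
  \<open>2 ^ N \<ge> Z\<close> is bad with probability at most 1/12.\<close>

definition Z_E :: aexp where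
  "Z_E = Bin Mult (Bin Mult (Num 12) (Var 6)) (PowE 32 33 (Bin Add (Var 4) (Num 1)) (Bin Add (Var 5) (Num 2)))"

definition N_E :: aexp where
  "N_E = Rec 30 31 (Var 16) (Num 0)
     (IfLe (Var 16) (PowE 32 33 (Num 2) (Var 31)) (Var 31) (Bin Add (Var 31) (Num 1)))"

text \<open>Trial division of the candidates from \<open>2 ^ N\<close> on. Since the search starts
  at 0 and a prime exists between \<open>2 ^ N\<close> and \<open>2 ^ (4 * N)\<close>, that many
  rounds are enough.\<close>

definition P_E :: aexp where
  "P_E = Rec 30 31 (PowE 32 33 (Num 2) (Bin Mult (Num 4) (Var 17))) (Num 0)
     (IfLe (PowE 32 33 (Num 2) (Var 17)) (Var 31)
       (Ite (SumE 32 33 (Var 31) (IfLe (Num 2) (Var 32) (Ite (Bin Mod (Var 31) (Var 32)) (Num 0) (Num 1)) (Num 0)))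
         (Bin Add (Var 31) (Num 1)) (Var 31))
       (Bin Add (Var 31) (Num 1)))"

text \<open>Twelve times a bound on the expected sample size, for Markov's inequality; the summand 1
  covers the rounding of the quotient.\<close>

definition cap_E :: aexp where
  "cap_E = Bin Mult (Num 12) (Bin Add (Bin Div (Var 4) (PowE 32 33 (Num 2) (Var 7))) (Num 1))"

text \<open>The current vertex becomes the next digit if the coin in cell 18 shows 1 and the list is
  not full. Cell 21 counts down from \<open>n\<close>, so the current vertex is \<open>n + 1\<close>
  minus its content.\<close>

definition code_E :: aexp where
  "code_E = Ite (Var 18) (IfLe (Var 15) (Var 11) (Var 10)
     (Bin Add (Var 10) (Bin Mult (Bin Sub (Bin Add (Var 4) (Num 1)) (Var 21))
       (PowE 32 33 (Bin Add (Var 4) (Num 1)) (Var 11))))) (Var 10)"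

definition len_E :: aexp where
  "len_E = Ite (Var 18) (IfLe (Var 15) (Var 11) (Var 11) (Bin Add (Var 11) (Num 1))) (Var 11)"

definition dec_program :: "nat \<Rightarrow> program" where
  "dec_program x = asg x (Bin Sub (Var x) (Num 1))"

definition coin_program :: program where
  "coin_program = Seq (asg 18 (Num 1)) (Seq (asg 19 (Var 7))
     (While 19 (Seq (Flip 20) (Seq (asg 18 (Bin Mult (Var 18) (Var 20))) (Seq (Const 20 0) (dec_program 19))))))"

definition sample_program :: program where
  "sample_program = Seq (asg 21 (Var 4)) (While 21 (Seq coin_program
     (Seq (asg 10 code_E) (Seq (asg 11 len_E) (Seq (asg 18 (Num 0)) (dec_program 21))))))"

definition seed_program :: program where
  "seed_program = Seq (asg 19 (Var 17))
     (While 19 (Seq (Flip 20) (Seq (asg 9 (Bin Add (Bin Mult (Num 2) (Var 9)) (Var 20)))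
       (Seq (Const 20 0) (dec_program 19)))))"

definition init_program :: program where
  "init_program = Seq (asg 4 (Var 0)) (Seq (asg 5 L_E) (Seq (asg 6 T_E) (Seq (asg 14 G_E) (Seq (asg 7 a_E)
     (Seq (asg 16 Z_E) (Seq (asg 17 N_E) (Seq (asg 8 P_E) (Seq (asg 15 cap_E)
     (Seq sample_program seed_program)))))))))"

lemmas init_defs = L_E_def T_E_def G_E_def a_E_def Z_E_def N_E_def P_E_def cap_E_def code_E_def len_E_def

lemma static_init:
  "static L_E" "static T_E" "static G_E" "static a_E" "static Z_E" "static N_E" "static P_E"
  "static cap_E" "static code_E" "static len_E" "static (Num c)" "static (Bin Mult (Var 18) (Var 20))"
  "static (Bin Add (Bin Mult (Num 2) (Var 9)) (Var 20))"
  by (auto simp: static_def init_defs macro_defs)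

lemma static_var: "x < 40 \<Longrightarrow> static (Var x)" "x < 40 \<Longrightarrow> static (Bin Sub (Var x) (Num 1))"
  by (auto simp: static_def)

end

text \<open>\<open>N\<close>, \<open>P\<close> and \<open>a\<close> are characterized by minimality,
  because this is what the searches of the program return.\<close>

locale sketch_init = sketch_run +
  fixes Z :: nat
  assumes Z_eq: "Z = 12 * T * (n + 1) ^ (L + 2)" and Z_X: "Z \<le> X"
    and N_least: "Z \<le> 2 ^ N" "\<And>k. k < N \<Longrightarrow> 2 ^ k < Z"
    and P_least: "\<And>k. k < P \<Longrightarrow> \<not> (prime k \<and> 2 ^ N \<le> k)"
    and P_le: "P \<le> 2 ^ (4 * N)" and X_N: "2 ^ (4 * N) \<le> X"
    and cap_eq: "cap = 12 * (n div 2 ^ a + 1)"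
    and a_small: "n < 2 ^ W \<Longrightarrow> a = 0"
    and a_large: "2 ^ W \<le> n \<Longrightarrow> n < CA * 2 ^ ((a + 1) * L)"
      "\<And>k. 2 ^ W \<le> n \<Longrightarrow> k < a \<Longrightarrow> CA * 2 ^ ((k + 1) * L) \<le> n"
    and a_n: "a \<le> n"
    and X_CA: "2 ^ W \<le> n \<Longrightarrow> CA * 2 ^ ((a + 1) * L) \<le> X" "2 ^ W \<le> n \<Longrightarrow> (a + 1) * L \<le> X" "2 ^ a \<le> X"
begin

lemma Z12: "12 \<le> Z"
proof -
  have "1 \<le> (n + 1) ^ (L + 2)" by (rule one_le_power) simp
  then have "12 * 1 * 1 \<le> 12 * T * (n + 1) ^ (L + 2)" by (intro mult_le_mono T1 le_refl)
  then show ?thesis by (simp add: Z_eq)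
qed

lemma N2: "2 \<le> N"
proof (rule ccontr)
  assume "\<not> 2 \<le> N"
  then have "(2::nat) ^ N \<le> 2 ^ 1" by (intro power_increasing) auto
  then show False using N_least(1) Z12 by simp
qed

lemma N_Z: "N \<le> Z"
proof (rule ccontr)
  assume "\<not> N \<le> Z"
  then have "2 ^ Z < Z" by (intro N_least(2)) simp
  then show False using less_exp[of Z] by simp
qed

lemma N4_X: "4 * N \<le> X"
  using X_N less_exp[of "4 * N"] by linarith

lemma pow2N_X: "2 ^ N \<le> X"
  using X_N power_increasing[of N "4 * N" "2::nat"] by linarith

lemma power2_B: "k \<le> N \<Longrightarrow> 2 ^ k \<le> B"
  using power_increasing[of k N "2::nat"] pow2N_X by (intro le_B1) linarith

lemma n_B: "n \<le> B" "n + 1 \<le> B"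
  using n_X le_B1[OF n_X] by auto

lemma computes_largeE':
  assumes "M 4 = n" "2 ^ W \<le> n \<Longrightarrow> computes B d M u" "n < 2 ^ W \<Longrightarrow> computes B e M v"
  shows "computes B (largeE d e) M (if 2 ^ W \<le> n then u else v)"
  unfolding largeE_def using assms le_B1[OF X_W] n_B
  by (intro computes_IfLe computes_Num computes_Var) auto

lemma computes_L_E: "M 4 = n \<Longrightarrow> computes B L_E M L"
  unfolding L_E_def L_eq min_def
  by (intro computes_largeE' computes_IfLe computes_Num computes_Var)
    (use n_B X_LB X_L L_eq in \<open>auto intro!: le_B1\<close>)

lemma computes_T_E: "M 4 = n \<Longrightarrow> computes B T_E M T"
  unfolding T_E_def T_eq
  by (intro computes_largeE' computes_Num) (use X_T T_eq in \<open>auto intro!: le_B1\<close>)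

lemma computes_G_E: "M 4 = n \<Longrightarrow> computes B G_E M G"
  unfolding G_E_def G_eq
  by (intro computes_largeE' computes_Num) (use X_G G_eq in \<open>auto intro!: le_B1\<close>)

lemma computes_a_E:
  assumes "M 4 = n" "M 5 = L"
  shows "computes B a_E M a"
proof -
  have "computes B a_E M (if 2 ^ W \<le> n then a else 0)"
    unfolding a_E_def
  proof (rule computes_largeE'[of M, OF assms(1)])
    show "computes B (Num 0) M 0" by (rule computes_Num) simp
    assume large: "2 ^ W \<le> n"
    let ?stop = "\<lambda>k. n < CA * 2 ^ ((k + 1) * L)"
    show "computes B (Rec 30 31 (Var 4) (Num 0)
       (IfLe (Bin Mult (Num CA) (PowE 32 33 (Num 2) (Bin Mult (Bin Add (Var 31) (Num 1)) (Var 5)))) (Var 4)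
       (Bin Add (Var 31) (Num 1)) (Var 31))) M a"
    proof (rule computes_search[where stop = ?stop])
      show "computes B (Var 4) M n" using assms n_B by (intro computes_Var) auto
      show "n < CA * 2 ^ ((a + 1) * L)" using a_large(1) large .
      show "\<not> n < CA * 2 ^ ((k + 1) * L)" if "k < a" for k using a_large(2)[OF large that] by simp
      show "a \<le> n" by (rule a_n)
      fix j k assume k: "k \<le> a"
      let ?M = "M(30 := j, 31 := k)"
      have kL: "(k + 1) * L \<le> (a + 1) * L" using k by (intro mult_le_mono1) simp
      then have pw: "(2::nat) ^ ((k + 1) * L) \<le> 2 ^ ((a + 1) * L)" by (intro power_increasing) auto
      then have cp: "CA * 2 ^ ((k + 1) * L) \<le> B"
        using X_CA(1)[OF large] mult_le_mono2[OF pw, of CA] by (intro le_B1) linarith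
      have CA: "0 < CA" using a_large(1)[OF large] by (cases CA) auto
      then have "2 ^ ((k + 1) * L) \<le> CA * 2 ^ ((k + 1) * L)" by simp
      then have pB: "2 ^ ((k + 1) * L) \<le> B" using cp by linarith
      have "CA * 1 \<le> CA * 2 ^ ((k + 1) * L)" by (intro mult_le_mono2) simp
      then have CB: "CA \<le> B" using cp by linarith
      have kB: "k \<le> B" "k + 1 \<le> B" using k a_n n_X by (auto intro!: le_B1)
      have LB: "L \<le> B" using X_L by (intro le_B1) simp
      have eB: "(k + 1) * L \<le> B" using kL X_CA(2)[OF large] by (intro le_B1) linarith
      have "computes B (IfLe (Bin Mult (Num CA) (PowE 32 33 (Num 2) (Bin Mult (Bin Add (Var 31) (Num 1)) (Var 5)))) (Var 4)
         (Bin Add (Var 31) (Num 1)) (Var 31)) ?M (if CA * 2 ^ ((k + 1) * L) \<le> n then k + 1 else k)"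
        by (intro computes_IfLe computes_Mult computes_PowE computes_Add computes_Num computes_Var)
          (use assms n_B cp pB CB kB LB eB one_le_B in auto)
      then show "computes B (IfLe (Bin Mult (Num CA) (PowE 32 33 (Num 2) (Bin Mult (Bin Add (Var 31) (Num 1)) (Var 5)))) (Var 4)
         (Bin Add (Var 31) (Num 1)) (Var 31)) ?M (if n < CA * 2 ^ ((k + 1) * L) then k else Suc k)"
        by (rule computes_eq) auto
    qed
  qed
  then show ?thesis using a_small by (auto split: if_splits)
qed

lemma computes_Z_E:
  assumes "M 4 = n" "M 5 = L" "M 6 = T"
  shows "computes B Z_E M Z"
  unfolding Z_E_def Z_eq
proof (intro computes_Mult computes_PowE computes_Add computes_Num computes_Var)
  show "12 * T * (n + 1) ^ (L + 2) \<le> B" using Z_X Z_eq by (intro le_B1) simp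
  have "(n + 1) ^ (L + 2) \<le> Z" "12 * T \<le> Z" unfolding Z_eq using T1 by (auto simp del: power_Suc)
  then show "(n + 1) ^ (L + 2) \<le> B" "12 * T \<le> B" using Z_X le_B1 by (meson order_trans)+
  show "12 \<le> B" using Z12 Z_X by (intro le_B1) simp
qed (use assms n_B X_L X_T one_le_B in \<open>auto intro!: le_B1\<close>)

lemma computes_N_E:
  assumes "M 16 = Z"
  shows "computes B N_E M N"
  unfolding N_E_def
proof (rule computes_search[where stop = "\<lambda>k. Z \<le> 2 ^ k"])
  show "computes B (Var 16) M Z" using assms le_B1[OF Z_X] by (intro computes_Var) auto
  show "Z \<le> 2 ^ N" "N \<le> Z" by (rule N_least N_Z)+
  show "\<not> Z \<le> 2 ^ k" if "k < N" for k using N_least(2)[OF that] by simp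
  fix j k assume k: "k \<le> N"
  have kB: "k + 1 \<le> B" using k N4_X N2 by (intro le_B1) simp
  show "computes B (IfLe (Var 16) (PowE 32 33 (Num 2) (Var 31)) (Var 31) (Bin Add (Var 31) (Num 1)))
     (M(30 := j, 31 := k)) (if Z \<le> 2 ^ k then k else Suc k)"
    unfolding Suc_eq_plus1
    by (intro computes_IfLe computes_PowE computes_Add computes_Num computes_Var)
      (use assms le_B1[OF Z_X] kB power2_B[OF k] one_le_B in auto)
qed

definition divisor_count :: "nat \<Rightarrow> nat" where
  "divisor_count k = (\<Sum>d<k. if 2 \<le> d then if k mod d \<noteq> 0 then 0 else 1 else 0)"

lemma divisor_count_eq_0: "2 \<le> k \<Longrightarrow> divisor_count k = 0 \<longleftrightarrow> prime k"
  unfolding divisor_count_def prime_nat_iff' by (auto simp: mod_eq_0_iff_dvd)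

lemma computes_P_E:
  assumes "M 17 = N"
  shows "computes B P_E M P"
  unfolding P_E_def
proof (rule computes_search[where stop = "\<lambda>k. 2 ^ N \<le> k \<and> divisor_count k = 0"])
  have four: "(4::nat) \<le> B" using X_ge by (intro le_B1) simp
  show "computes B (PowE 32 33 (Num 2) (Bin Mult (Num 4) (Var 17))) M (2 ^ (4 * N))"
    by (intro computes_PowE computes_Mult computes_Num computes_Var)
      (use assms le_B1[OF X_N] le_B1[OF N4_X] one_le_B four in auto)
  have two: "(2::nat) \<le> 2 ^ N" using power_increasing[of 1 N "2::nat"] N2 by simp
  show "2 ^ N \<le> P \<and> divisor_count P = 0" using P_ge P_prime divisor_count_eq_0[OF P2] by simp
  show "\<not> (2 ^ N \<le> k \<and> divisor_count k = 0)" if "k < P" for k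
    using P_least[OF that] divisor_count_eq_0[of k] two by auto
  show "P \<le> 2 ^ (4 * N)" by (rule P_le)
  fix j k assume k: "k \<le> P"
  let ?M = "M(30 := j, 31 := k)"
  have kB: "k \<le> B" "k + 1 \<le> B"
  proof -
    have "k + 1 \<le> X * 2" using k P_X X_ge by simp
    then show "k + 1 \<le> B" using le_B2[of X 2] X_ge by simp
    then show "k \<le> B" by simp
  qed
  have "divisor_count k \<le> (\<Sum>d<k. 1)" unfolding divisor_count_def by (intro sum_mono) auto
  then have dk: "divisor_count k \<le> B" using kB by simp
  have cnt: "computes B (SumE 32 33 (Var 31) (IfLe (Num 2) (Var 32) (Ite (Bin Mod (Var 31) (Var 32)) (Num 0) (Num 1)) (Num 0))) ?M
      (divisor_count k)"
    unfolding divisor_count_def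
  proof (rule computes_SumE)
    show "computes B (Var 31) ?M k" using kB by (intro computes_Var) auto
    show "(\<Sum>d<k. if 2 \<le> d then if k mod d \<noteq> 0 then 0 else 1 else 0) \<le> B"
      using dk by (simp add: divisor_count_def)
    fix d s assume "d < k"
    then show "computes B (IfLe (Num 2) (Var 32) (Ite (Bin Mod (Var 31) (Var 32)) (Num 0) (Num 1)) (Num 0))
       (?M(32 := d, 33 := s)) (if 2 \<le> d then if k mod d \<noteq> 0 then 0 else 1 else 0)"
      using kB one_le_B by (intro computes_IfLe computes_Ite computes_Mod computes_Num computes_Var) auto
  qed
  have "computes B (IfLe (PowE 32 33 (Num 2) (Var 17)) (Var 31)
       (Ite (SumE 32 33 (Var 31) (IfLe (Num 2) (Var 32) (Ite (Bin Mod (Var 31) (Var 32)) (Num 0) (Num 1)) (Num 0)))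
         (Bin Add (Var 31) (Num 1)) (Var 31))
       (Bin Add (Var 31) (Num 1))) ?M
     (if 2 ^ N \<le> k then if divisor_count k \<noteq> 0 then k + 1 else k else k + 1)"
    by (intro computes_IfLe computes_Ite cnt computes_PowE computes_Add computes_Num computes_Var)
      (use assms kB one_le_B le_B1[OF pow2N_X] N4_X in \<open>auto intro: le_B1\<close>)
  then show "computes B (IfLe (PowE 32 33 (Num 2) (Var 17)) (Var 31)
       (Ite (SumE 32 33 (Var 31) (IfLe (Num 2) (Var 32) (Ite (Bin Mod (Var 31) (Var 32)) (Num 0) (Num 1)) (Num 0)))
         (Bin Add (Var 31) (Num 1)) (Var 31))
       (Bin Add (Var 31) (Num 1))) ?M
     (if 2 ^ N \<le> k \<and> divisor_count k = 0 then k else Suc k)"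
    by (rule computes_eq) auto
qed

lemma computes_cap_E:
  assumes "M 4 = n" "M 7 = a"
  shows "computes B cap_E M cap"
  unfolding cap_E_def cap_eq
proof (intro computes_Mult computes_PowE computes_Add computes_Div computes_Num computes_Var)
  show "12 * (n div 2 ^ a + 1) \<le> B" using X_cap cap_eq by (intro le_B1) simp
  then show "n div 2 ^ a + 1 \<le> B" by simp
  show "12 \<le> B" using Z12 Z_X by (intro le_B1) simp
qed (use assms n_B X_a(1) X_CA(3) one_le_B in \<open>auto intro!: le_B1\<close>)

lemma run_dec:
  assumes "ready B M" "x < 30" "M x = Suc k"
  shows "run B (dec_program x) M (return_pmf (M(x := k)))"
  unfolding dec_program_def
proof (intro run_asg static_var assms)
  have "M x \<le> B" using assms(1) by (auto simp: ready_def bounded_memory_def)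
  then have "computes B (Bin Sub (Var x) (Num 1)) M (Suc k - 1)"
    using assms one_le_B by (intro computes_Sub computes_Var computes_Num) auto
  then show "computes B (Bin Sub (Var x) (Num 1)) M k" by simp
qed (use assms in auto)

lemma run_Flip:
  assumes "ready B M" "x < 30"
  shows "run B (Flip x) M (map_pmf (\<lambda>b. M(x := of_bool b)) (pmf_of_set UNIV))"
  using assms by (intro runs_Flip) (auto simp: ready_def)

lemma run_Const:
  assumes "ready B M" "x < 30" "c \<le> B"
  shows "run B (Const x c) M (return_pmf (M(x := c)))"
  using assms by (intro runs_Const) (auto simp: ready_def)

lemma run_coin_program:
  assumes M: "ready B M" "M 7 = a" "M 20 = 0"
  shows "run B coin_program M (map_pmf (\<lambda>b. M(18 := of_bool b, 19 := 0)) (bernoulli_pmf (1 / 2 ^ a)))"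
proof -
  define mm where "mm b k = M(18 := of_bool b, 19 := k)" for b k
  let ?body = "Seq (Flip 20) (Seq (asg 18 (Bin Mult (Var 18) (Var 20))) (Seq (Const 20 0) (dec_program 19)))"
  let ?D = "\<lambda>(_::nat) b. map_pmf (\<lambda>c. b \<and> c) (pmf_of_set (UNIV :: bool set))"
  have aB: "a \<le> B" by (rule le_B1[OF X_a(1)])
  have rmm: "ready B (mm b k)" if "k \<le> a" for b k
    unfolding mm_def using M(1) one_le_B that aB by (intro ready_upd) auto
  have body: "run B ?body (mm b (Suc k)) (map_pmf (\<lambda>b'. mm b' k) (?D k b))" if k: "Suc k \<le> a" for b k
  proof -
    have "run B ?body (mm b (Suc k)) (bind_pmf (pmf_of_set UNIV) (\<lambda>c. return_pmf (mm (b \<and> c) k)))"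
    proof (rule runs_Seq_map[OF run_Flip])
      show r: "ready B (mm b (Suc k))" by (rule rmm[OF k])
      fix c :: bool
      let ?M1 = "(mm b (Suc k))(20 := of_bool c)"
      let ?M2 = "?M1(18 := of_bool (b \<and> c))"
      let ?M3 = "?M2(20 := 0)"
      have r1: "ready B ?M1" using one_le_B by (intro ready_upd[OF r]) auto
      have r2: "ready B ?M2" using one_le_B by (intro ready_upd[OF r1]) auto
      have r3: "ready B ?M3" by (intro ready_upd[OF r2]) auto
      have "computes B (Bin Mult (Var 18) (Var 20)) ?M1 (of_bool b * of_bool c)"
        using one_le_B by (intro computes_Mult computes_Var) (auto simp: mm_def)
      then have "computes B (Bin Mult (Var 18) (Var 20)) ?M1 (of_bool (b \<and> c))"
        by (rule computes_eq) auto
      then have 1: "run B (asg 18 (Bin Mult (Var 18) (Var 20))) ?M1 (return_pmf ?M2)"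
        by (intro run_asg static_init r1) simp_all
      have 2: "run B (Const 20 0) ?M2 (return_pmf ?M3)" by (intro run_Const r2) auto
      have 3: "run B (dec_program 19) ?M3 (return_pmf (?M3(19 := k)))"
        by (intro run_dec r3) (auto simp: mm_def)
      have eq: "?M3(19 := k) = mm (b \<and> c) k" using M(3) by (auto simp: mm_def fun_eq_iff)
      show "run B (Seq (asg 18 (Bin Mult (Var 18) (Var 20))) (Seq (Const 20 0) (dec_program 19))) ?M1
          (return_pmf (mm (b \<and> c) k))"
        by (rule runs_Seq_det[OF 1 runs_Seq_det[OF 2 3[unfolded eq]]])
    qed simp
    then show ?thesis by (simp add: map_pmf_def bind_assoc_pmf bind_return_pmf)
  qed
  have "run B (While 19 ?body) (mm True a) (map_pmf (\<lambda>b'. mm b' 0) (iter_pmf ?D a True))"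
  proof (rule runs_counter_loop[where I = "\<lambda>k _. k \<le> a" and mm = mm])
    show "run B ?body (mm b (Suc k)) (map_pmf (\<lambda>b'. mm b' k) (?D k b))" if "Suc k \<le> a" for b k
      by (rule body[OF that])
  qed (simp_all add: mm_def)
  then have loop: "run B (While 19 ?body) (mm True a) (map_pmf (\<lambda>b'. mm b' 0) (bernoulli_pmf (1 / 2 ^ a)))"
    by (simp only: iter_and_coins)
  have 1: "run B (asg 18 (Num 1)) M (return_pmf (M(18 := 1)))"
    using one_le_B M by (intro run_asg static_init computes_Num) auto
  have 2: "run B (asg 19 (Var 7)) (M(18 := 1)) (return_pmf (mm True a))"
  proof -
    have "computes B (Var 7) (M(18 := 1)) a" using M aB by (intro computes_Var) auto
    then have "run B (asg 19 (Var 7)) (M(18 := 1)) (return_pmf (M(18 := 1, 19 := a)))"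
      using one_le_B by (intro run_asg static_var ready_upd[OF M(1)]) simp_all
    then show ?thesis by (simp add: mm_def)
  qed
  show ?thesis
    unfolding coin_program_def using runs_Seq_det[OF 1 runs_Seq_det[OF 2 loop]] by (simp add: mm_def)
qed

definition init_memory :: memory where
  "init_memory = (\<lambda>_. 0)(0 := n, 4 := n, 5 := L, 6 := T, 14 := G, 7 := a, 16 := Z, 17 := N, 8 := P, 15 := cap)"

lemma ready_init: "ready B init_memory"
proof -
  have "ready B (\<lambda>_. 0)" using one_le_B by (auto simp: ready_def bounded_memory_def clear_def)
  moreover have "N \<le> X" using N4_X by simp
  moreover have "L \<le> X" using X_L by simp
  ultimately show ?thesis
    unfolding init_memory_def
    by (intro ready_upd) (auto intro!: le_B1 simp: n_B X_T X_G X_a Z_X P_X X_cap)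
qed

text \<open>The abstract state is the full sample \<open>l\<close>, while the memory keeps at most
  its first \<open>cap\<close> entries. An overflow thus does not disturb the run; it is one of the
  unlikely events in the analysis.\<close>

definition sample_memory :: "nat list \<Rightarrow> nat \<Rightarrow> memory" where
  "sample_memory l k = init_memory(10 := list_code (take cap l), 11 := length (take cap l), 21 := k)"

lemma take_subset: "set l \<subseteq> {1..n} \<Longrightarrow> set (take cap l) \<subseteq> {1..n}"
  by (meson set_take_subset subset_trans)

lemma ready_sample:
  assumes "set l \<subseteq> {1..n}" "k \<le> n"
  shows "ready B (sample_memory l k)"
proof -
  have "list_code (take cap l) \<le> B" using list_code_le[OF take_subset[OF assms(1)]] by (intro le_B1) simp
  moreover have "length (take cap l) \<le> B" using X_cap(1) by (intro le_B1) simp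
  moreover have "k \<le> B" using assms(2) n_B(1) by simp
  ultimately show ?thesis
    unfolding sample_memory_def by (intro ready_upd ready_init) simp_all
qed

lemma list_code_append:
  "list_code (l @ [v]) = list_code l + v * (n + 1) ^ length l"
proof -
  have "digits_num (n + 1) ((!) (l @ [v])) (length l) = digits_num (n + 1) ((!) l) (length l)"
    by (rule digits_num_cong) (simp add: nth_append)
  then show ?thesis by (simp add: list_code_def)
qed

lemma run_sample_body:
  assumes l: "set l \<subseteq> {1..n}" and k: "Suc k \<le> n"
  shows "run B (Seq coin_program (Seq (asg 10 code_E) (Seq (asg 11 len_E) (Seq (asg 18 (Num 0)) (dec_program 21)))))
    (sample_memory l (Suc k))
    (map_pmf (\<lambda>l'. sample_memory l' k)
      (map_pmf (\<lambda>b. if b then l @ [n - k] else l) (bernoulli_pmf (1 / 2 ^ a))))"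
proof -
  let ?M = "sample_memory l (Suc k)"
  let ?t = "take cap l"
  have r: "ready B ?M" by (rule ready_sample[OF l k])
  have "run B (Seq coin_program (Seq (asg 10 code_E) (Seq (asg 11 len_E) (Seq (asg 18 (Num 0)) (dec_program 21))))) ?M
    (bind_pmf (bernoulli_pmf (1 / 2 ^ a)) (\<lambda>b. return_pmf (sample_memory (if b then l @ [n - k] else l) k)))"
  proof (rule runs_Seq_map[OF run_coin_program[OF r]])
    show "?M 7 = a" "?M 20 = 0" by (simp_all add: sample_memory_def init_memory_def)
    fix b
    define l' where "l' = (if b then l @ [n - k] else l)"
    let ?M0 = "?M(18 := of_bool b, 19 := 0)"
    let ?M1 = "?M0(10 := list_code (take cap l'))"
    let ?M2 = "?M1(11 := length (take cap l'))"
    let ?M3 = "?M2(18 := 0)"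
    have l': "set l' \<subseteq> {1..n}" using l k by (auto simp: l'_def)
    have tk: "take cap l' = (if b \<and> \<not> cap \<le> length ?t then ?t @ [n - k] else ?t)"
      by (auto simp: l'_def)
    have code: "list_code (take cap l') = (if b then if cap \<le> length ?t then list_code ?t
        else list_code ?t + (n - k) * (n + 1) ^ length ?t else list_code ?t)"
      unfolding tk by (auto simp: list_code_append)
    have len: "length (take cap l') = (if b then if cap \<le> length ?t then length ?t
        else length ?t + 1 else length ?t)"
      unfolding tk by auto
    have cB: "list_code (take cap l') \<le> B" using list_code_le[OF take_subset[OF l']] by (intro le_B1) simp
    have lB: "length (take cap l') \<le> B" using X_cap by (intro le_B1) simp
    have r0: "ready B ?M0" using one_le_B by (intro ready_upd r) auto
    have r1: "ready B ?M1" using cB by (intro ready_upd[OF r0]) auto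
    have r2: "ready B ?M2" using lB by (intro ready_upd[OF r1]) auto
    have r3: "ready B ?M3" by (intro ready_upd[OF r2]) auto
    have look: "?M0 18 = of_bool b" "?M0 15 = cap" "?M0 11 = length ?t" "?M0 10 = list_code ?t"
      "?M0 4 = n" "?M0 21 = Suc k"
      by (simp_all add: sample_memory_def init_memory_def)
    have "list_code ?t \<le> X" using list_code_le[OF take_subset[OF l]] by simp
    then have small: "cap \<le> B" "length ?t \<le> B" "list_code ?t \<le> B" "Suc k \<le> B"
      using X_cap k n_B by (auto intro!: le_B1)
    have "computes B code_E ?M0 (if of_bool b \<noteq> (0::nat) then if cap \<le> length ?t then list_code ?t
        else list_code ?t + (n + 1 - Suc k) * (n + 1) ^ length ?t else list_code ?t)"
      unfolding code_E_def
    proof (intro computes_Ite computes_IfLe)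
      assume a: "of_bool b \<noteq> (0::nat)" "length ?t < cap"
      have nk: "n + 1 - Suc k = n - k" by simp
      have sm: "list_code ?t + (n - k) * (n + 1) ^ length ?t \<le> B" using cB a unfolding code by (simp split: if_splits)
      then have sm2: "(n - k) * (n + 1) ^ length ?t \<le> B" by simp
      have "(n + 1) ^ length ?t \<le> (n - k) * (n + 1) ^ length ?t" using k by simp
      then have sm3: "(n + 1) ^ length ?t \<le> B" using sm2 by linarith
      show "computes B (Bin Add (Var 10) (Bin Mult (Bin Sub (Bin Add (Var 4) (Num 1)) (Var 21))
          (PowE 32 33 (Bin Add (Var 4) (Num 1)) (Var 11)))) ?M0 (list_code ?t + (n + 1 - Suc k) * (n + 1) ^ length ?t)"
        by (intro computes_Add computes_Mult computes_Sub computes_PowE computes_Num computes_Var)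
          (use look small n_B one_le_B sm sm2 sm3 in \<open>auto simp: nk\<close>)
    qed (use look small one_le_B in \<open>auto intro!: computes_Var\<close>)
    then have cc: "computes B code_E ?M0 (list_code (take cap l'))"
      by (rule computes_eq) (auto simp: code)
    have s1: "run B (asg 10 code_E) ?M0 (return_pmf ?M1)"
      by (intro run_asg static_init cc r0) simp
    have "computes B len_E ?M1 (if of_bool b \<noteq> (0::nat) then if cap \<le> length ?t then length ?t
        else length ?t + 1 else length ?t)"
      unfolding len_E_def
      by (intro computes_Ite computes_IfLe computes_Add computes_Var computes_Num)
        (use look small one_le_B in auto)
    then have lc: "computes B len_E ?M1 (length (take cap l'))"
      by (rule computes_eq) (unfold len, cases b, simp_all)
    have s2: "run B (asg 11 len_E) ?M1 (return_pmf ?M2)"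
      by (intro run_asg static_init lc r1) simp
    have s3: "run B (asg 18 (Num 0)) ?M2 (return_pmf ?M3)"
      by (intro run_asg static_init computes_Num r2) simp_all
    have s4: "run B (dec_program 21) ?M3 (return_pmf (?M3(21 := k)))"
      by (intro run_dec r3) (auto simp: sample_memory_def)
    have eq: "?M3(21 := k) = sample_memory l' k"
      by (auto simp: sample_memory_def init_memory_def fun_eq_iff)
    show "run B (Seq (asg 10 code_E) (Seq (asg 11 len_E) (Seq (asg 18 (Num 0)) (dec_program 21)))) ?M0
        (return_pmf (sample_memory (if b then l @ [n - k] else l) k))"
      using runs_Seq_det[OF s1 runs_Seq_det[OF s2 runs_Seq_det[OF s3 s4[unfolded eq]]]]
      by (simp only: l'_def)
  qed
  then show ?thesis by (simp add: map_pmf_def bind_assoc_pmf bind_return_pmf)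
qed

text \<open>The loop counts down, whereas \<open>sample_list\<close> recurses on the number of
  vertices already treated. The statement splits the sampling into the first \<open>n - k\<close>
  vertices and the \<open>k\<close> vertices that the loop still has to visit.\<close>

lemma sample_list_iter:
  assumes "k \<le> n"
  shows "bind_pmf (sample_list p (n - k))
      (iter_pmf (\<lambda>k l. map_pmf (\<lambda>b. if b then l @ [n - k] else l) (bernoulli_pmf p)) k) = sample_list p n"
  using assms
proof (induction k)
  case 0
  then show ?case by (simp add: bind_return_pmf')
next
  case (Suc k)
  have e: "n - k = Suc (n - Suc k)" using Suc.prems by simp
  have "bind_pmf (sample_list p (n - Suc k)) (\<lambda>l. map_pmf (\<lambda>b. if b then l @ [n - k] else l) (bernoulli_pmf p))
      = sample_list p (n - k)"
    unfolding e by simp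
  then show ?case using Suc by (simp add: bind_assoc_pmf[symmetric])
qed

lemma run_sample_program:
  "run B sample_program init_memory
    (map_pmf (\<lambda>l. sample_memory l 0) (sample_list (1 / 2 ^ a) n))"
proof -
  let ?D = "\<lambda>k l. map_pmf (\<lambda>b. if b then l @ [n - k] else l) (bernoulli_pmf (1 / 2 ^ a))"
  let ?body = "Seq coin_program (Seq (asg 10 code_E) (Seq (asg 11 len_E) (Seq (asg 18 (Num 0)) (dec_program 21))))"
  have loop: "run B (While 21 ?body) (sample_memory [] n) (map_pmf (\<lambda>l. sample_memory l 0) (iter_pmf ?D n []))"
  proof (rule runs_counter_loop[where I = "\<lambda>k l. k \<le> n \<and> set l \<subseteq> {1..n}"])
    fix k and l :: "nat list" assume I: "Suc k \<le> n \<and> set l \<subseteq> {1..n}"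
    then show "run B ?body (sample_memory l (Suc k)) (map_pmf (\<lambda>l'. sample_memory l' k) (?D k l))"
      using run_sample_body by blast
    show "k \<le> n \<and> set l' \<subseteq> {1..n}" if "l' \<in> set_pmf (?D k l)" for l'
    proof -
      have "set l' \<subseteq> insert (n - k) (set l)" using that by (auto split: if_splits)
      then show ?thesis using I by auto
    qed
  qed (auto simp: sample_memory_def)
  have it: "iter_pmf ?D n [] = sample_list (1 / 2 ^ a) n"
    using sample_list_iter[of n "1 / 2 ^ a"] by (simp add: bind_return_pmf)
  have st: "run B (asg 21 (Var 4)) init_memory (return_pmf (sample_memory [] n))"
  proof -
    have "computes B (Var 4) init_memory n" using n_B by (intro computes_Var) (auto simp: init_memory_def)
    then have "run B (asg 21 (Var 4)) init_memory (return_pmf (init_memory(21 := n)))"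
      by (intro run_asg static_var ready_init) auto
    moreover have "init_memory(21 := n) = sample_memory [] n"
      by (auto simp: sample_memory_def init_memory_def list_code_def fun_eq_iff)
    ultimately show ?thesis by simp
  qed
  show ?thesis
    unfolding sample_program_def by (rule runs_Seq_det[OF st loop[unfolded it]])
qed

definition start_memory :: "nat list \<Rightarrow> nat \<Rightarrow> memory" where
  "start_memory l r = init_memory(10 := list_code (take cap l), 11 := length (take cap l), 9 := r)"

lemma run_seed_program:
  assumes l: "set l \<subseteq> {1..n}"
  shows "run B seed_program (sample_memory l 0)
    (map_pmf (start_memory l) (pmf_of_set {..<2 ^ N}))"
proof -
  let ?M = "sample_memory l 0"
  define mm where "mm r k = ?M(9 := r, 19 := k)" for r k
  let ?body = "Seq (Flip 20) (Seq (asg 9 (Bin Add (Bin Mult (Num 2) (Var 9)) (Var 20)))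
       (Seq (Const 20 0) (dec_program 19)))"
  let ?D = "\<lambda>(_::nat) r. map_pmf (\<lambda>b. 2 * r + of_bool b) (pmf_of_set (UNIV :: bool set))"
  \<comment> \<open>With \<open>k\<close> bits to come, \<open>r\<close> consists of the first
    \<open>N - k\<close> bits.\<close>
  let ?I = "\<lambda>k r. k \<le> N \<and> r < (2::nat) ^ (N - k)"
  have NB: "N \<le> B" using N4_X by (intro le_B1) simp
  have rB: "r \<le> B" if "?I k r" for r k
    using that power2_B[of "N - k"] by simp
  have r0: "ready B ?M" by (rule ready_sample[OF l]) simp
  have rmm: "ready B (mm r k)" if "?I k r" for r k
    unfolding mm_def using r0 that rB[OF that] NB by (intro ready_upd) auto
  have step: "?I k (2 * r + of_bool b)" if "?I (Suc k) r" for k r b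
  proof -
    have "N - k = Suc (N - Suc k)" using that Suc_diff_Suc[of k N] by simp
    then have "2 ^ (N - k) = 2 * (2::nat) ^ (N - Suc k)" by simp
    then show ?thesis using that by auto
  qed
  have body: "run B ?body (mm r (Suc k)) (map_pmf (\<lambda>r'. mm r' k) (?D k r))" if I: "?I (Suc k) r" for r k
  proof -
    have "run B ?body (mm r (Suc k)) (bind_pmf (pmf_of_set UNIV) (\<lambda>b. return_pmf (mm (2 * r + of_bool b) k)))"
    proof (rule runs_Seq_map[OF run_Flip])
      show rr: "ready B (mm r (Suc k))" by (rule rmm[OF I])
      fix b :: bool
      let ?M1 = "(mm r (Suc k))(20 := of_bool b)"
      let ?M2 = "?M1(9 := 2 * r + of_bool b)"
      let ?M3 = "?M2(20 := 0)"
      have nr: "2 * r + of_bool b \<le> B" using rB[OF step[OF I]] .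
      have r1: "ready B ?M1" using one_le_B by (intro ready_upd[OF rr]) auto
      have r2: "ready B ?M2" using nr by (intro ready_upd[OF r1]) auto
      have r3: "ready B ?M3" by (intro ready_upd[OF r2]) auto
      have "computes B (Bin Add (Bin Mult (Num 2) (Var 9)) (Var 20)) ?M1 (2 * r + of_bool b)"
        using one_le_B nr rB[OF I] by (intro computes_Add computes_Mult computes_Num computes_Var) (auto simp: mm_def)
      then have 1: "run B (asg 9 (Bin Add (Bin Mult (Num 2) (Var 9)) (Var 20))) ?M1 (return_pmf ?M2)"
        by (intro run_asg static_init r1) simp_all
      have 2: "run B (Const 20 0) ?M2 (return_pmf ?M3)" by (intro run_Const r2) auto
      have 3: "run B (dec_program 19) ?M3 (return_pmf (?M3(19 := k)))"
        by (intro run_dec r3) (auto simp: mm_def)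
      have eq: "?M3(19 := k) = mm (2 * r + of_bool b) k"
        by (auto simp: mm_def sample_memory_def init_memory_def fun_eq_iff)
      show "run B (Seq (asg 9 (Bin Add (Bin Mult (Num 2) (Var 9)) (Var 20))) (Seq (Const 20 0) (dec_program 19))) ?M1
          (return_pmf (mm (2 * r + of_bool b) k))"
        by (rule runs_Seq_det[OF 1 runs_Seq_det[OF 2 3[unfolded eq]]])
    qed simp
    then show ?thesis by (simp add: map_pmf_def bind_assoc_pmf bind_return_pmf)
  qed
  have "run B (While 19 ?body) (mm 0 N) (map_pmf (\<lambda>r. mm r 0) (iter_pmf ?D N 0))"
  proof (rule runs_counter_loop[where I = ?I and mm = mm])
    show "run B ?body (mm r (Suc k)) (map_pmf (\<lambda>r'. mm r' k) (?D k r))" if "?I (Suc k) r" for r k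
      by (rule body[OF that])
    show "?I k r'" if "?I (Suc k) r" "r' \<in> set_pmf (?D k r)" for k r r'
      using that step by auto
  qed (auto simp: mm_def)
  then have loop: "run B (While 19 ?body) (mm 0 N) (map_pmf (\<lambda>r. mm r 0) (pmf_of_set {..<2 ^ N}))"
    by (simp only: iter_double_coins)
  have "computes B (Var 17) ?M N" using NB by (intro computes_Var) (auto simp: sample_memory_def init_memory_def)
  then have "run B (asg 19 (Var 17)) ?M (return_pmf (?M(19 := N)))"
    by (intro run_asg static_var r0) auto
  moreover have "?M(19 := N) = mm 0 N" by (auto simp: mm_def sample_memory_def init_memory_def fun_eq_iff)
  ultimately have 1: "run B (asg 19 (Var 17)) ?M (return_pmf (mm 0 N))" by simp
  have "mm r 0 = start_memory l r" for r
    by (auto simp: mm_def sample_memory_def start_memory_def init_memory_def fun_eq_iff)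
  then show ?thesis
    unfolding seed_program_def using runs_Seq_det[OF 1 loop] by simp
qed

lemma run_init_program:
  "run B init_program ((\<lambda>_. 0)(0 := n))
    (bind_pmf (sample_list (1 / 2 ^ a) n) (\<lambda>l. map_pmf (start_memory l) (pmf_of_set {..<2 ^ N})))"
proof -
  let ?M0 = "(\<lambda>_. 0)(0 := n)"
  let ?M1 = "?M0(4 := n)" let ?M2 = "?M1(5 := L)" let ?M3 = "?M2(6 := T)" let ?M4 = "?M3(14 := G)"
  let ?M5 = "?M4(7 := a)" let ?M6 = "?M5(16 := Z)" let ?M7 = "?M6(17 := N)" let ?M8 = "?M7(8 := P)"
  have "ready B (\<lambda>_. 0)" using one_le_B by (auto simp: ready_def bounded_memory_def clear_def)
  then have r0: "ready B ?M0" using n_B by (intro ready_upd) auto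
  have r1: "ready B ?M1" using n_B by (intro ready_upd[OF r0]) auto
  have r2: "ready B ?M2" using X_L by (intro ready_upd[OF r1] le_B1) auto
  have r3: "ready B ?M3" using X_T by (intro ready_upd[OF r2] le_B1) auto
  have r4: "ready B ?M4" using X_G by (intro ready_upd[OF r3] le_B1) auto
  have r5: "ready B ?M5" using X_a by (intro ready_upd[OF r4] le_B1) auto
  have r6: "ready B ?M6" using Z_X by (intro ready_upd[OF r5] le_B1) auto
  have r7: "ready B ?M7" using N4_X by (intro ready_upd[OF r6] le_B1) auto
  have r8: "ready B ?M8" using P_X by (intro ready_upd[OF r7] le_B1) auto
  have s1: "run B (asg 4 (Var 0)) ?M0 (return_pmf ?M1)"
    using n_B by (intro run_asg static_var computes_Var r0) auto
  have s2: "run B (asg 5 L_E) ?M1 (return_pmf ?M2)" by (intro run_asg static_init computes_L_E r1) auto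
  have s3: "run B (asg 6 T_E) ?M2 (return_pmf ?M3)" by (intro run_asg static_init computes_T_E r2) auto
  have s4: "run B (asg 14 G_E) ?M3 (return_pmf ?M4)" by (intro run_asg static_init computes_G_E r3) auto
  have s5: "run B (asg 7 a_E) ?M4 (return_pmf ?M5)" by (intro run_asg static_init computes_a_E r4) auto
  have s6: "run B (asg 16 Z_E) ?M5 (return_pmf ?M6)" by (intro run_asg static_init computes_Z_E r5) auto
  have s7: "run B (asg 17 N_E) ?M6 (return_pmf ?M7)" by (intro run_asg static_init computes_N_E r6) auto
  have s8: "run B (asg 8 P_E) ?M7 (return_pmf ?M8)" by (intro run_asg static_init computes_P_E r7) auto
  have s9: "run B (asg 15 cap_E) ?M8 (return_pmf init_memory)"
    unfolding init_memory_def by (intro run_asg static_init computes_cap_E r8) auto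
  have s10: "run B (Seq sample_program seed_program) init_memory
      (bind_pmf (sample_list (1 / 2 ^ a) n) (\<lambda>l. map_pmf (start_memory l) (pmf_of_set {..<2 ^ N})))"
    by (rule runs_Seq_map[OF run_sample_program run_seed_program]) (use set_sample_list in blast)
  show ?thesis
    unfolding init_program_def
    by (rule runs_Seq_det[OF s1 runs_Seq_det[OF s2 runs_Seq_det[OF s3 runs_Seq_det[OF s4 runs_Seq_det[OF s5
      runs_Seq_det[OF s6 runs_Seq_det[OF s7 runs_Seq_det[OF s8 runs_Seq_det[OF s9 s10]]]]]]]]])
qed

end

section \<open>Correctness of a run\<close>

text \<open>After the initialization nothing is random any more, so termination together with a
  property of all outcomes replaces the exact distributions of \<open>runs\<close>.\<close>

definition ensures :: "config spmf \<Rightarrow> (config \<Rightarrow> bool) \<Rightarrow> bool" where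
  "ensures c Q \<longleftrightarrow> (\<exists>D. c = spmf_of_pmf D \<and> (\<forall>s\<in>set_pmf D. Q s))"

lemma ensures_bind:
  assumes "ensures c Q" "\<And>s. Q s \<Longrightarrow> ensures (f s) R"
  shows "ensures (bind_spmf c f) R"
proof -
  obtain D where D: "c = spmf_of_pmf D" "\<And>s. s \<in> set_pmf D \<Longrightarrow> Q s"
    using assms(1) by (auto simp: ensures_def)
  have "\<forall>s\<in>set_pmf D. \<exists>H. f s = spmf_of_pmf H \<and> (\<forall>s'\<in>set_pmf H. R s')"
    using assms(2) D(2) by (auto simp: ensures_def)
  then obtain H where H: "\<And>s. s \<in> set_pmf D \<Longrightarrow> f s = spmf_of_pmf (H s)"
    "\<And>s s'. s \<in> set_pmf D \<Longrightarrow> s' \<in> set_pmf (H s) \<Longrightarrow> R s'"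
    by metis
  have "bind_spmf c f = spmf_of_pmf (bind_pmf D H)"
    by (simp add: D(1) spmf_of_pmf_bind H(1) cong: bind_pmf_cong)
  moreover have "\<forall>s'\<in>set_pmf (bind_pmf D H). R s'" using H(2) by auto
  ultimately show ?thesis unfolding ensures_def by blast
qed

lemma runs_ensures:
  assumes "runs K B p (mem s) (return_pmf M)"
  shows "ensures (exec p s) (\<lambda>s'. mem s' = M \<and> peak s' \<le> max (peak s) (space_bound K B))"
proof -
  obtain D where D: "exec p s = spmf_of_pmf D" "map_pmf mem D = return_pmf M"
    "\<forall>s'\<in>set_pmf D. peak s' \<le> max (peak s) (space_bound K B)"
    using assms unfolding runs_def by blast
  have "mem s' = M" if "s' \<in> set_pmf D" for s'
    using that D(2) by (metis imageI pmf.set_map set_return_pmf singletonD)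
  then show ?thesis using D by (auto simp: ensures_def)
qed

lemma prob_bind_ge:
  assumes "\<And>s. s \<in> set_pmf D \<Longrightarrow> s \<in> S \<Longrightarrow> set_pmf (H s) \<subseteq> E"
  shows "measure_pmf.prob D S \<le> measure_pmf.prob (bind_pmf D H) E"
proof -
  have "emeasure (measure_pmf D) S = (\<integral>\<^sup>+s. indicator S s \<partial>measure_pmf D)" by simp
  also have "\<dots> \<le> (\<integral>\<^sup>+s. emeasure (measure_pmf (H s)) E \<partial>measure_pmf D)"
  proof (rule nn_integral_mono_AE, rule AE_pmfI)
    fix s assume s: "s \<in> set_pmf D"
    show "indicator S s \<le> emeasure (measure_pmf (H s)) E"
    proof (cases "s \<in> S")
      case True
      then have "set_pmf (H s) \<subseteq> E" using assms s by blast
      then have "measure_pmf.prob (H s) E = 1"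
        by (intro measure_pmf.prob_eq_1[THEN iffD2]) (auto simp: AE_measure_pmf_iff)
      then show ?thesis by (simp add: measure_pmf.emeasure_eq_measure indicator_def)
    qed simp
  qed
  also have "\<dots> = emeasure (measure_pmf (bind_pmf D H)) E" by simp
  finally show ?thesis by (simp add: measure_pmf.emeasure_eq_measure)
qed

text \<open>The large components are disjoint and occupy at least \<open>L + 1\<close> vertices
  each.\<close>

lemma card_large_components:
  assumes "edges_on V E" "finite V"
  shows "card {C \<in> components V E. L < card C} \<le> card V div (L + 1)"
proof -
  let ?C = "{C \<in> components V E. L < card C}"
  have fin: "finite (components V E)" using assms(2) by (simp add: components_def)
  have sub: "C \<subseteq> V" if "C \<in> components V E" for C
    using that component_subset[OF assms(1)] unfolding components_def by blast
  have "card ?C * (L + 1) = (\<Sum>C\<in>?C. L + 1)" by simp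
  also have "\<dots> \<le> sum card ?C" by (intro sum_mono) auto
  also have "\<dots> = card (\<Union>?C)"
  proof (rule card_Union_disjoint[symmetric])
    show "pairwise disjnt ?C"
      unfolding pairwise_def disjnt_def components_def using component_disjoint by blast
  qed (use sub assms(2) finite_subset in blast)
  also have "\<dots> \<le> card V" using sub assms(2) by (intro card_mono) auto
  finally show ?thesis by (simp add: less_eq_div_iff_mult_less_eq)
qed

context sketch
begin

text \<open>Adding the zero cell 30 copies the numerator from cell 13.\<close>

definition post_program :: program where
  "post_program = Seq (Arith Add 0 13 30) (Const 1 2)"

definition algorithm :: stream_algorithm where
  "algorithm = Stream_Algorithm init_program step_program post_program"

end

context sketch_init
begin

definition SB :: nat where "SB = space_bound 80 B"

lemma ready_memory_bits: "ready B M \<Longrightarrow> memory_bits M \<le> SB"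
  unfolding SB_def ready_def by (intro memory_bits_le) auto

lemma ready_item:
  assumes "good_graph g" "valid_item n W g x" "ready B M"
  shows "ready B (item_memory x M)"
proof -
  have WB: "W \<le> X" using X_W less_exp[of W] by linarith
  have rd: "ready B (M(0 := op, 1 := u, 2 := v, 3 := w))"
    if "op \<le> 1" "u \<le> n" "v \<le> n" "w \<le> W" for op u v w
    using that assms(3) n_B one_le_B le_B1[OF WB] by (intro ready_upd) auto
  show ?thesis
  proof (cases x)
    case (Insertion u v w)
    then show ?thesis using valid_item_bounds[OF assms(1,2), of u v w] rd[of 1 u v w] by simp
  next
    case (Deletion u v w)
    then show ?thesis using valid_item_bounds[OF assms(1,2), of u v w] rd[of 0 u v w] by simp
  qed
qed

text \<open>Cell 13 is written by the steps only, hence the restriction to nonempty streams; a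
  connected graph on at least two vertices cannot come from an empty one.\<close>

lemma process_ensures:
  assumes "\<And>i. i < length xs \<Longrightarrow> valid_item n W (fold apply_item (take i xs) g) (xs ! i)"
    and "good_graph g" "valid_sample l r" "state g l r (mem s)" "peak s \<le> SB"
  shows "ensures (process_stream step_program xs s) (\<lambda>s'. state (fold apply_item xs g) l r (mem s') \<and>
    peak s' \<le> SB \<and> (xs \<noteq> [] \<longrightarrow> mem s' 13 = numer (fold apply_item xs g) l r))"
  using assms
proof (induction xs arbitrary: g s)
  case Nil
  then show ?case by (auto simp: ensures_def intro!: exI[of _ "return_pmf s"])
next
  case (Cons x xs)
  have vx: "valid_item n W g x" using Cons.prems(1)[of 0] by simp
  let ?g = "apply_item x g"
  have gg: "good_graph ?g" using weighted_graph_on_apply[OF Cons.prems(2) vx] .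
  have mi: "mem (read_item x s) = item_memory x (mem s)" by (cases x) (simp_all add: set_mem_def)
  have pk: "peak (read_item x s) \<le> SB"
  proof -
    have "ready B (item_memory x (mem s))"
      using Cons.prems vx by (intro ready_item) (auto simp: state_def)
    then have "memory_bits (item_memory x (mem s)) \<le> SB" by (rule ready_memory_bits)
    then show ?thesis using Cons.prems(5) by (cases x) (simp_all add: set_mem_def)
  qed
  obtain M' where M': "run B step_program (mem (read_item x s)) (return_pmf M')"
    "state ?g l r M'" "M' 13 = numer ?g l r"
    using run_step[OF Cons.prems(2) vx Cons.prems(3,4)] mi by auto
  have e1: "ensures (exec step_program (read_item x s)) (\<lambda>s'. mem s' = M' \<and> peak s' \<le> SB)"
  proof -
    have "ensures (exec step_program (read_item x s)) (\<lambda>s'. mem s' = M' \<and> peak s' \<le> max (peak (read_item x s)) (space_bound 80 B))"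
      by (rule runs_ensures[OF M'(1)])
    then show ?thesis using pk by (auto simp: ensures_def SB_def)
  qed
  have vt: "valid_item n W (fold apply_item (take i xs) ?g) (xs ! i)" if "i < length xs" for i
    using Cons.prems(1)[of "Suc i"] that by simp
  show ?case
    unfolding process_stream.simps
  proof (rule ensures_bind[OF e1])
    fix s' :: config assume s': "mem s' = M' \<and> peak s' \<le> SB"
    show "ensures (process_stream step_program xs s') (\<lambda>s'. state (fold apply_item (x # xs) g) l r (mem s') \<and>
      peak s' \<le> SB \<and> (x # xs \<noteq> [] \<longrightarrow> mem s' 13 = numer (fold apply_item (x # xs) g) l r))"
    proof (cases "xs = []")
      case True
      then show ?thesis using s' M' by (auto simp: ensures_def intro!: exI[of _ "return_pmf s'"])
    next
      case False
      then show ?thesis using Cons.IH[OF vt gg Cons.prems(3)] s' M'(2) by auto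
    qed
  qed
qed

lemma post_ensures:
  assumes "ready B (mem s)" "peak s \<le> SB"
  shows "ensures (exec post_program (s\<lparr>time := 0\<rparr>)) (\<lambda>s'. peak s' \<le> SB \<and> time s' \<le> SB \<and>
    mem s' 0 = mem s 13 \<and> mem s' 1 = 2)"
proof -
  let ?v = "mem s 13"
  have z: "mem s 30 = 0" using assms(1) clearD by (auto simp: ready_def)
  have vB: "?v \<le> B" using assms(1) by (auto simp: ready_def bounded_memory_def)
  define s1 where "s1 = assign (read_cost 13 (s\<lparr>time := 0\<rparr>) + read_cost 30 (s\<lparr>time := 0\<rparr>)) 0 ?v (s\<lparr>time := 0\<rparr>)"
  define s2 where "s2 = assign 0 1 2 s1"
  have ex: "exec post_program (s\<lparr>time := 0\<rparr>) = return_spmf s2"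
    by (simp add: post_program_def s2_def s1_def z)
  have r1: "ready B ((mem s)(0 := ?v))" using assms(1) vB by (intro ready_upd) auto
  have r2: "ready B ((mem s)(0 := ?v, 1 := 2))" using one_le_B by (intro ready_upd[OF r1]) auto
  have pk: "peak s2 \<le> SB"
    using assms(2) ready_memory_bits[OF r1] ready_memory_bits[OF r2] by (simp add: s2_def s1_def)
  have bts: "bits 0 = 1" "bits 1 = 1" "bits 2 = 2" "bits 13 = 4" "bits 30 = 5" "bits 80 = 7"
    by (simp_all add: bits_def compute_floorlog)
  \<comment> \<open>All addresses are constants; only the copied value has variable length, and it
    is read once and written once.\<close>
  have tm: "time s2 = 14 + 2 * bits ?v"
    by (simp add: s2_def s1_def assign_def set_mem_def charge_def read_cost_def z bts[unfolded One_nat_def] bts)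
  have "bits ?v \<le> bits B" by (rule bits_mono[OF vB])
  then have "time s2 \<le> SB" unfolding tm SB_def space_bound_def by (simp add: bts)
  then have "\<forall>s'\<in>set_pmf (return_pmf s2). peak s' \<le> SB \<and> time s' \<le> SB \<and> mem s' 0 = mem s 13 \<and> mem s' 1 = 2"
    using pk by (simp add: s2_def s1_def)
  then show ?thesis unfolding ensures_def ex by (intro exI[of _ "return_pmf s2"]) simp
qed

lemma state_start:
  assumes "set l \<subseteq> {1..n}" "r < 2 ^ N"
  shows "valid_sample (take cap l) r" "state (\<lambda>_. None) (take cap l) r (start_memory l r)"
proof -
  show vs: "valid_sample (take cap l) r"
    using take_subset[OF assms(1)] assms(2) P_ge by (simp add: valid_sample_def)
  interpret sketch_table W LA LB TB GB CA clB gapB n L T G a P N cap X "length (take cap l)" r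
    "list_code (take cap l)" "table (\<lambda>_. None) (take cap l) r"
    by (rule sketch_tableI[OF vs])
  have t0: "table (\<lambda>_. None) (take cap l) r = 0"
    by (simp add: table_def digits_num_def print_digit_def level_of_def fingerprint_def)
  have "params (start_memory l r)"
    unfolding params_def by (simp add: t0 start_memory_def init_memory_def)
  moreover have "ready B (start_memory l r)"
    unfolding start_memory_def using vs list_code_le[of "take cap l"] X_cap P_X
    by (intro ready_upd ready_init) (auto intro!: le_B1 simp: valid_sample_def)
  ultimately show "state (\<lambda>_. None) (take cap l) r (start_memory l r)"
    by (simp add: state_def)
qed

section \<open>Random seeds and failure probabilities\<close>

definition seeds :: "(nat list \<times> nat) pmf" where
  "seeds = pair_pmf (sample_list (1 / 2 ^ a) n) (pmf_of_set {..<2 ^ N})"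

lemma set_seeds: "(l, r) \<in> set_pmf seeds \<Longrightarrow> set l \<subseteq> {1..n} \<and> distinct l \<and> r < 2 ^ N"
proof -
  assume "(l, r) \<in> set_pmf seeds"
  moreover have "set_pmf (pmf_of_set {..<(2::nat) ^ N}) = {..<2 ^ N}"
    by (rule set_pmf_of_set) (auto simp: lessThan_empty_iff)
  ultimately have "l \<in> set_pmf (sample_list (1 / 2 ^ a) n)" "r < 2 ^ N" by (auto simp: seeds_def)
  then show ?thesis using set_sample_list[of l "1 / 2 ^ a" n] by blast
qed

text \<open>The seeds determine the answer, so the probability of a good result is at least that of
  the seeds whose answer is good.\<close>

lemma run_stream_algorithm:
  assumes xs: "valid_stream n W xs" "xs \<noteq> []"
  defines "g \<equiv> final_graph xs"
  shows "lossless_spmf (run_stream algorithm n xs)"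
    and "\<forall>s\<in>set_spmf (run_stream algorithm n xs). peak s \<le> SB \<and> time s \<le> SB"
    and "measure_pmf.prob seeds {(l, r). Q (real (numer g (take cap l) r) / 2)}
      \<le> measure (measure_spmf (run_stream algorithm n xs)) {s. Q (result s)}"
proof -
  let ?s0 = "start_config n"
  have m0: "mem ?s0 = (\<lambda>_. 0)(0 := n)" by (simp add: start_config_def set_mem_def)
  have "ready B (\<lambda>_. 0)" using one_le_B by (auto simp: ready_def bounded_memory_def clear_def)
  then have "ready B (mem ?s0)" unfolding m0 using n_B by (intro ready_upd) auto
  then have p0: "peak ?s0 \<le> SB"
    using ready_memory_bits by (simp add: start_config_def set_mem_def)
  have init: "bind_pmf (sample_list (1 / 2 ^ a) n) (\<lambda>l. map_pmf (start_memory l) (pmf_of_set {..<2 ^ N}))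
      = map_pmf (\<lambda>(l, r). start_memory l r) seeds"
    by (simp add: seeds_def pair_pmf_def map_pmf_def bind_assoc_pmf bind_return_pmf)
  obtain D where D: "exec init_program ?s0 = spmf_of_pmf D"
    "map_pmf mem D = map_pmf (\<lambda>(l, r). start_memory l r) seeds"
    "\<And>s. s \<in> set_pmf D \<Longrightarrow> peak s \<le> max (peak ?s0) (space_bound 80 B)"
    using run_init_program m0 unfolding runs_def init by blast
  define rest where "rest s = bind_spmf (process_stream step_program xs s)
      (\<lambda>s'. exec post_program (s'\<lparr>time := 0\<rparr>))" for s
  have rest: "ensures (rest s) (\<lambda>s'. peak s' \<le> SB \<and> time s' \<le> SB \<and>
      result s' = real (numer g (take cap l) r) / 2)"
    if s: "s \<in> set_pmf D" "mem s = start_memory l r" "(l, r) \<in> set_pmf seeds" for s l r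
  proof -
    note lr = set_seeds[OF s(3)]
    have vs: "valid_sample (take cap l) r" "state (\<lambda>_. None) (take cap l) r (mem s)"
      using state_start lr s(2) by auto
    have gg: "good_graph (\<lambda>_. None)" by (rule weighted_graph_on_empty)
    have vi: "valid_item n W (fold apply_item (take i xs) (\<lambda>_. None)) (xs ! i)" if "i < length xs" for i
      using xs(1) that by (simp add: valid_stream_def final_graph_def)
    have ps: "peak s \<le> SB" using D(3)[OF s(1)] p0 by (simp add: SB_def)
    have 1: "ensures (process_stream step_program xs s) (\<lambda>s'. state g (take cap l) r (mem s') \<and>
        peak s' \<le> SB \<and> mem s' 13 = numer g (take cap l) r)"
      using process_ensures[OF vi gg vs ps] xs(2) unfolding g_def final_graph_def by simp
    show ?thesis
      unfolding rest_def
    proof (rule ensures_bind[OF 1])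
      fix s' :: config assume s': "state g (take cap l) r (mem s') \<and> peak s' \<le> SB \<and> mem s' 13 = numer g (take cap l) r"
      then have "ensures (exec post_program (s'\<lparr>time := 0\<rparr>)) (\<lambda>s''. peak s'' \<le> SB \<and> time s'' \<le> SB \<and>
          mem s'' 0 = mem s' 13 \<and> mem s'' 1 = 2)"
        by (intro post_ensures) (auto simp: state_def)
      then show "ensures (exec post_program (s'\<lparr>time := 0\<rparr>)) (\<lambda>s'. peak s' \<le> SB \<and> time s' \<le> SB \<and>
          result s' = real (numer g (take cap l) r) / 2)"
        using s' by (auto simp: ensures_def result_def)
    qed
  qed
  have src: "\<exists>l r. mem s = start_memory l r \<and> (l, r) \<in> set_pmf seeds" if "s \<in> set_pmf D" for s
  proof -
    have "mem s \<in> set_pmf (map_pmf mem D)" using that by simp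
    then show ?thesis unfolding D(2) by auto
  qed
  have "\<exists>H. rest s = spmf_of_pmf H \<and> (\<forall>s'\<in>set_pmf H. peak s' \<le> SB \<and> time s' \<le> SB)" if "s \<in> set_pmf D" for s
    using src[OF that] rest[OF that] unfolding ensures_def by blast
  then obtain H where H: "\<And>s. s \<in> set_pmf D \<Longrightarrow> rest s = spmf_of_pmf (H s)"
    "\<And>s s'. s \<in> set_pmf D \<Longrightarrow> s' \<in> set_pmf (H s) \<Longrightarrow> peak s' \<le> SB \<and> time s' \<le> SB"
    by metis
  have run: "run_stream algorithm n xs = spmf_of_pmf (bind_pmf D H)"
  proof -
    have "run_stream algorithm n xs = bind_pmf D rest"
      by (simp add: run_stream_def algorithm_def D(1) rest_def[abs_def])
    then show ?thesis by (simp add: spmf_of_pmf_bind H(1) cong: bind_pmf_cong)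
  qed
  show "lossless_spmf (run_stream algorithm n xs)" unfolding run by simp
  show "\<forall>s\<in>set_spmf (run_stream algorithm n xs). peak s \<le> SB \<and> time s \<le> SB"
    unfolding run using H(2) by auto
  \<comment> \<open>The event is transported through memories, since these are what the
    specification of the initialization speaks about; seeds that agree after truncation share a
    memory.\<close>
  define A where "A = {M. \<exists>l r. M = start_memory l r \<and> (l, r) \<in> set_pmf seeds \<and>
      Q (real (numer g (take cap l) r) / 2)}"
  have "measure_pmf.prob seeds {(l, r). Q (real (numer g (take cap l) r) / 2)} =
      measure_pmf.prob seeds ({(l, r). Q (real (numer g (take cap l) r) / 2)} \<inter> set_pmf seeds)"
    by (rule measure_Int_set_pmf[symmetric])
  also have "\<dots> \<le> measure_pmf.prob seeds ((\<lambda>(l, r). start_memory l r) -` A)"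
    by (intro measure_pmf.finite_measure_mono) (auto simp: A_def)
  also have "\<dots> = measure_pmf.prob (map_pmf mem D) A" unfolding D(2) by simp
  also have "\<dots> = measure_pmf.prob D {s. mem s \<in> A}" by (simp add: vimage_def)
  also have "\<dots> \<le> measure_pmf.prob (bind_pmf D H) {s. Q (result s)}"
  proof (rule prob_bind_ge)
    fix s assume s: "s \<in> set_pmf D" "s \<in> {s. mem s \<in> A}"
    then obtain l r where lr: "mem s = start_memory l r" "(l, r) \<in> set_pmf seeds"
      "Q (real (numer g (take cap l) r) / 2)" by (auto simp: A_def)
    obtain H' where H': "rest s = spmf_of_pmf H'"
      "\<forall>s'\<in>set_pmf H'. result s' = real (numer g (take cap l) r) / 2"
      using rest[OF s(1) lr(1,2)] unfolding ensures_def by blast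
    have "H s = H'" using H(1)[OF s(1)] H'(1) by (metis pmf_eqI spmf_spmf_of_pmf)
    then show "set_pmf (H s) \<subseteq> {s. Q (result s)}" using H'(2) lr(3) by (metis mem_Collect_eq subsetI)
  qed
  also have "\<dots> = measure (measure_spmf (run_stream algorithm n xs)) {s. Q (result s)}"
    unfolding run by simp
  finally show "measure_pmf.prob seeds {(l, r). Q (real (numer g (take cap l) r) / 2)}
      \<le> measure (measure_spmf (run_stream algorithm n xs)) {s. Q (result s)}" .
qed

text \<open>At most \<open>Z / 12\<close> points are bad for some threshold, among
  \<open>2 ^ N \<ge> Z\<close> equally likely ones.\<close>

lemma prob_deceived:
  assumes "good_graph g"
  shows "measure_pmf.prob (pmf_of_set {..<2 ^ N}) {r. \<exists>j<T. deceived n P L (level_of g j) r} \<le> 1 / 12"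
proof -
  let ?S = "{r. \<exists>j<T. deceived n P L (level_of g j) r}"
  have "card {r \<in> {..<2 ^ N}. \<exists>j<T. deceived n P L (level_of g j) r} \<le> T * (n + 1) ^ (L + 2)"
    using good_graph_level[OF assms] P_prime P_ge by (intro card_deceived)
  then have "12 * card ({..<2 ^ N} \<inter> ?S) \<le> Z" by (simp add: Z_eq Int_def)
  also have "\<dots> \<le> 2 ^ N" by (rule N_least)
  finally have "12 * real (card ({..<2 ^ N} \<inter> ?S)) \<le> 2 ^ N"
    by (metis (mono_tags, lifting) of_nat_le_iff of_nat_mult of_nat_numeral of_nat_power)
  then show ?thesis
    by (subst measure_pmf_of_set) (auto simp: lessThan_empty_iff field_simps)
qed

definition small_count :: "wgraph \<Rightarrow> nat \<Rightarrow> nat" where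
  "small_count g j = card {C \<in> components {1..n} (level_of g j). card C \<le> L}"

definition estimate :: "wgraph \<Rightarrow> nat \<Rightarrow> nat list \<Rightarrow> nat" where
  "estimate g j l = (\<Sum>C\<in>{C \<in> components {1..n} (level_of g j). C \<subseteq> set l \<and> card C \<le> L}. 2 ^ (a * card C))"

text \<open>Chebyshev's inequality for each threshold and a union bound over the \<open>T\<close>
  thresholds. The variance is at most \<open>n * (2 ^ (a * L) - 1)\<close>, since there are at most
  \<open>n\<close> components, and those counted have at most \<open>L\<close> vertices.\<close>

lemma prob_estimate:
  assumes g: "good_graph g" and \<eta>: "\<eta> > 0" and dev: "real T * real n * (2 ^ (a * L) - 1) \<le> \<eta>\<^sup>2 / 12"
  shows "measure_pmf.prob (sample_list (1 / 2 ^ a) n)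
    {l. \<exists>j<T. \<eta> \<le> \<bar>real (estimate g j l) - real (small_count g j)\<bar>} \<le> 1 / 12"
proof -
  let ?SL = "sample_list (1 / 2 ^ a) n"
  let ?Bad = "\<lambda>j. {l. \<eta> \<le> \<bar>real (estimate g j l) - real (small_count g j)\<bar>}"
  have one: "measure_pmf.prob ?SL (?Bad j) \<le> real n * (2 ^ (a * L) - 1) / \<eta>\<^sup>2" for j
  proof -
    define \<C> where "\<C> = {C \<in> components {1..n} (level_of g j). card C \<le> L}"
    have e: "edges_on {1..n} (level_of g j)" by (rule good_graph_level[OF g])
    have fin: "finite (components {1..n} (level_of g j))" by (simp add: components_def)
    have dis: "C \<inter> D = {}" if "C \<in> \<C>" "D \<in> \<C>" "C \<noteq> D" for C D
      using that component_disjoint by (auto simp: \<C>_def components_def)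
    have sub: "C \<subseteq> {1..n}" if "C \<in> \<C>" for C
      using that component_subset[OF e] unfolding \<C>_def components_def by blast
    have cL: "card C \<le> L" if "C \<in> \<C>" for C using that by (simp add: \<C>_def)
    have fC: "finite \<C>" using fin by (simp add: \<C>_def)
    have "card \<C> \<le> card (components {1..n} (level_of g j))" using fin by (intro card_mono) (auto simp: \<C>_def)
    also have "\<dots> \<le> n" unfolding components_def using card_image_le[of "{1..n}"] by simp
    finally have cn: "card \<C> \<le> n" .
    have est: "real (estimate g j l) = (\<Sum>C\<in>{C \<in> \<C>. C \<subseteq> set l}. (1 / (1 / 2 ^ a)) ^ card C)" for l
    proof -
      have "{C \<in> components {1..n} (level_of g j). C \<subseteq> set l \<and> card C \<le> L} = {C \<in> \<C>. C \<subseteq> set l}"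
        by (auto simp: \<C>_def)
      then show ?thesis by (simp add: estimate_def power_mult)
    qed
    have "measure_pmf.prob ?SL (?Bad j) \<le> real (card \<C>) * ((1 / (1 / 2 ^ a)) ^ L - 1) / \<eta>\<^sup>2"
      using component_estimator_deviation[of "1 / 2 ^ a" \<C> n L \<eta>, OF _ _ dis sub cL fC \<eta>]
      unfolding est small_count_def \<C>_def[symmetric] by simp
    also have "\<dots> = real (card \<C>) * (2 ^ (a * L) - 1) / \<eta>\<^sup>2" by (simp add: power_mult)
    also have "\<dots> \<le> real n * (2 ^ (a * L) - 1) / \<eta>\<^sup>2"
      using cn by (intro divide_right_mono mult_right_mono) auto
    finally show ?thesis .
  qed
  have "{l. \<exists>j<T. \<eta> \<le> \<bar>real (estimate g j l) - real (small_count g j)\<bar>} = (\<Union>j<T. ?Bad j)" by auto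
  then have "measure_pmf.prob ?SL {l. \<exists>j<T. \<eta> \<le> \<bar>real (estimate g j l) - real (small_count g j)\<bar>}
      \<le> (\<Sum>j<T. measure_pmf.prob ?SL (?Bad j))"
    by (simp only:) (rule measure_pmf.finite_measure_subadditive_finite; simp)
  also have "\<dots> \<le> (\<Sum>j<T. real n * (2 ^ (a * L) - 1) / \<eta>\<^sup>2)" by (intro sum_mono one)
  also have "\<dots> = real T * real n * (2 ^ (a * L) - 1) / \<eta>\<^sup>2" by simp
  also have "\<dots> \<le> (\<eta>\<^sup>2 / 12) / \<eta>\<^sup>2" by (intro divide_right_mono dev) simp
  also have "\<dots> = 1 / 12" using \<eta> by simp
  finally show ?thesis .
qed

lemma prob_sample_length: "measure_pmf.prob (sample_list (1 / 2 ^ a) n) {l. cap \<le> length l} \<le> 1 / 12"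
proof -
  have "real n / 2 ^ a \<le> real (n div 2 ^ a) + 1"
  proof -
    have "n < 2 ^ a * (n div 2 ^ a) + 2 ^ a"
      using mult_div_mod_eq[of "2 ^ a" n] mod_less_divisor[of "2 ^ a" n, OF zero_less_power] by linarith
    then have "real n < real (2 ^ a * (n div 2 ^ a) + 2 ^ a)" by (simp only: of_nat_less_iff)
    then show ?thesis by (simp add: field_simps)
  qed
  moreover have "real cap / 12 = real (n div 2 ^ a) + 1" by (simp add: cap_eq)
  moreover have "1 / 2 ^ a * real n = real n / 2 ^ a" by simp
  ultimately have "1 / 2 ^ a * real n \<le> real cap / 12" by linarith
  then show ?thesis
    using prob_sample_list_too_long[of "1 / 2 ^ a" cap n] cap1 by simp
qed

text \<open>An overlong sample, a bad point and a large deviation have probability at most 1/12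
  each; together this is 1/4, below the permitted 1/3.\<close>

lemma prob_good_seeds:
  assumes g: "good_graph g" and \<eta>: "\<eta> > 0" and dev: "real T * real n * (2 ^ (a * L) - 1) \<le> \<eta>\<^sup>2 / 12"
  shows "2 / 3 \<le> measure_pmf.prob seeds {(l, r). length l \<le> cap \<and> (\<forall>j<T. \<not> deceived n P L (level_of g j) r) \<and>
    (\<forall>j<T. \<bar>real (estimate g j l) - real (small_count g j)\<bar> < \<eta>)}" (is "_ \<le> measure_pmf.prob _ ?Good")
proof -
  let ?SL = "sample_list (1 / 2 ^ a) n" and ?U = "pmf_of_set {..<(2::nat) ^ N}"
  let ?B1 = "{l. cap \<le> length l}" and ?B2 = "{r. \<exists>j<T. deceived n P L (level_of g j) r}"
    and ?B3 = "{l. \<exists>j<T. \<eta> \<le> \<bar>real (estimate g j l) - real (small_count g j)\<bar>}"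
  have "- ?Good \<subseteq> fst -` ?B1 \<union> (snd -` ?B2 \<union> fst -` ?B3)" by (auto simp: not_less)
  then have "measure_pmf.prob seeds (- ?Good) \<le> measure_pmf.prob seeds (fst -` ?B1 \<union> (snd -` ?B2 \<union> fst -` ?B3))"
    by (intro measure_pmf.finite_measure_mono) auto
  also have "\<dots> \<le> measure_pmf.prob seeds (fst -` ?B1) +
      (measure_pmf.prob seeds (snd -` ?B2) + measure_pmf.prob seeds (fst -` ?B3))"
    by (intro order_trans[OF measure_Un_le] add_mono order_refl) auto
  also have "\<dots> = measure_pmf.prob (map_pmf fst seeds) ?B1 +
      (measure_pmf.prob (map_pmf snd seeds) ?B2 + measure_pmf.prob (map_pmf fst seeds) ?B3)"
    by simp
  also have "\<dots> = measure_pmf.prob ?SL ?B1 + (measure_pmf.prob ?U ?B2 + measure_pmf.prob ?SL ?B3)"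
    by (simp only: seeds_def map_fst_pair_pmf map_snd_pair_pmf)
  also have "\<dots> \<le> 1 / 12 + (1 / 12 + 1 / 12)"
    by (intro add_mono prob_sample_length prob_deceived[OF g] prob_estimate[OF g \<eta> dev])
  finally have "measure_pmf.prob seeds (- ?Good) \<le> 1 / 4" by simp
  moreover have "measure_pmf.prob seeds (- ?Good) = 1 - measure_pmf.prob seeds ?Good"
    using measure_pmf.prob_compl[of ?Good seeds] by (simp add: Compl_eq_Diff_UNIV)
  ultimately show ?thesis by linarith
qed

lemma numer_estimate:
  assumes g: "good_graph g" and l: "distinct l" "set l \<subseteq> {1..n}" "length l \<le> cap"
    and r: "r < P" "\<forall>j<T. \<not> deceived n P L (level_of g j) r"
  shows "numer g l r = 2 * (n - 1) + 2 * (\<Sum>j<T. gap j * estimate g j l) + G * (n div (L + 1)) - 2 * G"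
proof -
  have "atom_sum P (\<lambda>i. digit P (table g l r) (i * T + j)) (length l) L a = estimate g j l" if j: "j < T" for j
    unfolding estimate_def
  proof (rule atom_sum_eq[OF l(1) refl good_graph_level[OF g] l(2)])
    show "\<not> deceived n P L (level_of g j) r" using r(2) j by blast
    fix i assume i: "i < length l"
    have k: "i * T + j < length l * T"
    proof -
      have "i * T + j < Suc i * T" using j by simp
      also have "\<dots> \<le> length l * T" using i by (intro mult_le_mono1) simp
      finally show ?thesis .
    qed
    have "(i * T + j) mod T = j" "(i * T + j) div T = i" using j by simp_all
    then show "int (digit P (table g l r) (i * T + j)) mod int P = fingerprint n r (level_of g j) (l ! i) mod int P"
      using P2 by (simp add: digit_table[OF k] print_digit_def)
  qed
  then show ?thesis by (simp add: numer_def)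
qed

text \<open>The component count of a level lies between the number of small components and
  \<open>n div (L + 1)\<close> more. Taking the middle errs by at most half of that range, and
  sampling by at most \<open>\<eta>\<close>. Weighted with the gaps, which sum to \<open>G\<close>,
  the error is at most \<open>\<epsilon> - \<delta>\<close> times \<open>n - 1\<close>, hence times
  the minimum; rounding of the weights uses up the remaining \<open>\<delta>\<close>.\<close>

theorem algorithm_correct:
  fixes \<tau> :: "nat \<Rightarrow> nat" and \<epsilon> \<delta> \<eta> :: real
  assumes xs: "valid_stream n W xs" and conn: "graph_connected {1..n} (dom (final_graph xs))"
    and class_ok: "\<And>w. 1 \<le> w \<Longrightarrow> w \<le> W \<Longrightarrow> cls w \<le> T \<and> w \<le> \<tau> (cls w) \<and> real (\<tau> (cls w)) \<le> (1 + \<delta>) * w"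
    and \<tau>: "\<tau> 0 = 1" "\<And>j. \<tau> j \<le> \<tau> (Suc j)" "\<And>j. j < T \<Longrightarrow> gap j = \<tau> (Suc j) - \<tau> j" "G = \<tau> T - 1"
    and \<eta>: "\<eta> > 0" "real T * real n * (2 ^ (a * L) - 1) \<le> \<eta>\<^sup>2 / 12"
    and err: "G * (\<eta> + real (n div (L + 1)) / 2) \<le> (\<epsilon> - \<delta>) * (real n - 1)" "\<delta> \<le> \<epsilon>" "0 \<le> \<delta>"
  shows "lossless_spmf (run_stream algorithm n xs)"
    and "\<forall>s\<in>set_spmf (run_stream algorithm n xs). peak s \<le> SB \<and> time s \<le> SB"
    and "2 / 3 \<le> measure (measure_spmf (run_stream algorithm n xs))
      {s. approximates \<epsilon> (real (mst_weight n (final_graph xs))) (result s)}"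
proof -
  define g where "g = final_graph xs"
  have ne: "xs \<noteq> []"
  proof
    assume "xs = []"
    then have d: "dom (final_graph xs) = {}" by (simp add: final_graph_def)
    have "\<forall>u\<in>{1..n}. {1..n} \<subseteq> component {} u"
      using conn unfolding graph_connected_iff d by blast
    from bspec[OF this, of 1] have "{1..n} \<subseteq> component {} 1" using n2 by simp
    moreover have "component {} 1 = {1}" by (auto simp: component_def adj_def)
    moreover have "2 \<in> {1..n}" using n2 by simp
    ultimately have "(2::nat) \<in> {1}" by blast
    then show False by simp
  qed
  have gg: "good_graph g"
    unfolding g_def final_graph_def
  proof (rule weighted_graph_on_fold[OF weighted_graph_on_empty])
    show "valid_item n W (fold apply_item (take i xs) (\<lambda>_. None)) (xs ! i)" if "i < length xs" for i
      using xs that by (simp add: valid_stream_def final_graph_def)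
  qed
  have wt: "1 \<le> the (g e) \<and> the (g e) \<le> W" if "e \<in> dom g" for e
    using gg that by (auto simp: weighted_graph_on_def)
  interpret leveled_graph "{1..n}" "dom g" "\<lambda>e. cls (the (g e))" \<tau> T
  proof unfold_locales
    show "edges_on {1..n} (dom g)" using gg by (simp add: weighted_graph_on_def)
    show "graph_connected {1..n} (dom g)" using conn by (simp add: g_def)
    show "cls (the (g e)) \<le> T" if "e \<in> dom g" for e using class_ok wt[OF that] by auto
  qed (use \<tau> in auto)
  have lev: "level j = level_of g j" for j by (simp add: level_def level_of_def)
  have lower: "1 \<le> the (g e) \<and> the (g e) \<le> \<tau> (cls (the (g e)))" if "e \<in> dom g" for e
    using class_ok[of "the (g e)"] wt[OF that] by blast
  have upper: "real (\<tau> (cls (the (g e)))) \<le> (1 + \<delta>) * the (g e)" if "e \<in> dom g" for e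
    using class_ok[of "the (g e)"] wt[OF that] by blast
  note mst = mst_weight_level_cost[of n g cls \<tau> T \<delta>, OF leveled_graph_axioms lower upper]
  have Gsum: "G = (\<Sum>j<T. gap j)"
  proof -
    have "(\<Sum>j<T. \<tau> (Suc j) - \<tau> j) = \<tau> T - \<tau> 0"
    proof (induction T)
      case (Suc T)
      have "\<tau> 0 \<le> \<tau> T" using lift_Suc_mono_le[of \<tau> 0 T] \<tau>(2) by simp
      then show ?case using Suc \<tau>(2)[of T] by simp
    qed simp
    then show ?thesis using \<tau> by simp
  qed
  define H where "H = n div (L + 1)"
  define cc where "cc j = card (components {1..n} (level_of g j))" for j
  have cc: "small_count g j \<le> cc j" "cc j \<le> small_count g j + H" "1 \<le> cc j" for j
  proof -
    let ?C = "components {1..n} (level_of g j)"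
    have fin: "finite ?C" by (simp add: components_def)
    have "?C = {C \<in> ?C. card C \<le> L} \<union> {C \<in> ?C. L < card C}" by auto
    then have "cc j = small_count g j + card {C \<in> ?C. L < card C}"
      unfolding cc_def small_count_def using fin
      by (subst card_Un_disjoint[symmetric]) (auto intro: arg_cong[of _ _ card])
    moreover have "card {C \<in> ?C. L < card C} \<le> H"
      using card_large_components[OF good_graph_level[OF gg], of j L] by (simp add: H_def)
    ultimately show "small_count g j \<le> cc j" "cc j \<le> small_count g j + H" by auto
    have "?C \<noteq> {}" using n2 by (auto simp: components_def)
    then show "1 \<le> cc j" using fin by (simp add: cc_def Suc_le_eq card_gt_0_iff)
  qed
  have cost: "real level_cost = real n - 1 + (\<Sum>j<T. real (gap j) * (real (cc j) - 1))"
  proof -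
    have "level_cost = (n - 1) + (\<Sum>j<T. gap j * (cc j - 1))"
      unfolding level_cost_def using \<tau> by (simp add: lev cc_def)
    then have "real level_cost = real (n - 1) + (\<Sum>j<T. real (gap j) * real (cc j - 1))" by simp
    then show ?thesis using cc(3) n2 by (simp add: of_nat_diff)
  qed
  have good: "approximates \<epsilon> (real (mst_weight n g)) (real (numer g (take cap l) r) / 2)"
    if lr: "(l, r) \<in> set_pmf seeds" and len: "length l \<le> cap"
      and dc: "\<forall>j<T. \<not> deceived n P L (level_of g j) r"
      and es: "\<forall>j<T. \<bar>real (estimate g j l) - real (small_count g j)\<bar> < \<eta>" for l r
  proof -
    note sl = set_seeds[OF lr]
    have nu: "numer g l r = 2 * (n - 1) + 2 * (\<Sum>j<T. gap j * estimate g j l) + G * H - 2 * G"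
      unfolding H_def using sl len dc P_ge by (intro numer_estimate gg) auto
    define Y where "Y = real n - 1 + (\<Sum>j<T. real (gap j) * real (estimate g j l)) + G * real H / 2 - real G"
    \<comment> \<open>The truncated subtraction clips the estimate at 0, which cannot increase its
      distance from a nonnegative target.\<close>
    have Y: "real (numer g l r) / 2 = max 0 Y"
    proof -
      have "real (2 * (n - 1) + 2 * (\<Sum>j<T. gap j * estimate g j l) + G * H) - real (2 * G) = 2 * Y"
        using n2 by (simp add: Y_def of_nat_diff algebra_simps)
      moreover have "real (x - y) = max 0 (real x - real y)" for x y :: nat by simp
      ultimately have "real (numer g l r) = max 0 (2 * Y)" unfolding nu by simp
      then show ?thesis by (simp add: max_def)
    qed
    have "Y - real level_cost = (\<Sum>j<T. real (gap j) * (real (estimate g j l) - real (cc j) + real H / 2))"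
      unfolding Y_def cost Gsum by (simp add: sum_distrib_right sum_distrib_left sum_subtractf sum.distrib algebra_simps sum_divide_distrib)
    then have "\<bar>Y - real level_cost\<bar> \<le> (\<Sum>j<T. \<bar>real (gap j) * (real (estimate g j l) - real (cc j) + real H / 2)\<bar>)"
      by simp
    also have "\<dots> \<le> (\<Sum>j<T. real (gap j) * (\<eta> + real H / 2))"
    proof (rule sum_mono)
      fix j assume "j \<in> {..<T}"
      then have 1: "\<bar>real (estimate g j l) - real (small_count g j)\<bar> < \<eta>" using es by simp
      have 2: "real (small_count g j) \<le> real (cc j)" "real (cc j) \<le> real (small_count g j) + real H"
        using cc(1,2)[of j] by linarith+
      have "\<bar>real (estimate g j l) - real (cc j) + real H / 2\<bar> \<le> \<eta> + real H / 2"
        using 1 2 by linarith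
      then show "\<bar>real (gap j) * (real (estimate g j l) - real (cc j) + real H / 2)\<bar> \<le> real (gap j) * (\<eta> + real H / 2)"
        by (simp add: abs_mult mult_left_mono)
    qed
    also have "\<dots> = G * (\<eta> + real H / 2)" by (simp add: Gsum sum_distrib_right)
    also have "\<dots> \<le> (\<epsilon> - \<delta>) * (real n - 1)" using err(1) by (simp add: H_def)
    also have "\<dots> \<le> (\<epsilon> - \<delta>) * real (mst_weight n g)"
      using err(2) mst(3) n2 by (intro mult_left_mono) linarith+
    finally have yc: "\<bar>Y - real level_cost\<bar> \<le> (\<epsilon> - \<delta>) * real (mst_weight n g)" .
    have "\<bar>Y - real (mst_weight n g)\<bar> \<le> \<bar>Y - real level_cost\<bar> + \<bar>real level_cost - real (mst_weight n g)\<bar>"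
      by linarith
    also have "\<dots> \<le> (\<epsilon> - \<delta>) * real (mst_weight n g) + \<delta> * real (mst_weight n g)"
      using yc mst(1,2) by (simp add: algebra_simps)
    also have "\<dots> = \<epsilon> * real (mst_weight n g)" by (simp add: algebra_simps)
    finally have "\<bar>max 0 Y - real (mst_weight n g)\<bar> \<le> \<epsilon> * real (mst_weight n g)" by linarith
    moreover have "take cap l = l" using len by simp
    ultimately show ?thesis unfolding approximates_def by (simp add: Y)
  qed
  note rs = run_stream_algorithm[OF xs ne]
  show "lossless_spmf (run_stream algorithm n xs)"
    and "\<forall>s\<in>set_spmf (run_stream algorithm n xs). peak s \<le> SB \<and> time s \<le> SB"
    by (rule rs)+
  have "2 / 3 \<le> measure_pmf.prob seeds {(l, r). length l \<le> cap \<and> (\<forall>j<T. \<not> deceived n P L (level_of g j) r) \<and>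
    (\<forall>j<T. \<bar>real (estimate g j l) - real (small_count g j)\<bar> < \<eta>)}" (is "_ \<le> measure_pmf.prob _ ?Good")
    by (rule prob_good_seeds[OF gg \<eta>])
  also have "\<dots> = measure_pmf.prob seeds (?Good \<inter> set_pmf seeds)" by (rule measure_Int_set_pmf[symmetric])
  also have "\<dots> \<le> measure_pmf.prob seeds {(l, r). approximates \<epsilon> (real (mst_weight n g)) (real (numer g (take cap l) r) / 2)}"
    using good by (intro measure_pmf.finite_measure_mono) auto
  also have "\<dots> \<le> measure (measure_spmf (run_stream algorithm n xs)) {s. approximates \<epsilon> (real (mst_weight n g)) (result s)}"
    using rs(3)[of "approximates \<epsilon> (real (mst_weight n g))"] by (simp add: g_def)
  finally show "2 / 3 \<le> measure (measure_spmf (run_stream algorithm n xs))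
      {s. approximates \<epsilon> (real (mst_weight n (final_graph xs))) (result s)}" by (simp add: g_def)
qed

end

section \<open>Choice of the parameters\<close>

text \<open>Makes the square of the number of thresholds, which is logarithmic in \<open>W\<close>,
  at most linear in \<open>W\<close>.\<close>

lemma one_add_ln_le_sqrt:
  fixes y :: real
  assumes "1 \<le> y"
  shows "1 + ln y \<le> 2 * sqrt y"
proof -
  have "ln (sqrt y) \<le> sqrt y - 1" using assms by (intro ln_le_minus_one) simp
  moreover have "ln (sqrt y) = ln y / 2" using assms by (simp add: ln_sqrt)
  ultimately show ?thesis by simp
qed

lemma le_log2_of_power_le: "2 ^ k \<le> n \<Longrightarrow> real k \<le> log 2 (real n)"
proof -
  assume "2 ^ k \<le> n"
  then have "real (2 ^ k) \<le> real n" by (simp only: of_nat_le_iff)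
  then have "log 2 (2 ^ k) \<le> log 2 (real n)" by (subst log_le_cancel_iff) (auto intro: less_le_trans[of 0 "2 ^ k"])
  then show ?thesis by simp
qed

locale parameters =
  fixes \<epsilon> :: real and W :: nat
  assumes eps: "0 < \<epsilon>" "\<epsilon> < 1" and W2: "2 \<le> W"
begin

text \<open>
  \<open>CA\<close> makes Chebyshev's inequality, with deviation \<open>x * n / 4\<close>, fail with probability at most 1/12
  for all \<open>W - 1\<close> thresholds together.
\<close>

definition x :: real where "x = \<epsilon> / (real W - 1)"
definition LA :: nat where "LA = nat \<lfloor>1 / x\<rfloor>"
definition CA :: nat where "CA = nat \<lceil>192 * real W / x\<^sup>2\<rceil>"
definition \<beta> :: real where "\<beta> = 1 + \<epsilon> / 2"
definition clB :: "nat \<Rightarrow> nat" where "clB w = nat \<lceil>log \<beta> (real w)\<rceil>"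
definition TB :: nat where "TB = clB W"
text \<open>Rounding down makes the class weights integral and keeps them at least as large as every
  integer weight in the class.\<close>

definition \<tau>B :: "nat \<Rightarrow> nat" where "\<tau>B j = nat \<lfloor>\<beta> ^ j\<rfloor>"
definition gapB :: "nat \<Rightarrow> nat" where "gapB j = \<tau>B (Suc j) - \<tau>B j"
definition GB :: nat where "GB = \<tau>B TB - 1"
text \<open>With \<open>G \<le> 2 * W\<close>, the uncertainty about components of more than
  \<open>LB\<close> vertices costs at most \<open>n * \<epsilon> / 8\<close>.\<close>

definition LB :: nat where "LB = nat \<lceil>8 * real W / \<epsilon>\<rceil>"
text \<open>Gathers the dependence of \<open>LB\<close> on \<open>\<epsilon>\<close> in one natural
  number with \<open>LB \<le> W * EE\<close>.\<close>

definition EE :: nat where "EE = nat \<lceil>9 / \<epsilon>\<rceil>"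

sublocale sketch W LA LB TB GB CA clB gapB .

lemma x_pos: "0 < x" and x_less: "x < 1" and x_le: "x \<le> \<epsilon>"
proof -
  have 1: "1 \<le> real W - 1" using W2 by simp
  then show "0 < x" using eps by (simp add: x_def)
  show "x \<le> \<epsilon>" using 1 eps by (simp add: x_def divide_le_eq)
  then show "x < 1" using eps by simp
qed

lemma LA1: "1 \<le> LA" and LA_le: "real LA \<le> 1 / x" and LA_gt: "1 / x < real LA + 1"
proof -
  have 1: "1 \<le> 1 / x" using x_pos x_less by simp
  then have i: "1 \<le> \<lfloor>1 / x\<rfloor>" by simp
  then show "1 \<le> LA" unfolding LA_def by linarith
  have "real LA = of_int \<lfloor>1 / x\<rfloor>" unfolding LA_def by (rule of_nat_nat) (use i in linarith)
  then show "real LA \<le> 1 / x" "1 / x < real LA + 1" by linarith+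
qed

lemma CA_ge: "192 * real W / x\<^sup>2 \<le> real CA" and CA1: "1 \<le> CA"
  and CA_le: "real CA \<le> 193 * real W ^ 3 / \<epsilon>\<^sup>2"
proof -
  have x2: "0 < x\<^sup>2" "x\<^sup>2 \<le> 1" using x_pos x_less by (auto simp: power_le_one)
  have W1: "1 \<le> real W" using W2 by simp
  have ge: "1 \<le> 192 * real W / x\<^sup>2"
  proof -
    have "x\<^sup>2 \<le> 192 * real W" using x2 W1 by linarith
    then show ?thesis using x2 by (simp add: le_divide_eq)
  qed
  show "192 * real W / x\<^sup>2 \<le> real CA" unfolding CA_def by linarith
  then show "1 \<le> CA" using ge by linarith
  have "real CA \<le> 192 * real W / x\<^sup>2 + 1" unfolding CA_def using ge by linarith
  also have "\<dots> \<le> 192 * real W / x\<^sup>2 + real W / x\<^sup>2"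
  proof -
    have "1 \<le> real W / x\<^sup>2" using x2 W1 by (simp add: le_divide_eq)
    then show ?thesis by simp
  qed
  also have "\<dots> = 193 * (real W * (real W - 1)\<^sup>2) / \<epsilon>\<^sup>2"
    by (simp add: x_def power_divide field_simps)
  also have "\<dots> \<le> 193 * real W ^ 3 / \<epsilon>\<^sup>2"
  proof -
    have "(real W - 1)\<^sup>2 \<le> (real W)\<^sup>2" using W1 by (intro power_mono) auto
    then have "real W * (real W - 1)\<^sup>2 \<le> real W * (real W)\<^sup>2" using W1 by (intro mult_left_mono) auto
    then have "real W * (real W - 1)\<^sup>2 \<le> real W ^ 3" by (simp add: power3_eq_cube power2_eq_square)
    then show ?thesis using eps by (intro divide_right_mono mult_left_mono) auto
  qed
  finally show "real CA \<le> 193 * real W ^ 3 / \<epsilon>\<^sup>2" .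
qed

lemma beta: "1 < \<beta>" "\<beta> < 3 / 2"
  using eps by (auto simp: \<beta>_def)

lemma clB_bounds:
  assumes "1 \<le> w"
  shows "log \<beta> w \<le> real (clB w)" "real (clB w) < log \<beta> w + 1"
    "real w \<le> \<beta> ^ clB w" "\<beta> ^ clB w \<le> \<beta> * real w"
proof -
  have l0: "0 \<le> log \<beta> w" using assms beta by simp
  show 1: "log \<beta> w \<le> real (clB w)" unfolding clB_def by linarith
  show 2: "real (clB w) < log \<beta> w + 1" unfolding clB_def using l0 by linarith
  have e: "\<beta> powr log \<beta> w = real w" using assms beta by simp
  have "real w \<le> \<beta> powr real (clB w)" using powr_mono[OF 1, of \<beta>] beta e by simp
  then show "real w \<le> \<beta> ^ clB w" using beta by (simp add: powr_realpow)
  have "\<beta> powr real (clB w) \<le> \<beta> powr (log \<beta> w + 1)" using 2 beta by (intro powr_mono) auto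
  also have "\<dots> = real w * \<beta>" using e beta by (simp add: powr_add)
  finally show "\<beta> ^ clB w \<le> \<beta> * real w" using beta by (simp add: powr_realpow mult.commute)
qed

lemma clB_mono: "w \<le> W \<Longrightarrow> clB w \<le> TB"
proof (cases "w = 0")
  case True
  then show ?thesis by (simp add: clB_def log_def)
next
  case False
  assume "w \<le> W"
  then have "log \<beta> w \<le> log \<beta> W" using False beta by simp
  then show ?thesis unfolding TB_def clB_def by (intro nat_mono ceiling_mono)
qed

lemma \<tau>B_bounds: "real (\<tau>B j) \<le> \<beta> ^ j" "real w \<le> \<beta> ^ j \<Longrightarrow> w \<le> \<tau>B j"
proof -
  have "0 \<le> \<beta> ^ j" using beta by simp
  then show "real (\<tau>B j) \<le> \<beta> ^ j" unfolding \<tau>B_def by linarith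
  assume "real w \<le> \<beta> ^ j"
  then show "w \<le> \<tau>B j" unfolding \<tau>B_def by (simp add: le_nat_floor)
qed

lemma \<tau>B_mono: "\<tau>B j \<le> \<tau>B (Suc j)"
proof -
  have "\<beta> ^ j \<le> \<beta> ^ Suc j" using beta by (intro power_increasing) auto
  then show ?thesis unfolding \<tau>B_def by (intro nat_mono floor_mono)
qed

lemma TB1: "1 \<le> TB"
proof -
  have "0 < log \<beta> W" using W2 beta by simp
  then show ?thesis unfolding TB_def clB_def by linarith
qed

lemma GB_le: "real GB \<le> 2 * real W" and gapB_le: "j \<le> TB \<Longrightarrow> gapB j \<le> 4 * W"
proof -
  have W1: "1 \<le> W" using W2 by simp
  have b: "\<beta> ^ TB \<le> \<beta> * real W" using clB_bounds(4)[OF W1] by (simp add: TB_def)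
  have bw: "\<beta> * real W \<le> 2 * real W" using beta by (intro mult_right_mono) auto
  have "real GB \<le> real (\<tau>B TB)" unfolding GB_def by simp
  then show "real GB \<le> 2 * real W" using \<tau>B_bounds(1)[of TB] b bw by linarith
  assume j: "j \<le> TB"
  have "real (gapB j) \<le> real (\<tau>B (Suc j))" unfolding gapB_def by simp
  also have "\<dots> \<le> \<beta> ^ Suc j" by (rule \<tau>B_bounds)
  also have "\<dots> \<le> \<beta> ^ Suc TB" using beta j by (intro power_increasing) auto
  also have "\<dots> = \<beta> * \<beta> ^ TB" by simp
  also have "\<dots> \<le> 2 * (2 * real W)" using beta b bw by (intro mult_mono) auto
  finally show "gapB j \<le> 4 * W" by linarith
qed

lemma LB_le: "LB \<le> W * EE" and LB_ge: "8 * real W / \<epsilon> \<le> real LB" and EE_ge: "9 / \<epsilon> \<le> real EE"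
  and EE9: "9 \<le> EE"
proof -
  show e: "9 / \<epsilon> \<le> real EE" unfolding EE_def by linarith
  have "9 \<le> 9 / \<epsilon>" using eps by (simp add: le_divide_eq)
  then show "9 \<le> EE" using e by linarith
  show "8 * real W / \<epsilon> \<le> real LB" unfolding LB_def by linarith
  have p: "0 \<le> 8 * real W / \<epsilon>" using eps by simp
  have "real LB \<le> 8 * real W / \<epsilon> + 1" unfolding LB_def using p by linarith
  also have "\<dots> \<le> 8 * real W / \<epsilon> + real W / \<epsilon>"
  proof -
    have "1 \<le> real W / \<epsilon>" using eps W2 by (simp add: le_divide_eq)
    then show ?thesis by simp
  qed
  also have "\<dots> = real W * (9 / \<epsilon>)" by (simp add: field_simps)
  also have "\<dots> \<le> real W * real EE" using e by (intro mult_left_mono) auto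
  finally show "LB \<le> W * EE" by (metis of_nat_le_iff of_nat_mult)
qed

end

section \<open>Parameters for a given number of vertices\<close>

locale instance_parameters = parameters +
  fixes n :: nat
  assumes n2: "2 \<le> n"
begin

definition L :: nat where "L = (if 2 ^ W \<le> n then LA else min n LB)"
definition T :: nat where "T = (if 2 ^ W \<le> n then W - 1 else TB)"
definition G :: nat where "G = (if 2 ^ W \<le> n then W - 1 else GB)"
definition a :: nat where "a = (if 2 ^ W \<le> n then LEAST k. n < CA * 2 ^ ((k + 1) * L) else 0)"
definition Z :: nat where "Z = 12 * T * (n + 1) ^ (L + 2)"
definition N :: nat where "N = (LEAST k. Z \<le> 2 ^ k)"
definition P :: nat where "P = (LEAST p. prime p \<and> 2 ^ N \<le> p)"
definition cap :: nat where "cap = 12 * (n div 2 ^ a + 1)"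
text \<open>The leading term is the length of the table in bits: \<open>cap * T\<close> digits to a
  base of at most \<open>2 ^ (4 * N)\<close>. The other summands make \<open>X\<close> exceed the
  constants of the program.\<close>

definition D :: nat where "D = 4 * N * cap * T + W + EE + (if 2 ^ W \<le> n then CA else 0)"
definition X :: nat where "X = 2 ^ D"

lemma T1: "1 \<le> T" using W2 TB1 by (auto simp: T_def)

lemma a_small: "n < 2 ^ W \<Longrightarrow> a = 0" by (simp add: a_def)

lemma a_large:
  assumes "2 ^ W \<le> n"
  shows "n < CA * 2 ^ ((a + 1) * L)" "k < a \<Longrightarrow> CA * 2 ^ ((k + 1) * L) \<le> n" "a \<le> n"
proof -
  have L1: "1 \<le> L" using assms LA1 by (simp add: L_def)
  let ?Q = "\<lambda>k. n < CA * 2 ^ ((k + 1) * L)"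
  have a: "a = (LEAST k. ?Q k)" using assms by (simp add: a_def)
  have Qn: "?Q n"
  proof -
    have "n < 2 ^ n" by (rule less_exp)
    also have "(2::nat) ^ n \<le> 2 ^ ((n + 1) * L)" using L1 by (intro power_increasing) (cases L, auto)
    also have "\<dots> \<le> CA * 2 ^ ((n + 1) * L)" using CA1 by simp
    finally show ?thesis .
  qed
  show "n < CA * 2 ^ ((a + 1) * L)" unfolding a by (rule LeastI[of ?Q, OF Qn])
  show "a \<le> n" unfolding a by (rule Least_le[of ?Q, OF Qn])
  show "CA * 2 ^ ((k + 1) * L) \<le> n" if "k < a" using not_less_Least[of k ?Q] that unfolding a by simp
qed

lemma a_n: "a \<le> n"
  using a_large(3) by (cases "2 ^ W \<le> n") (auto simp: a_def)

text \<open>By minimality, a positive \<open>a\<close> itself still satisfies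
  \<open>CA * 2 ^ (a * L) \<le> n\<close>.\<close>

lemma pow_aL: "2 ^ (a * L) \<le> n"
proof (cases "a = 0")
  case False
  then have l: "2 ^ W \<le> n" using a_small by (cases "2 ^ W \<le> n") auto
  have "CA * 2 ^ ((a - 1 + 1) * L) \<le> n" using False by (intro a_large(2)[OF l]) simp
  then have "CA * 2 ^ (a * L) \<le> n" using False by simp
  moreover have "2 ^ (a * L) \<le> CA * 2 ^ (a * L)" using CA1 by simp
  ultimately show ?thesis by linarith
qed (use n2 in simp)

lemma N_least: "Z \<le> 2 ^ N" "k < N \<Longrightarrow> 2 ^ k < Z"
proof -
  have "Z \<le> 2 ^ Z" using less_exp[of Z] by simp
  then show "Z \<le> 2 ^ N" unfolding N_def by (rule LeastI)
  show "2 ^ k < Z" if "k < N" using not_less_Least[of k "\<lambda>k. Z \<le> 2 ^ k"] that unfolding N_def by simp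
qed

lemma Z_ge: "12 \<le> Z" "T \<le> Z" "(n + 1) ^ (L + 2) \<le> Z"
proof -
  have p: "1 \<le> (n + 1) ^ (L + 2)" by (rule one_le_power) simp
  have "12 * 1 * 1 \<le> Z" unfolding Z_def by (intro mult_le_mono T1 p le_refl)
  then show "12 \<le> Z" by simp
  have "1 * T * 1 \<le> Z" unfolding Z_def by (intro mult_le_mono p le_refl) simp
  then show "T \<le> Z" by simp
  have "1 * 1 * (n + 1) ^ (L + 2) \<le> Z" unfolding Z_def by (intro mult_le_mono T1 le_refl) simp
  then show "(n + 1) ^ (L + 2) \<le> Z" by simp
qed

lemma N2: "2 \<le> N"
proof (rule ccontr)
  assume "\<not> 2 \<le> N"
  then have "(2::nat) ^ N \<le> 2 ^ 1" by (intro power_increasing) auto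
  then show False using N_least(1) Z_ge(1) by simp
qed

lemma P_props: "prime P" "2 ^ N \<le> P" "P \<le> 2 ^ (4 * N)" "k < P \<Longrightarrow> \<not> (prime k \<and> 2 ^ N \<le> k)"
proof -
  let ?Q = "\<lambda>p::nat. prime p \<and> 2 ^ N \<le> p"
  obtain p where p: "?Q p" "p \<le> 2 ^ (4 * N)" using ex_prime_between[OF N2] by auto
  have "?Q P" unfolding P_def by (rule LeastI[of ?Q, OF p(1)])
  then show "prime P" "2 ^ N \<le> P" by auto
  have "P \<le> p" unfolding P_def by (rule Least_le[of ?Q, OF p(1)])
  then show "P \<le> 2 ^ (4 * N)" using p(2) by simp
  show "\<not> ?Q k" if "k < P" using not_less_Least[of k ?Q] that unfolding P_def by simp
qed

lemma cap1: "1 \<le> cap" by (simp add: cap_def)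

lemma D_ge: "W \<le> D" "EE + W \<le> D" "4 * N * cap * T \<le> D" "4 * N * cap \<le> D" "4 * N \<le> D" "N * cap \<le> D" "cap \<le> D"
  "2 ^ W \<le> n \<Longrightarrow> N + CA \<le> D" "N \<le> D"
proof -
  show d1: "4 * N * cap * T \<le> D" "W \<le> D" "EE + W \<le> D" by (simp_all add: D_def)
  have "4 * N * cap * 1 \<le> 4 * N * cap * T" by (intro mult_le_mono le_refl T1)
  then show d2: "4 * N * cap \<le> D" using d1 by linarith
  have "4 * N * 1 \<le> 4 * N * cap" by (intro mult_le_mono le_refl cap1)
  then show d3: "4 * N \<le> D" using d2 by linarith
  then show "N \<le> D" by linarith
  show "N * cap \<le> D" using d2 by simp
  have "1 * cap \<le> 4 * N * cap" using N2 by (intro mult_le_mono le_refl) simp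
  then show "cap \<le> D" using d2 by linarith
  show "N + CA \<le> D" if "2 ^ W \<le> n"
  proof -
    have "4 * N \<le> 4 * N * cap * T"
      using \<open>4 * N * 1 \<le> 4 * N * cap\<close> \<open>4 * N * cap * 1 \<le> 4 * N * cap * T\<close> by linarith
    moreover have "D = 4 * N * cap * T + W + EE + CA" using that by (simp add: D_def)
    ultimately show ?thesis by linarith
  qed
qed

lemma le_X: "k \<le> D \<Longrightarrow> y \<le> 2 ^ k \<Longrightarrow> y \<le> X"
  unfolding X_def using power_increasing[of k D "2::nat"] by linarith

lemma Z_X: "Z \<le> X" by (rule le_X[OF D_ge(9) N_least(1)])

lemma n1_N: "(n + 1) ^ 2 \<le> 2 ^ N" "n + 1 \<le> 2 ^ N"
proof -
  have "(n + 1) ^ 2 \<le> (n + 1) ^ (L + 2)" by (intro power_increasing) auto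
  then show 1: "(n + 1) ^ 2 \<le> 2 ^ N" using Z_ge(3) N_least(1) by linarith
  have "n + 1 \<le> (n + 1) ^ 2" by (simp add: power2_eq_square)
  then show "n + 1 \<le> 2 ^ N" using 1 by linarith
qed

lemma power_less_exp: "y \<le> 2 ^ y" for y :: nat
  using less_exp[of y] by simp

lemma W_EE_X: "W * EE \<le> X" "4 * W \<le> X" "2 * W \<le> X"
proof -
  have "W * EE \<le> 2 ^ W * 2 ^ EE" by (intro mult_le_mono power_less_exp)
  also have "\<dots> = 2 ^ (EE + W)" by (simp add: power_add)
  finally show "W * EE \<le> X" by (rule le_X[OF D_ge(2)])
  then show "4 * W \<le> X" "2 * W \<le> X" using EE9 mult_le_mono2[of 9 EE W] by linarith+
qed

lemma n_X: "n + 1 \<le> X" by (rule le_X[OF D_ge(9) n1_N(2)])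

lemma CA_X:
  assumes l: "2 ^ W \<le> n"
  shows "CA * 2 ^ ((a + 1) * L) \<le> X"
proof -
  have "CA * 2 ^ ((a + 1) * L) \<le> CA * (n * 2 ^ L)"
    using pow_aL by (simp add: power_add mult_le_mono)
  also have "n * 2 ^ L \<le> (n + 1) ^ (L + 2)"
  proof -
    have "n * 2 ^ L \<le> (n + 1) ^ 2 * (n + 1) ^ L"
      using n2 by (intro mult_le_mono power_mono) (auto simp: power2_eq_square)
    moreover have "(n + 1) ^ (L + 2) = (n + 1) ^ 2 * (n + 1) ^ L" by (simp only: power_add mult.commute)
    ultimately show ?thesis by (simp only:)
  qed
  also have "\<dots> \<le> 2 ^ N" using Z_ge(3) N_least(1) by linarith
  also have "CA * 2 ^ N \<le> 2 ^ CA * 2 ^ N" by (intro mult_le_mono1 power_less_exp)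
  also have "\<dots> = 2 ^ (N + CA)" by (simp add: power_add)
  finally have "CA * 2 ^ ((a + 1) * L) \<le> 2 ^ (N + CA)" by (simp add: mult_le_mono2)
  then show ?thesis by (rule le_X[OF D_ge(8)[OF l]])
qed

sublocale sketch_init W LA LB TB GB CA clB gapB n L T G a P N cap X Z
proof unfold_locales
  show "2 \<le> n" "1 \<le> T" "1 \<le> cap" "prime P" "2 ^ N \<le> P" "Z \<le> 2 ^ N" "P \<le> 2 ^ (4 * N)" "a \<le> n" "Z \<le> X"
    by (rule n2 T1 cap1 P_props N_least a_n Z_X)+
  show "L = (if 2 ^ W \<le> n then LA else min n LB)" "T = (if 2 ^ W \<le> n then W - 1 else TB)"
    "G = (if 2 ^ W \<le> n then W - 1 else GB)" "Z = 12 * T * (n + 1) ^ (L + 2)" "cap = 12 * (n div 2 ^ a + 1)"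
    by (rule L_def T_def G_def Z_def cap_def)+
  show "2 ^ W \<le> X" by (rule le_X[OF D_ge(1) le_refl])
  show "(n + 1) ^ 2 \<le> X" by (rule le_X[OF D_ge(9) n1_N(1)])
  show "L + 2 \<le> X"
  proof -
    have "L + 2 \<le> 2 ^ (L + 2)" by (rule power_less_exp)
    also have "(2::nat) ^ (L + 2) \<le> (n + 1) ^ (L + 2)" using n2 by (intro power_mono) auto
    finally show ?thesis using Z_ge(3) Z_X by linarith
  qed
  show "T \<le> X" using Z_ge(2) Z_X by linarith
  show "G \<le> X" using GB_le W_EE_X(3) by (auto simp: G_def)
  show "LB \<le> X" using LB_le W_EE_X(1) by linarith
  show "clB w \<le> X" if "n < 2 ^ W" "w \<le> W" for w
    using clB_mono[OF that(2)] \<open>T \<le> X\<close> that(1) by (simp add: T_def)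
  show "gapB j \<le> X" if "j \<le> TB" for j using gapB_le[OF that] W_EE_X(2) by linarith
  show aX: "a \<le> X" using a_n n_X by linarith
  show pX: "2 ^ (a * L) \<le> X" using pow_aL n_X by linarith
  show "cap \<le> X" by (rule le_X[OF D_ge(7) power_less_exp])
  show "2 ^ cap \<le> X" by (rule le_X[OF D_ge(7) le_refl])
  show "(n + 1) ^ cap \<le> X"
  proof (rule le_X[OF D_ge(6)])
    show "(n + 1) ^ cap \<le> 2 ^ (N * cap)" unfolding power_mult by (intro power_mono n1_N) simp
  qed
  show "P ^ (cap * T) \<le> X"
  proof (rule le_X[OF D_ge(3)])
    have "P ^ (cap * T) \<le> (2 ^ (4 * N)) ^ (cap * T)" by (intro power_mono P_props) simp
    then show "P ^ (cap * T) \<le> 2 ^ (4 * N * cap * T)" by (simp add: power_mult[symmetric] mult.assoc)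
  qed
  show "2 ^ (4 * N) \<le> X" by (rule le_X[OF D_ge(5) le_refl])
  show "2 ^ k < Z" if "k < N" for k by (rule N_least(2)[OF that])
  show "\<not> (prime k \<and> 2 ^ N \<le> k)" if "k < P" for k by (rule P_props(4)[OF that])
  show "a = 0" if "n < 2 ^ W" by (rule a_small[OF that])
  show "n < CA * 2 ^ ((a + 1) * L)" "CA * 2 ^ ((a + 1) * L) \<le> X" if "2 ^ W \<le> n"
    by (rule a_large(1)[OF that] CA_X[OF that])+
  show "CA * 2 ^ ((k + 1) * L) \<le> n" if "2 ^ W \<le> n" "k < a" for k by (rule a_large(2)[OF that])
  show "(a + 1) * L \<le> X" if "2 ^ W \<le> n"
  proof -
    have "(a + 1) * L \<le> 2 ^ ((a + 1) * L)" by (rule power_less_exp)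
    also have "\<dots> \<le> CA * 2 ^ ((a + 1) * L)" using CA1 by simp
    finally show ?thesis using CA_X[OF that] by linarith
  qed
  show "2 ^ a \<le> X"
  proof (cases "a = 0")
    case True
    then show ?thesis using n_X by simp
  next
    case False
    then have "2 ^ W \<le> n" using a_small by (cases "2 ^ W \<le> n") auto
    then have "1 \<le> L" using LA1 by (simp add: L_def)
    then have "(2::nat) ^ a \<le> 2 ^ (a * L)" by (intro power_increasing) auto
    then show ?thesis using pX by linarith
  qed
qed

text \<open>Each of the 80 cells is charged 7 bits for the address bound and
  \<open>8 * D + 1\<close> bits for the value bound \<open>B\<close>.\<close>

lemma SB_eq: "SB = 640 * (D + 1)"
proof -
  have b: "bits 80 = 7" by (simp add: bits_def compute_floorlog)
  have "B = X ^ 8" by (rule B_def)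
  then have B: "B = 2 ^ (8 * D)" by (simp add: X_def power_mult[symmetric] mult.commute)
  have "floorlog 2 (2 ^ m) = m + 1" for m by (simp add: floorlog_def)
  then have "bits B = 8 * D + 1" unfolding B bits_def by simp
  then show ?thesis by (simp add: SB_def space_bound_def b)
qed

lemma correct:
  assumes "valid_stream n W xs" "graph_connected {1..n} (dom (final_graph xs))"
  shows "lossless_spmf (run_stream algorithm n xs)
    \<and> (\<forall>s\<in>set_spmf (run_stream algorithm n xs). peak s \<le> SB \<and> time s \<le> SB)
    \<and> 2 / 3 \<le> measure (measure_spmf (run_stream algorithm n xs))
      {s. approximates \<epsilon> (real (mst_weight n (final_graph xs))) (result s)}"
proof (cases "2 ^ W \<le> n")
  case l: True
  have "(2::nat) ^ 2 \<le> 2 ^ W" using W2 by (intro power_increasing) auto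
  then have n4: "4 \<le> n" using l by simp
  have Wn: "real W - 1 \<ge> 1" using W2 by simp
  have xW: "x * (real W - 1) = \<epsilon>" using Wn by (simp add: x_def)
  \<comment> \<open>A quarter of \<open>x * n\<close> for sampling and half of it for the large
    components leave a quarter of the allowed error, which pays for \<open>n - 1\<close> in place of
    \<open>n\<close> because \<open>n \<ge> 4\<close>.\<close>
  define \<eta> where "\<eta> = x * real n / 4"
  have eta: "\<eta> > 0" using x_pos n2 by (simp add: \<eta>_def)
  have dev: "real T * real n * (2 ^ (a * L) - 1) \<le> \<eta>\<^sup>2 / 12"
  proof (cases "a = 0")
    case True
    then show ?thesis by simp
  next
    case False
    have "CA * 2 ^ ((a - 1 + 1) * L) \<le> n" using False by (intro a_large(2)[OF l]) simp
    then have "CA * 2 ^ (a * L) \<le> n" using False by simp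
    then have "real (CA * 2 ^ (a * L)) \<le> real n" by (simp only: of_nat_le_iff)
    then have c: "real CA * 2 ^ (a * L) \<le> real n" by simp
    have "192 * real W / x\<^sup>2 * 2 ^ (a * L) \<le> real CA * 2 ^ (a * L)" using CA_ge by (intro mult_right_mono) auto
    then have "192 * real W * 2 ^ (a * L) / x\<^sup>2 \<le> real n" using c by simp
    then have "192 * real W * 2 ^ (a * L) \<le> real n * x\<^sup>2" using x_pos by (simp add: divide_le_eq)
    then have w: "real W * 2 ^ (a * L) \<le> real n * x\<^sup>2 / 192" by simp
    have TW: "real T \<le> real W" using l by (simp add: T_def)
    have "real T * real n * (2 ^ (a * L) - 1) \<le> real W * real n * 2 ^ (a * L)"
      using TW by (intro mult_mono) auto
    also have "\<dots> = real n * (real W * 2 ^ (a * L))" by simp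
    also have "\<dots> \<le> real n * (real n * x\<^sup>2 / 192)" using w by (intro mult_left_mono) auto
    also have "\<dots> = \<eta>\<^sup>2 / 12" by (simp add: \<eta>_def power2_eq_square)
    finally show ?thesis .
  qed
  have err: "real G * (\<eta> + real (n div (L + 1)) / 2) \<le> (\<epsilon> - 0) * (real n - 1)"
  proof -
    have G: "real G = real W - 1" using l W2 by (simp add: G_def of_nat_diff)
    have "real (n div (L + 1)) \<le> real n / real (L + 1)" by (rule of_nat_div_le_of_nat)
    also have "\<dots> \<le> real n * x"
    proof -
      have "1 / x < real (L + 1)" using LA_gt l by (simp add: L_def)
      then have "1 < x * real (L + 1)" using x_pos by (simp add: divide_less_eq mult.commute)
      then have "real n * 1 \<le> real n * (x * real (L + 1))" by (intro mult_left_mono) auto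
      then show ?thesis by (simp add: divide_le_eq mult.assoc)
    qed
    finally have H: "real (n div (L + 1)) \<le> real n * x" .
    have "real G * (\<eta> + real (n div (L + 1)) / 2) \<le> (real W - 1) * (x * real n / 4 + real n * x / 2)"
      unfolding G \<eta>_def using H Wn by (intro mult_left_mono) auto
    also have "\<dots> = x * (real W - 1) * (3 / 4 * real n)" by (simp add: algebra_simps)
    also have "\<dots> = \<epsilon> * (3 / 4 * real n)" by (simp only: xW)
    also have "\<dots> \<le> \<epsilon> * (real n - 1)" using eps n4 by (intro mult_left_mono) auto
    finally show ?thesis by simp
  qed
  \<comment> \<open>The weights are exact here: class \<open>w - 1\<close> stands for weight
    \<open>w\<close>, all gaps are 1 and \<open>\<delta>\<close> is 0.\<close>
  define \<tau> where "\<tau> j = j + 1" for j :: nat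
  have c: "cls w = w - 1" for w using l by (simp add: cls_def)
  have T: "T = W - 1" using l by (simp add: T_def)
  have cl: "cls w \<le> T \<and> w \<le> \<tau> (cls w) \<and> real (\<tau> (cls w)) \<le> (1 + 0) * real w"
    if w: "1 \<le> w" "w \<le> W" for w
    unfolding c T \<tau>_def using w by auto
  have t0: "\<tau> 0 = 1" by (simp add: \<tau>_def)
  have tm: "\<tau> j \<le> \<tau> (Suc j)" for j by (simp add: \<tau>_def)
  have gp: "gap j = \<tau> (Suc j) - \<tau> j" for j using l by (simp add: gap_def \<tau>_def)
  have Gt: "G = \<tau> T - 1" using l by (simp add: G_def \<tau>_def T)
  have "0 \<le> \<epsilon>" "0 \<le> (0::real)" using eps by auto
  from algorithm_correct[OF assms cl t0 tm gp Gt eta dev err this]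
  show ?thesis by blast
next
  case s: False
  then have ns: "n < 2 ^ W" by simp
  have a0: "a = 0" by (rule a_small[OF ns])
  \<comment> \<open>Half of \<open>\<epsilon>\<close> is spent on rounding, a quarter on this
    deviation and a quarter on the large components, with \<open>G \<le> 2 * W\<close>. As
    \<open>a\<close> is 0, the variance vanishes and every positive deviation satisfies Chebyshev's
    condition.\<close>
  define \<eta> where "\<eta> = \<epsilon> * (real n - 1) / (8 * real W)"
  have Wp: "0 < real W" using W2 by simp
  have eta: "\<eta> > 0" using eps n2 Wp by (simp add: \<eta>_def)
  have dev: "real T * real n * (2 ^ (a * L) - 1) \<le> \<eta>\<^sup>2 / 12" by (simp add: a0)
  have G: "real G \<le> 2 * real W" using s GB_le by (simp add: G_def)
  have err: "real G * (\<eta> + real (n div (L + 1)) / 2) \<le> (\<epsilon> - \<epsilon> / 2) * (real n - 1)"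
  proof -
    have e1: "real G * \<eta> \<le> \<epsilon> / 4 * (real n - 1)"
    proof -
      have "real G * \<eta> \<le> 2 * real W * \<eta>" using G eta by (intro mult_right_mono) auto
      also have "\<dots> = \<epsilon> / 4 * (real n - 1)" using Wp by (simp add: \<eta>_def)
      finally show ?thesis .
    qed
    have e2: "real G * (real (n div (L + 1)) / 2) \<le> \<epsilon> / 4 * (real n - 1)"
    proof (cases "n \<le> LB")
      case True
      \<comment> \<open>Every component is small then, and \<open>n div (L + 1)\<close> is
        0.\<close>
      then have "L = n" using s by (simp add: L_def)
      then show ?thesis using eps n2 by simp
    next
      case False
      then have L: "L = LB" using s by (simp add: L_def)
      have "real (n div (L + 1)) \<le> real n / real (L + 1)" by (rule of_nat_div_le_of_nat)
      also have "\<dots> \<le> real n / (8 * real W / \<epsilon>)"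
        using LB_ge L eps Wp by (intro divide_left_mono) auto
      also have "\<dots> = real n * \<epsilon> / (8 * real W)" by simp
      finally have "real G * (real (n div (L + 1)) / 2) \<le> 2 * real W * (real n * \<epsilon> / (8 * real W) / 2)"
        using G by (intro mult_mono) (auto simp: mult.commute)
      also have "\<dots> = \<epsilon> / 4 * (real n / 2)" using Wp by simp
      also have "\<dots> \<le> \<epsilon> / 4 * (real n - 1)" using eps n2 by (intro mult_left_mono) auto
      finally show ?thesis .
    qed
    show ?thesis using e1 e2 by (simp add: algebra_simps)
  qed
  have c: "cls w = clB w" for w using s by (simp add: cls_def)
  have T: "T = TB" using s by (simp add: T_def)
  have cl: "cls w \<le> T \<and> w \<le> \<tau>B (cls w) \<and> real (\<tau>B (cls w)) \<le> (1 + \<epsilon> / 2) * real w"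
    if w: "1 \<le> w" "w \<le> W" for w
    unfolding c T using clB_mono[OF w(2)] clB_bounds[OF w(1)] \<tau>B_bounds(1)[of "clB w"]
      \<tau>B_bounds(2)[of w "clB w"]
    by (auto simp: \<beta>_def[symmetric])
  have t0: "\<tau>B 0 = 1" by (simp add: \<tau>B_def)
  have gp: "gap j = \<tau>B (Suc j) - \<tau>B j" for j using s by (simp add: gap_def gapB_def)
  have Gt: "G = \<tau>B T - 1" using s by (simp add: G_def GB_def T)
  have "\<epsilon> / 2 \<le> \<epsilon>" "0 \<le> \<epsilon> / 2" using eps by auto
  from algorithm_correct[OF assms cl t0 \<tau>B_mono gp Gt eta dev err this]
  show ?thesis by blast
qed

end

section \<open>Asymptotic bound on the space\<close>

definition class_const :: "real \<Rightarrow> real" where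
  "class_const \<epsilon> = 1 / ln (1 + \<epsilon> / 2) + 1"

text \<open>The factor of \<open>W * lg ^ 2\<close> in the bound on \<open>N * T\<close> for
  \<open>n < 2 ^ W\<close>. Its summands stem from the three terms 5, \<open>T\<close> and
  \<open>2 * (L + 2) * lg\<close> of the bound on \<open>N\<close>, each multiplied by
  \<open>T\<close>.\<close>

definition small_const :: "real \<Rightarrow> real" where
  "small_const \<epsilon> = 10 * class_const \<epsilon> + 4 * (class_const \<epsilon>)\<^sup>2 + 12 * class_const \<epsilon> * real (nat \<lceil>9 / \<epsilon>\<rceil>)"

definition space_const :: "real \<Rightarrow> real" where
  "space_const \<epsilon> = 223200 * (1 / \<epsilon>) ^ 3 + 384 * small_const \<epsilon> + real (nat \<lceil>9 / \<epsilon>\<rceil>) + 2"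

lemma small_const_nonneg:
  assumes "0 < \<epsilon>"
  shows "0 \<le> small_const \<epsilon>"
proof -
  have "0 \<le> class_const \<epsilon>" using assms by (simp add: class_const_def)
  then show ?thesis unfolding small_const_def by (intro add_nonneg_nonneg mult_nonneg_nonneg) auto
qed

lemma space_const_pos:
  assumes "0 < \<epsilon>"
  shows "0 < space_const \<epsilon>"
proof -
  have "0 < 223200 * (1 / \<epsilon>) ^ 3" using assms by simp
  then show ?thesis unfolding space_const_def using small_const_nonneg[OF assms] by linarith
qed

context instance_parameters
begin

definition lg :: real where "lg = log 2 (real n)"
definition Y :: real where "Y = real n powr (1 - x)"

lemma lg1: "1 \<le> lg"
  using le_log2_of_power_le[of 1 n] n2 by (simp add: lg_def)

lemma lg_pow: "1 \<le> lg ^ k" by (rule one_le_power[OF lg1])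

lemma Y1: "1 \<le> Y"
  unfolding Y_def using n2 x_less by (intro ge_one_powr_ge_zero) auto

text \<open>By minimality \<open>2 ^ (N - 1) < Z\<close>. In the constant 5, the logarithm of 12
  takes 4 and the minimality 1; the factor 2 before \<open>L + 2\<close> comes from
  \<open>n + 1 \<le> n ^ 2\<close>.\<close>

lemma N_le: "real N \<le> 5 + real T + 2 * (real L + 2) * lg"
proof -
  have "2 ^ (N - 1) < Z" using N2 by (intro N_least(2)) simp
  then have "real (2 ^ (N - 1)) < real Z" by (simp only: of_nat_less_iff)
  then have "log 2 (2 ^ (N - 1)) < log 2 (real Z)" by (subst log_less_cancel_iff) (auto intro: less_trans[of 0 "2 ^ (N - 1)"])
  then have 1: "real N - 1 < log 2 (real Z)" using N2 by (simp add: of_nat_diff)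
  have Tp: "0 < real T" using T1 by simp
  define Q where "Q = (real n + 1) ^ (L + 2)"
  have Qp: "0 < Q" unfolding Q_def by (intro zero_less_power) simp
  have "real Z = real (12 * T * (n + 1) ^ (L + 2))" by (simp only: Z_def)
  then have "real Z = 12 * real T * Q"
    by (simp only: Q_def of_nat_mult of_nat_power of_nat_add of_nat_1 of_nat_numeral)
  then have "log 2 (real Z) = log 2 12 + log 2 (real T) + log 2 Q" using Tp Qp by (simp add: log_mult)
  moreover have "log 2 Q = real (L + 2) * log 2 (real n + 1)" unfolding Q_def by (rule log_nat_power) simp
  ultimately have 2: "log 2 (real Z) = log 2 12 + log 2 (real T) + (real L + 2) * log 2 (real n + 1)" by simp
  have "log 2 12 \<le> log 2 (2 ^ 4)" by (subst log_le_cancel_iff) auto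
  then have 3: "log 2 12 \<le> (4::real)" by (simp only: log_pow_cancel)
  have 4: "log 2 (real T) \<le> real T"
  proof -
    have "T < 2 ^ T" by (rule less_exp)
    then have "real T < real (2 ^ T)" by (simp only: of_nat_less_iff)
    then have "log 2 (real T) \<le> log 2 (2 ^ T)" using Tp by (subst log_le_cancel_iff) auto
    then show ?thesis by simp
  qed
  have 5: "log 2 (real n + 1) \<le> 2 * lg"
  proof -
    have n2': "2 \<le> real n" using n2 by simp
    then have "2 * real n \<le> real n * real n" by (intro mult_right_mono) auto
    then have "real n + 1 \<le> real n ^ 2" using n2' unfolding power2_eq_square by linarith
    then have "log 2 (real n + 1) \<le> log 2 (real n ^ 2)" using n2' by (subst log_le_cancel_iff) auto
    also have "\<dots> = 2 * lg" using n2' by (simp add: lg_def log_nat_power)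
    finally show ?thesis .
  qed
  have "(real L + 2) * log 2 (real n + 1) \<le> (real L + 2) * (2 * lg)" using 5 by (intro mult_left_mono) auto
  then show ?thesis using 1 2 3 4 by (simp add: algebra_simps)
qed

lemma EE_le: "real EE \<le> 10 / \<epsilon>"
proof -
  have "real EE \<le> 9 / \<epsilon> + 1" unfolding EE_def using eps by (simp add: of_nat_ceiling)
  also have "\<dots> \<le> 9 / \<epsilon> + 1 / \<epsilon>"
  proof -
    have "1 \<le> 1 / \<epsilon>" using eps by simp
    then show ?thesis by linarith
  qed
  also have "\<dots> = 10 / \<epsilon>" by (simp only: add_divide_distrib[symmetric]) simp
  finally show ?thesis .
qed

text \<open>Here \<open>W \<le> lg\<close>, so \<open>T\<close>, \<open>L\<close> and
  \<open>CA\<close> are polynomial in \<open>lg\<close>. The exponent 6 consists of 2 for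
  \<open>N\<close>, 3 for the sample size through \<open>CA\<close>, and 1 for
  \<open>T\<close>.\<close>

lemma D_large:
  assumes l: "2 ^ W \<le> n"
  shows "real D + 1 \<le> 223200 * (1 / \<epsilon>) ^ 3 * Y * lg ^ 6"
proof -
  define s where "s = 1 / \<epsilon>"
  have s1: "1 \<le> s" using eps by (simp add: s_def)
  have Wl: "real W \<le> lg" unfolding lg_def by (rule le_log2_of_power_le[OF l])
  have W1: "1 \<le> real W" using W2 by simp
  have lg2: "1 \<le> lg ^ 2" "lg \<le> lg ^ 2" "lg \<le> lg ^ 6" "lg ^ 3 \<le> lg ^ 6"
    using lg1 power_increasing[of 1 2 lg] power_increasing[of 1 6 lg] power_increasing[of 3 6 lg] lg_pow[of 2] by auto
  have Tl: "real T \<le> lg" using l Wl by (simp add: T_def)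
  have Ll: "real L \<le> lg * s"
  proof -
    have "real L \<le> 1 / x" using l LA_le by (simp add: L_def)
    also have "\<dots> = (real W - 1) * s" by (simp add: x_def s_def)
    also have "\<dots> \<le> lg * s" using Wl s1 by (intro mult_right_mono) auto
    finally show ?thesis .
  qed
  have Nl: "real N \<le> 12 * s * lg ^ 2"
  proof -
    have "2 * (real L + 2) * lg \<le> 2 * (lg * s + 2) * lg" using Ll lg1 by (intro mult_right_mono) auto
    also have "\<dots> = 2 * s * lg ^ 2 + 4 * lg" by (simp add: power2_eq_square algebra_simps)
    finally have "real N \<le> 5 + lg + 2 * s * lg ^ 2 + 4 * lg" using N_le Tl by linarith
    also have "\<dots> \<le> 10 * lg ^ 2 + 2 * s * lg ^ 2" using lg2 by linarith
    also have "\<dots> \<le> 10 * (s * lg ^ 2) + 2 * s * lg ^ 2"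
    proof -
      have "1 * lg ^ 2 \<le> s * lg ^ 2" using s1 by (intro mult_right_mono) auto
      then show ?thesis by simp
    qed
    finally show ?thesis by (simp add: algebra_simps)
  qed
  have CAl: "real CA \<le> 193 * s ^ 2 * lg ^ 3"
  proof -
    have "real CA \<le> 193 * real W ^ 3 * s ^ 2" using CA_le by (simp add: s_def power_divide)
    also have "\<dots> \<le> 193 * lg ^ 3 * s ^ 2"
      using Wl W1 by (intro mult_right_mono mult_left_mono power_mono) auto
    finally show ?thesis by (simp add: algebra_simps)
  qed
  \<comment> \<open>From \<open>n < CA * 2 ^ ((a + 1) * L) \<le> (CA * 2 ^ (a + 1)) ^ L\<close> and
    \<open>x \<le> 1 / L\<close>, taking the \<open>L\<close>-th root gives
    \<open>n powr x \<le> 2 * CA * 2 ^ a\<close>.\<close>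
  have na: "real n / 2 ^ a \<le> 2 * real CA * Y"
  proof -
    have L: "L = LA" "1 \<le> real L" using l LA1 by (auto simp: L_def)
    have np: "0 < real n" using n2 by simp
    have CAp: "1 \<le> real CA" using CA1 by simp
    have "real n < real (CA * 2 ^ ((a + 1) * L))" using a_large(1)[OF l] by (simp only: of_nat_less_iff)
    then have "real n < real CA * 2 ^ ((a + 1) * L)" by (simp only: of_nat_mult of_nat_power of_nat_numeral)
    then have "real n < real CA * (2 ^ (a + 1)) ^ L" unfolding power_mult .
    also have "\<dots> \<le> real CA ^ L * (2 ^ (a + 1)) ^ L"
      using CAp L(2) power_increasing[of 1 L "real CA"] by (intro mult_right_mono) auto
    also have "\<dots> = (real CA * 2 ^ (a + 1)) ^ L" by (simp only: power_mult_distrib)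
    finally have lt: "real n \<le> (real CA * 2 ^ (a + 1)) powr real L"
      using CAp by (simp add: powr_realpow)
    have "real n powr x \<le> real n powr (1 / real L)"
    proof (rule powr_mono)
      have "real L \<le> 1 / x" using L LA_le by simp
      then have "x * real L \<le> 1" using x_pos by (simp add: le_divide_eq mult.commute)
      then show "x \<le> 1 / real L" using L(2) by (simp add: le_divide_eq)
    qed (use n2 in simp)
    also have "\<dots> \<le> ((real CA * 2 ^ (a + 1)) powr real L) powr (1 / real L)"
      using lt L(2) by (intro powr_mono2) auto
    also have "\<dots> = real CA * 2 ^ (a + 1)" using L(2) CAp by (simp add: powr_powr)
    finally have q: "real n powr x \<le> real CA * 2 ^ (a + 1)" .
    have "real n = Y * real n powr x" unfolding Y_def using np by (simp add: powr_add[symmetric])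
    also have "\<dots> \<le> Y * (real CA * 2 ^ (a + 1))" using q Y1 by (intro mult_left_mono) auto
    also have "\<dots> = 2 * real CA * Y * 2 ^ a" by simp
    finally show ?thesis by (simp add: divide_le_eq)
  qed
  have capl: "real cap \<le> 4644 * s ^ 2 * lg ^ 3 * Y"
  proof -
    have "real (n div 2 ^ a) \<le> real n / 2 ^ a" using of_nat_div_le_of_nat[of n "2 ^ a", where 'a = real] by simp
    also have "\<dots> \<le> 2 * real CA * Y" by (rule na)
    also have "\<dots> \<le> 2 * (193 * s ^ 2 * lg ^ 3) * Y" using CAl Y1 by (intro mult_right_mono mult_left_mono) auto
    finally have 1: "real (n div 2 ^ a) \<le> 386 * (s ^ 2 * lg ^ 3 * Y)" by simp
    have "1 * 1 \<le> s ^ 2 * lg ^ 3"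
      using lg_pow[of 3] one_le_power[OF s1, of 2] by (intro mult_mono) auto
    then have "1 * 1 \<le> s ^ 2 * lg ^ 3 * Y"
      using Y1 by (intro mult_mono[of 1 "s ^ 2 * lg ^ 3" 1 Y]) auto
    then have "real cap \<le> 12 * (387 * (s ^ 2 * lg ^ 3 * Y))" using 1 by (simp add: cap_def)
    then show ?thesis by simp
  qed
  define R where "R = s ^ 3 * Y * lg ^ 6"
  have s3: "1 \<le> s ^ 3" "s \<le> s ^ 3" "s ^ 2 \<le> s ^ 3"
    using one_le_power[OF s1, of 3] power_increasing[of 1 3 s] power_increasing[of 2 3 s] s1 by auto
  have RI: "u * v * w \<le> R" if "u \<le> s ^ 3" "v \<le> Y" "w \<le> lg ^ 6" "0 \<le> u" "0 \<le> v" "0 \<le> w" for u v w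
    unfolding R_def using that s1 Y1 by (intro mult_mono) (auto intro!: mult_nonneg_nonneg)
  \<comment> \<open>The product of the constants is 222912; the difference to 223200 absorbs the
    lower terms of \<open>D\<close>.\<close>
  have "4 * real N * real cap * real T \<le> 4 * (12 * s * lg ^ 2) * (4644 * s ^ 2 * lg ^ 3 * Y) * lg"
    using Nl capl Tl s1 lg1 Y1 by (intro mult_mono) auto
  also have "\<dots> = 222912 * R" unfolding R_def by (simp add: eval_nat_numeral algebra_simps)
  finally have 1: "4 * real N * real cap * real T \<le> 222912 * R" .
  have 2: "real W \<le> R" using RI[of 1 1 "real W"] Wl lg2 s3 Y1 by auto
  have 3: "real EE \<le> 10 * R"
  proof -
    have "s * 1 * 1 \<le> R" using s3 Y1 lg_pow[of 6] s1 by (intro RI) auto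
    moreover have "real EE \<le> 10 * s" using EE_le by (simp add: s_def)
    ultimately show ?thesis by simp
  qed
  have 4: "real CA \<le> 193 * R"
    using RI[of "s ^ 2" 1 "lg ^ 3"] CAl s3 Y1 lg2 lg1 by (auto simp: mult.assoc)
  have 5: "1 \<le> R" using RI[of 1 1 1] s3 Y1 lg_pow[of 6] by auto
  have "real D = 4 * real N * real cap * real T + real W + real EE + real CA" using l by (simp add: D_def)
  then have "real D + 1 \<le> 223200 * R" using 1 2 3 4 5 by linarith
  then show ?thesis by (simp add: R_def s_def mult.assoc)
qed

text \<open>Only one factor \<open>W\<close> is allowed, although \<open>N\<close> contains
  \<open>L * lg\<close> with \<open>L\<close> up to the order of \<open>W\<close> and is multiplied
  by \<open>T\<close>, which is logarithmic in \<open>W\<close>. If \<open>W \<le> n ^ 2\<close>,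
  this logarithm is at most proportional to \<open>lg\<close>; otherwise
  \<open>L \<le> n \<le> sqrt W\<close>, and \<open>T\<close> is at most of order
  \<open>sqrt W\<close>.\<close>

lemma D_small:
  assumes l: "n < 2 ^ W"
  shows "real D + 1 \<le> (384 * small_const \<epsilon> + real EE + 2) * real W * Y * lg ^ 2"
proof -
  define c where "c = class_const \<epsilon>"
  define q where "q = 1 + ln (real W)"
  have Wr: "2 \<le> real W" using W2 by simp
  have lb: "0 < ln \<beta>" using beta by simp
  have c1: "1 \<le> c" using lb by (simp add: c_def class_const_def \<beta>_def[symmetric])
  have q1: "1 \<le> q" using Wr by (simp add: q_def)
  have qs: "q \<le> 2 * sqrt (real W)" unfolding q_def using Wr by (intro one_add_ln_le_sqrt) simp
  have sq: "sqrt (real W) * sqrt (real W) = real W" by simp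
  have sqW: "sqrt (real W) \<le> real W"
    using Wr real_sqrt_le_mono[of "real W" "real W * real W"] by simp
  have Tq: "real T \<le> c * q"
  proof -
    have "real T < log \<beta> W + 1" using clB_bounds(2)[of W] W2 l by (simp add: T_def TB_def)
    also have "\<dots> = ln W * (1 / ln \<beta>) + 1" by (simp add: log_def)
    also have "\<dots> \<le> c * q"
    proof -
      have "c * q = (1 / ln \<beta> + 1) * (1 + ln W)" by (simp add: c_def class_const_def \<beta>_def q_def)
      also have "\<dots> = ln W * (1 / ln \<beta>) + 1 + (1 / ln \<beta> + ln W)" by (simp add: algebra_simps add_divide_distrib)
      finally show ?thesis using lb Wr by simp
    qed
    finally show ?thesis by simp
  qed
  have Ts: "real T \<le> 2 * c * sqrt W"
  proof -
    have "c * q \<le> c * (2 * sqrt W)" using qs c1 by (intro mult_left_mono) auto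
    then show ?thesis using Tq by simp
  qed
  have TW: "real T \<le> 2 * c * W"
  proof -
    have "2 * c * sqrt W \<le> 2 * c * W" using sqW c1 by (intro mult_left_mono) auto
    then show ?thesis using Ts by linarith
  qed
  have T2: "real T * real T \<le> 4 * c ^ 2 * W"
  proof -
    have "real T * real T \<le> (2 * c * sqrt W) * (2 * c * sqrt W)" using Ts c1 by (intro mult_mono) auto
    also have "\<dots> = 4 * c ^ 2 * (sqrt W * sqrt W)" by (simp add: power2_eq_square)
    finally show ?thesis using sq by simp
  qed
  have lgn: "ln (real n) \<le> lg"
  proof -
    have "ln 2 \<le> (1::real)" using ln_2_less_1 by simp
    then have "lg * ln 2 \<le> lg * 1" using lg1 by (intro mult_left_mono) auto
    then show ?thesis by (simp add: lg_def log_def)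
  qed
  have EE1: "9 \<le> real EE" using EE9 by simp
  have LT: "(real L + 2) * real T \<le> 6 * c * real EE * W * lg"
  proof (cases "W \<le> n ^ 2")
    case True
    have "ln (real W) \<le> ln (real n ^ 2)"
    proof (subst ln_le_cancel_iff)
      show "real W \<le> real n ^ 2" using True by (metis of_nat_le_iff of_nat_power)
    qed (use Wr n2 in auto)
    also have "\<dots> = 2 * ln (real n)" using n2 by (simp add: ln_realpow)
    finally have "q \<le> 3 * lg" using lgn lg1 by (simp add: q_def)
    then have "c * q \<le> c * (3 * lg)" using c1 by (intro mult_left_mono) auto
    then have T3: "real T \<le> 3 * c * lg" using Tq by simp
    have "L \<le> W * EE" using l LB_le by (simp add: L_def)
    then have "real L \<le> real W * real EE" by (metis of_nat_le_iff of_nat_mult)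
    moreover have "2 * 1 \<le> real W * real EE" using Wr EE1 by (intro mult_mono) auto
    ultimately have L2: "real L + 2 \<le> 2 * (real W * real EE)" by linarith
    have "(real L + 2) * real T \<le> (2 * (real W * real EE)) * (3 * c * lg)"
      using L2 T3 by (intro mult_mono) auto
    then show ?thesis by (simp add: algebra_simps)
  next
    case False
    then have "real (n ^ 2) \<le> real W" by (simp only: of_nat_le_iff)
    then have ns: "real n \<le> sqrt W" by (intro real_le_rsqrt) simp
    have "L \<le> n" using l by (simp add: L_def)
    then have "real L + 2 \<le> 2 * sqrt W" using ns n2 by linarith
    then have "(real L + 2) * real T \<le> (2 * sqrt W) * (2 * c * sqrt W)"
      using Ts by (intro mult_mono) auto
    also have "\<dots> = 4 * c * (sqrt W * sqrt W)" by simp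
    also have "\<dots> = 4 * c * W * 1 * 1" using sq by simp
    also have "\<dots> \<le> 6 * c * W * real EE * lg"
      using c1 EE1 lg1 by (intro mult_mono) auto
    finally show ?thesis by (simp add: algebra_simps)
  qed
  define K where "K = small_const \<epsilon>"
  have K: "K = 10 * c + 4 * c ^ 2 + 12 * c * real EE"
    by (simp add: K_def small_const_def c_def EE_def)
  have K0: "0 \<le> K" unfolding K using c1 by simp
  have NT: "real N * real T \<le> K * W * lg ^ 2"
  proof -
    have "real N * real T \<le> (5 + real T + 2 * (real L + 2) * lg) * real T"
      using N_le by (intro mult_right_mono) auto
    also have "\<dots> = 5 * real T + real T * real T + 2 * lg * ((real L + 2) * real T)" by (simp add: algebra_simps)
    also have "\<dots> \<le> 5 * (2 * c * W) + 4 * c ^ 2 * W + 2 * lg * (6 * c * real EE * W * lg)"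
      using TW T2 LT lg1 by (intro add_mono mult_left_mono) auto
    also have "\<dots> = (10 * c + 4 * c ^ 2) * W * 1 + 12 * c * real EE * W * lg ^ 2"
      by (simp add: power2_eq_square algebra_simps)
    also have "\<dots> \<le> (10 * c + 4 * c ^ 2) * W * lg ^ 2 + 12 * c * real EE * W * lg ^ 2"
      using c1 lg_pow[of 2] by (intro add_mono mult_left_mono) auto
    also have "\<dots> = K * W * lg ^ 2" by (simp add: K algebra_simps)
    finally show ?thesis .
  qed
  \<comment> \<open>Keeping all vertices costs no more than a factor 4: \<open>n < 2 ^ W\<close> and
    \<open>W * x \<le> 2\<close> give \<open>n powr x \<le> 4\<close>.\<close>
  have nY: "real n \<le> 4 * Y"
  proof -
    have np: "0 < real n" using n2 by simp
    have "real n < real (2 ^ W)" using l by (simp only: of_nat_less_iff)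
    then have nW: "real n \<le> 2 powr real W" by (simp add: powr_realpow)
    have "real n powr x \<le> (2 powr real W) powr x" using nW x_pos by (intro powr_mono2) auto
    also have "\<dots> = 2 powr (real W * x)" by (simp add: powr_powr)
    also have "\<dots> \<le> 2 powr 2"
    proof (rule powr_mono)
      have "real W * \<epsilon> \<le> real W * 1" using eps by (intro mult_left_mono) auto
      also have "\<dots> \<le> 2 * (real W - 1)" using Wr by simp
      finally show "real W * x \<le> 2" using Wr by (simp add: x_def divide_le_eq)
    qed simp
    finally have q: "real n powr x \<le> 4" by simp
    have "real n = Y * real n powr x" unfolding Y_def using np by (simp add: powr_add[symmetric])
    also have "\<dots> \<le> Y * 4" using q Y1 by (intro mult_left_mono) auto
    finally show ?thesis by simp
  qed
  have capY: "real cap \<le> 96 * Y"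
    using nY n2 a_small[OF l] by (simp add: cap_def)
  define R where "R = real W * Y * lg ^ 2"
  have RI: "real W * 1 * 1 \<le> R" unfolding R_def using Y1 lg_pow[of 2] by (intro mult_mono) auto
  have R1: "1 \<le> R" "real W \<le> R" using RI Wr by auto
  have "4 * real N * real cap * real T = 4 * real cap * (real N * real T)" by simp
  also have "\<dots> \<le> 4 * (96 * Y) * (K * W * lg ^ 2)"
    using capY Y1 by (intro mult_mono[OF _ NT]) auto
  also have "\<dots> = 384 * K * R" by (simp add: R_def)
  finally have 1: "4 * real N * real cap * real T \<le> 384 * K * R" .
  have 2: "real EE \<le> real EE * R" using R1 mult_left_mono[of 1 R "real EE"] by simp
  have "real D + 1 = 4 * real N * real cap * real T + real W + real EE + 1" using l by (simp add: D_def)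
  also have "\<dots> \<le> (384 * K + real EE + 2) * R" using 1 2 R1 by (simp add: algebra_simps)
  finally show ?thesis by (simp add: K_def R_def mult.assoc)
qed

lemma D_bound: "real D + 1 \<le> space_const \<epsilon> * real W * Y * lg ^ 6"
proof (cases "2 ^ W \<le> n")
  case True
  have sc: "223200 * (1 / \<epsilon>) ^ 3 \<le> space_const \<epsilon>"
    using small_const_nonneg[OF eps(1)] unfolding space_const_def by simp
  have "223200 * (1 / \<epsilon>) ^ 3 * 1 \<le> space_const \<epsilon> * real W"
    using sc eps W2 order_trans[OF _ sc, of 0] by (intro mult_mono) auto
  then have "223200 * (1 / \<epsilon>) ^ 3 * (Y * lg ^ 6) \<le> space_const \<epsilon> * real W * (Y * lg ^ 6)"
    using Y1 lg1 by (intro mult_right_mono) auto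
  then show ?thesis using D_large[OF True] by (simp add: mult.assoc)
next
  case False
  then have l: "n < 2 ^ W" by simp
  have sc: "384 * small_const \<epsilon> + real EE + 2 \<le> space_const \<epsilon>"
    using eps by (simp add: space_const_def EE_def)
  have sc0: "0 \<le> 384 * small_const \<epsilon> + real EE + 2"
    using small_const_nonneg[OF eps(1)] by simp
  have lg26: "lg ^ 2 \<le> lg ^ 6" using lg1 by (intro power_increasing) auto
  have "(384 * small_const \<epsilon> + real EE + 2) * (real W * Y * lg ^ 2) \<le> space_const \<epsilon> * (real W * Y * lg ^ 6)"
    using sc sc0 lg26 Y1 lg1 by (intro mult_mono mult_left_mono) auto
  then show ?thesis using D_small[OF l] by (simp add: mult.assoc)
qed

end

section \<open>The theorem\<close>

text \<open>The program \<open>Skip\<close> leaves nothing but the current item in memory, in four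
  cells with values at most \<open>n + W\<close>.\<close>

lemma trivial_stream:
  assumes "weighted_graph_on n W g"
    and "\<And>i. i < length xs \<Longrightarrow> valid_item n W (fold apply_item (take i xs) g) (xs ! i)"
    and "bounded_memory 4 (n + W) (mem s)" "peak s \<le> space_bound 4 (n + W)"
  shows "\<exists>s'. process_stream Skip xs s = return_spmf s' \<and> bounded_memory 4 (n + W) (mem s') \<and>
    peak s' \<le> space_bound 4 (n + W)"
  using assms
proof (induction xs arbitrary: g s)
  case (Cons x xs)
  have vx: "valid_item n W g x" using Cons.prems(2)[of 0] by simp
  have bm: "bounded_memory 4 (n + W) ((mem s)(0 := c, 1 := u, 2 := v, 3 := w))"
    if "c \<le> 1" "u \<in> {1..n} \<and> v \<in> {1..n} \<and> u \<noteq> v \<and> w \<in> {1..W}" for c u v w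
    using that Cons.prems(3) by (intro bounded_memory_upd) auto
  have "bounded_memory 4 (n + W) (mem (read_item x s)) \<and> peak (read_item x s) \<le> space_bound 4 (n + W)"
  proof (cases x)
    case (Insertion u v w)
    then show ?thesis
      using bm[of 1 u v w] valid_item_bounds[OF Cons.prems(1) vx, of u v w] memory_bits_le[OF bm[of 1 u v w]] Cons.prems(4)
      by (simp add: set_mem_def)
  next
    case (Deletion u v w)
    then show ?thesis
      using bm[of 0 u v w] valid_item_bounds[OF Cons.prems(1) vx, of u v w] memory_bits_le[OF bm[of 0 u v w]] Cons.prems(4)
      by (simp add: set_mem_def)
  qed
  moreover have "valid_item n W (fold apply_item (take i xs) (apply_item x g)) (xs ! i)" if "i < length xs" for i
    using Cons.prems(2)[of "Suc i"] that by simp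
  ultimately show ?case
    using Cons.IH[OF weighted_graph_on_apply[OF Cons.prems(1) vx]] by simp
qed simp

lemma bits_le_log:
  assumes "1 \<le> m"
  shows "real (bits m) \<le> log 2 m + 1"
proof -
  have "0 \<le> log 2 (real m)" using assms by simp
  then show ?thesis using assms by (simp add: bits_def floorlog_def)
qed

text \<open>The numerator 0 gives the answer 0 whatever the denominator, even 0, and its error is
  the true value itself, which \<open>\<epsilon> \<ge> 1\<close> permits. The length of one item is
  logarithmic in \<open>n\<close> and \<open>W\<close> and is covered by the product of
  \<open>W\<close> and the logarithm of \<open>n\<close>.\<close>

lemma trivial_algorithm:
  fixes n W :: nat and \<epsilon> :: real
  defines "A \<equiv> Stream_Algorithm Skip Skip (Const 0 0)"
  assumes n: "2 \<le> n" and W: "2 \<le> W" and e: "1 \<le> \<epsilon>" and xs: "valid_stream n W xs"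
  shows "lossless_spmf (run_stream A n xs)"
    and "\<forall>s\<in>set_spmf (run_stream A n xs). real (peak s) \<le> 28 * real W * log 2 n \<and> real (time s) \<le> 28 * real W * log 2 n"
    and "measure (measure_spmf (run_stream A n xs)) {s. approximates \<epsilon> (real X) (result s)} = 1"
proof -
  have b0: "bounded_memory 4 (n + W) (mem (start_config n))"
    unfolding bounded_memory_def by (simp add: start_config_def set_mem_def)
  then have p0: "peak (start_config n) \<le> space_bound 4 (n + W)"
    using memory_bits_le[OF b0] by (simp add: start_config_def set_mem_def)
  have "valid_item n W (fold apply_item (take i xs) (\<lambda>_. None)) (xs ! i)" if "i < length xs" for i
    using xs that by (simp add: valid_stream_def final_graph_def)
  from trivial_stream[OF weighted_graph_on_empty this b0 p0]
  obtain s where s: "process_stream Skip xs (start_config n) = return_spmf s"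
    "bounded_memory 4 (n + W) (mem s)" "peak s \<le> space_bound 4 (n + W)" by blast
  define s' where "s' = assign 0 0 0 (s\<lparr>time := 0\<rparr>)"
  have run: "run_stream A n xs = return_spmf s'" by (simp add: run_stream_def A_def s s'_def)
  show "lossless_spmf (run_stream A n xs)" by (simp add: run)
  have "bounded_memory 4 (n + W) ((mem s)(0 := 0))" using s(2) by (intro bounded_memory_upd) auto
  then have pk: "peak s' \<le> space_bound 4 (n + W)" using s(3) memory_bits_le by (simp add: s'_def)
  have bts: "bits 4 = 3" "bits 0 = 1" by (simp_all add: bits_def compute_floorlog)
  have tm: "time s' = 2" by (simp add: s'_def assign_def set_mem_def charge_def bts)
  have lg: "1 \<le> log 2 (real n)" using le_log2_of_power_le[of 1 n] n by simp
  have W1: "2 \<le> real W" using W by simp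
  have "n + W \<le> n * W"
  proof -
    obtain i j where "n = i + 2" "W = j + 2" using n W by (metis add.commute le_Suc_ex)
    then show ?thesis by (simp add: algebra_simps)
  qed
  then have "log 2 (real (n + W)) \<le> log 2 (real n * real W)"
    using n W by (subst log_le_cancel_iff) (auto simp flip: of_nat_mult of_nat_add)
  also have "\<dots> = log 2 n + log 2 W" using n W by (simp add: log_mult)
  also have "log 2 (real W) \<le> real W"
  proof -
    have "real W < real (2 ^ W)" using less_exp[of W] by (simp only: of_nat_less_iff)
    then have "log 2 (real W) \<le> log 2 (2 ^ W)" using W by (subst log_le_cancel_iff) auto
    then show ?thesis by simp
  qed
  finally have "log 2 (real (n + W)) \<le> log 2 n + real W" by simp
  then have "real (bits (n + W)) \<le> log 2 n + real W + 1" using bits_le_log[of "n + W"] n by simp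
  then have sb: "real (space_bound 4 (n + W)) \<le> 4 * (4 + log 2 n + real W)" by (simp add: space_bound_def bts)
  define R where "R = real W * log 2 n"
  have WR: "real W \<le> R" "log 2 n \<le> R"
    unfolding R_def using W1 lg mult_left_mono[of 1 "log 2 n" "real W"] mult_right_mono[of 1 "real W" "log 2 n"]
    by auto
  have "4 * (4 + log 2 n + real W) \<le> 28 * R" using WR W1 by argo
  then have "real (space_bound 4 (n + W)) \<le> 28 * R" using sb by (rule order_trans[rotated])
  moreover have "2 \<le> 28 * R" using WR(1) W1 by argo
  ultimately have "real (space_bound 4 (n + W)) \<le> 28 * real W * log 2 n" "2 \<le> 28 * real W * log 2 n"
    by (simp_all only: R_def mult.assoc)
  then show "\<forall>s\<in>set_spmf (run_stream A n xs). real (peak s) \<le> 28 * real W * log 2 n \<and> real (time s) \<le> 28 * real W * log 2 n"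
    using pk tm by (auto simp: run)
  have "mem s' 0 = 0" by (simp add: s'_def)
  then have "approximates \<epsilon> (real X) (result s')"
    using e mult_right_mono[of 1 \<epsilon> "real X"] by (simp add: approximates_def result_def)
  then show "measure (measure_spmf (run_stream A n xs)) {s. approximates \<epsilon> (real X) (result s)} = 1"
    by (simp add: run measure_return_pmf indicator_def flip: spmf_of_pmf_return_pmf)
qed

theorem theorem3p4:
  fixes \<epsilon> :: real
  assumes "\<epsilon> > 0"
  shows "\<exists>(C::real) (k::nat). C > 0 \<and>
    (\<forall>(t::real) (W::nat). t \<ge> 1 \<longrightarrow> W \<ge> 2 \<longrightarrow>
      (\<exists>A. \<forall>n xs. n \<ge> 2 \<longrightarrow> valid_stream n W xs \<longrightarrow>
        graph_connected {1..n} (dom (final_graph xs)) \<longrightarrow>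
        (let bound = C * exp t * real W
               * real n powr (1 - \<epsilon> / (real W - 1) + \<epsilon> powr t / (real W - 1) powr t) * ln (real n) ^ k
         in lossless_spmf (run_stream A n xs)
          \<and> (\<forall>s \<in> set_spmf (run_stream A n xs). real (peak s) \<le> bound \<and> real (time s) \<le> bound)
          \<and> measure (measure_spmf (run_stream A n xs))
              {s. approximates \<epsilon> (real (mst_weight n (final_graph xs))) (result s)} \<ge> 2 / 3)))"
proof (cases "\<epsilon> < 1")
  case True
  \<comment> \<open>The factor 640 turns the exponent \<open>D\<close> into bits, and
    \<open>ln 2 ^ 6\<close> changes the base of the logarithm.\<close>
  define C where "C = 640 * space_const \<epsilon> / ln 2 ^ 6"
  have C: "C > 0" using space_const_pos[OF assms] by (simp add: C_def)
  show ?thesis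
  proof (rule exI[of _ C], rule exI[of _ 6], intro conjI allI impI C)
    fix t :: real and W :: nat
    assume t: "1 \<le> t" and W: "2 \<le> W"
    interpret parameters \<epsilon> W using assms True W by unfold_locales
    show "\<exists>A. \<forall>n xs. n \<ge> 2 \<longrightarrow> valid_stream n W xs \<longrightarrow> graph_connected {1..n} (dom (final_graph xs)) \<longrightarrow>
        (let bound = C * exp t * real W
               * real n powr (1 - \<epsilon> / (real W - 1) + \<epsilon> powr t / (real W - 1) powr t) * ln (real n) ^ 6
         in lossless_spmf (run_stream A n xs)
          \<and> (\<forall>s \<in> set_spmf (run_stream A n xs). real (peak s) \<le> bound \<and> real (time s) \<le> bound)
          \<and> measure (measure_spmf (run_stream A n xs))
              {s. approximates \<epsilon> (real (mst_weight n (final_graph xs))) (result s)} \<ge> 2 / 3)"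
    proof (rule exI[of _ algorithm], intro allI impI)
      fix n :: nat and xs
      assume n: "2 \<le> n" and xs: "valid_stream n W xs" and conn: "graph_connected {1..n} (dom (final_graph xs))"
      interpret instance_parameters \<epsilon> W n using n by unfold_locales
      define z where "z = real n powr (1 - \<epsilon> / (real W - 1) + \<epsilon> powr t / (real W - 1) powr t)"
      \<comment> \<open>The exponent of \<open>z\<close> exceeds that of \<open>Y\<close> by a
        quotient of powers, which is nonnegative.\<close>
      have Yz: "Y \<le> z"
        unfolding Y_def z_def x_def using n by (intro powr_mono) auto
      have "real SB = 640 * (real D + 1)" by (simp add: SB_eq)
      also have "\<dots> \<le> 640 * (space_const \<epsilon> * real W * Y * lg ^ 6)" using D_bound by simp
      also have "lg ^ 6 = ln (real n) ^ 6 / ln 2 ^ 6" by (simp add: lg_def log_def power_divide)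
      also have "640 * (space_const \<epsilon> * real W * Y * (ln (real n) ^ 6 / ln 2 ^ 6)) = C * 1 * real W * Y * ln (real n) ^ 6"
        by (simp add: C_def)
      also have "\<dots> \<le> C * exp t * real W * z * ln (real n) ^ 6"
        using C t Yz Y1 n by (intro mult_mono) auto
      finally have b: "real SB \<le> C * exp t * real W * z * ln (real n) ^ 6" .
      have "real y \<le> C * exp t * real W * z * ln (real n) ^ 6" if "y \<le> SB" for y
        using b that by linarith
      then show "let bound = C * exp t * real W
               * real n powr (1 - \<epsilon> / (real W - 1) + \<epsilon> powr t / (real W - 1) powr t) * ln (real n) ^ 6
         in lossless_spmf (run_stream algorithm n xs)
          \<and> (\<forall>s \<in> set_spmf (run_stream algorithm n xs). real (peak s) \<le> bound \<and> real (time s) \<le> bound)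
          \<and> measure (measure_spmf (run_stream algorithm n xs))
              {s. approximates \<epsilon> (real (mst_weight n (final_graph xs))) (result s)} \<ge> 2 / 3"
        using correct[OF xs conn] unfolding Let_def z_def by blast
    qed
  qed
next
  case False
  define C :: real where "C = 28 / ln 2"
  have C: "C > 0" by (simp add: C_def)
  show ?thesis
  proof (rule exI[of _ C], rule exI[of _ 1], intro conjI allI impI C)
    fix t :: real and W :: nat
    assume t: "1 \<le> t" and W: "2 \<le> W"
    define A where "A = Stream_Algorithm Skip Skip (Const 0 0)"
    show "\<exists>A. \<forall>n xs. n \<ge> 2 \<longrightarrow> valid_stream n W xs \<longrightarrow> graph_connected {1..n} (dom (final_graph xs)) \<longrightarrow>
        (let bound = C * exp t * real W
               * real n powr (1 - \<epsilon> / (real W - 1) + \<epsilon> powr t / (real W - 1) powr t) * ln (real n) ^ 1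
         in lossless_spmf (run_stream A n xs)
          \<and> (\<forall>s \<in> set_spmf (run_stream A n xs). real (peak s) \<le> bound \<and> real (time s) \<le> bound)
          \<and> measure (measure_spmf (run_stream A n xs))
              {s. approximates \<epsilon> (real (mst_weight n (final_graph xs))) (result s)} \<ge> 2 / 3)"
    proof (rule exI[of _ A], intro allI impI)
      fix n :: nat and xs
      assume n: "2 \<le> n" and xs: "valid_stream n W xs" and conn: "graph_connected {1..n} (dom (final_graph xs))"
      have e: "1 \<le> \<epsilon>" using False by simp
      note A = trivial_algorithm[OF n W e xs, folded A_def]
      define y where "y = \<epsilon> / (real W - 1)"
      have W1: "1 \<le> real W - 1" using W by simp
      have y0: "0 < y" using assms W1 by (simp add: y_def)
      have yt: "\<epsilon> powr t / (real W - 1) powr t = y powr t"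
        unfolding y_def using assms W1 by (subst powr_divide) auto
      \<comment> \<open>The exponent of \<open>n\<close> must be nonnegative also if
        \<open>y > 1\<close>, where \<open>1 - y\<close> is negative; then
        \<open>y powr t \<ge> y\<close> because \<open>t \<ge> 1\<close>.\<close>
      have "0 \<le> 1 - y + y powr t"
      proof (cases "y \<le> 1")
        case True
        then show ?thesis using y0 powr_ge_zero[of y t] by linarith
      next
        case False
        then have "y powr 1 \<le> y powr t" using t by (intro powr_mono) auto
        then show ?thesis using y0 by simp
      qed
      then have z: "1 \<le> real n powr (1 - \<epsilon> / (real W - 1) + \<epsilon> powr t / (real W - 1) powr t)"
        unfolding yt y_def[symmetric] using n by (intro ge_one_powr_ge_zero) auto
      have "28 * real W * log 2 n = C * 1 * real W * 1 * ln (real n) ^ 1" by (simp add: C_def log_def)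
      also have "\<dots> \<le> C * exp t * real W * real n powr (1 - \<epsilon> / (real W - 1) + \<epsilon> powr t / (real W - 1) powr t) * ln (real n) ^ 1"
        using C t z n by (intro mult_mono) auto
      finally have b: "28 * real W * log 2 n \<le> C * exp t * real W * real n powr (1 - \<epsilon> / (real W - 1) + \<epsilon> powr t / (real W - 1) powr t) * ln (real n) ^ 1" .
      show "let bound = C * exp t * real W
               * real n powr (1 - \<epsilon> / (real W - 1) + \<epsilon> powr t / (real W - 1) powr t) * ln (real n) ^ 1
         in lossless_spmf (run_stream A n xs)
          \<and> (\<forall>s \<in> set_spmf (run_stream A n xs). real (peak s) \<le> bound \<and> real (time s) \<le> bound)
          \<and> measure (measure_spmf (run_stream A n xs))
              {s. approximates \<epsilon> (real (mst_weight n (final_graph xs))) (result s)} \<ge> 2 / 3"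
        unfolding Let_def
      proof (intro conjI ballI)
        show "lossless_spmf (run_stream A n xs)" by (rule A(1))
        show "2 / 3 \<le> measure (measure_spmf (run_stream A n xs))
              {s. approximates \<epsilon> (real (mst_weight n (final_graph xs))) (result s)}"
          unfolding A(3) by simp
        fix s assume "s \<in> set_spmf (run_stream A n xs)"
        then have "real (peak s) \<le> 28 * real W * log 2 n" "real (time s) \<le> 28 * real W * log 2 n"
          using A(2) by blast+
        then show "real (peak s) \<le> C * exp t * real W * real n powr (1 - \<epsilon> / (real W - 1) + \<epsilon> powr t / (real W - 1) powr t) * ln (real n) ^ 1"
          "real (time s) \<le> C * exp t * real W * real n powr (1 - \<epsilon> / (real W - 1) + \<epsilon> powr t / (real W - 1) powr t) * ln (real n) ^ 1"
          using b by linarith+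
      qed
    qed
  qed
qed

end
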